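(* Let $n,m,l\in\mathbb{N}$, let $\Phi:\mathbb{M}_n\to\mathbb{M}_l$ and $\Psi:\mathbb{M}_m\to\mathbb{M}_l$ be strictly positive linear maps, let $f$ be a non-decreasing function on $(0,\infty)$ and $-1<p\le0$, and assume that $x\mapsto f(x^{1+p})$ is convex on $(0,\infty)$. Consider $$F_1(A,B):=\mathrm{Tr}\, f\bigl(\Phi(A^p)^{1/2}\Psi(B^q)\Phi(A^p)^{1/2}\bigr),\qquad F_2(A,B):=\mathrm{Tr}\, f\bigl((\Phi(A^{-p})^{1/2}\Psi(B^{-q})\Phi(A^{-p})^{1/2})^{-1}\bigr)$$ for $(A,B)\in\mathbb{P}_n\times\mathbb{P}_m$, where $q\in\mathbb{R}$ with $(p,q)\ne(0,0)$. Then: (1) For every $q\in[-1,0]\cup[1,2]$, $F_1$ is jointly convex. (2) For every $q\in[-1,0]$, $F_2$ is jointly convex. (3) If $m=l$ and $\Psi=\mathrm{id}$, then $F_2$ is jointly convex for every $q\in[1,2]$.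
   Context: $\mathbb{M}_n$: $n\times n$ complex matrices; $\mathbb{P}_n$: positive definite ones; $\mathrm{Tr}$: usual trace. A linear map is strictly positive if it maps positive definite matrices to positive definite matrices. *)

theory Defs
  imports "HOL-Analysis.Analysis"
begin

definition cadj :: "complex^'n^'m \<Rightarrow> complex^'m^'n" where
  "cadj A = (\<chi> i j. cnj (A $ j $ i))"

definition hermitian :: "complex^'n^'n \<Rightarrow> bool" where
  "hermitian A \<longleftrightarrow> cadj A = A"

definition unitary :: "complex^'n^'n \<Rightarrow> bool" where
  "unitary U \<longleftrightarrow> U ** cadj U = mat 1 \<and> cadj U ** U = mat 1"

definition posdef :: "complex^'n^'n \<Rightarrow> bool" where
  "posdef A \<longleftrightarrow> hermitian A \<and>
     (\<forall>x::complex^'n. x \<noteq> 0 \<longrightarrow> 0 < Re (\<Sum>i\<in>UNIV. \<Sum>j\<in>UNIV. cnj (x $ i) * A $ i $ j * x $ j))"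

definition rdiag :: "('n \<Rightarrow> real) \<Rightarrow> complex^'n^'n" where
  "rdiag d = (\<chi> i j. if i = j then complex_of_real (d i) else 0)"

text \<open>Functional calculus for Hermitian matrices: f(A) = U diag(f(lambda_i)) U*
  for a unitary diagonalisation A = U diag(lambda_i) U* (independent of the choice).\<close>
definition matfun :: "(real \<Rightarrow> real) \<Rightarrow> complex^'n^'n \<Rightarrow> complex^'n^'n" where
  "matfun f A = (SOME B. \<exists>U d. unitary U \<and> A = U ** rdiag d ** cadj U \<and>
                                 B = U ** rdiag (f \<circ> d) ** cadj U)"

definition cscale :: "complex \<Rightarrow> complex^'n^'m \<Rightarrow> complex^'n^'m" where
  "cscale c A = (\<chi> i j. c * A $ i $ j)"

definition clinear_map :: "(complex^'n^'n \<Rightarrow> complex^'l^'l) \<Rightarrow> bool" where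
  "clinear_map \<Phi> \<longleftrightarrow> (\<forall>A B. \<Phi> (A + B) = \<Phi> A + \<Phi> B) \<and> (\<forall>c A. \<Phi> (cscale c A) = cscale c (\<Phi> A))"

definition strictly_positive :: "(complex^'n^'n \<Rightarrow> complex^'l^'l) \<Rightarrow> bool" where
  "strictly_positive \<Phi> \<longleftrightarrow> (\<forall>A. posdef A \<longrightarrow> posdef (\<Phi> A))"

definition rtrace :: "complex^'n^'n \<Rightarrow> real" where
  "rtrace A = Re (trace A)"

definition mpow :: "complex^'n^'n \<Rightarrow> real \<Rightarrow> complex^'n^'n" where
  "mpow A r = matfun (\<lambda>x. x powr r) A"

definition F1 :: "(real \<Rightarrow> real) \<Rightarrow> (complex^'n^'n \<Rightarrow> complex^'l^'l) \<Rightarrow> (complex^'m^'m \<Rightarrow> complex^'l^'l)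
                  \<Rightarrow> real \<Rightarrow> real \<Rightarrow> complex^'n^'n \<Rightarrow> complex^'m^'m \<Rightarrow> real" where
  "F1 f \<Phi> \<Psi> p q A B =
     rtrace (matfun f (mpow (\<Phi> (mpow A p)) (1/2) ** \<Psi> (mpow B q) ** mpow (\<Phi> (mpow A p)) (1/2)))"

definition F2 :: "(real \<Rightarrow> real) \<Rightarrow> (complex^'n^'n \<Rightarrow> complex^'l^'l) \<Rightarrow> (complex^'m^'m \<Rightarrow> complex^'l^'l)
                  \<Rightarrow> real \<Rightarrow> real \<Rightarrow> complex^'n^'n \<Rightarrow> complex^'m^'m \<Rightarrow> real" where
  "F2 f \<Phi> \<Psi> p q A B =
     rtrace (matfun f (matrix_inv (mpow (\<Phi> (mpow A (-p))) (1/2) ** \<Psi> (mpow B (-q)) ** mpow (\<Phi> (mpow A (-p))) (1/2))))"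

definition jointly_convex :: "(complex^'n^'n \<Rightarrow> complex^'m^'m \<Rightarrow> real) \<Rightarrow> bool" where
  "jointly_convex F \<longleftrightarrow>
     (\<forall>A1 A2 B1 B2 t. posdef A1 \<and> posdef A2 \<and> posdef B1 \<and> posdef B2 \<and> 0 \<le> t \<and> t \<le> 1 \<longrightarrow>
        F (cscale (complex_of_real t) A1 + cscale (complex_of_real (1 - t)) A2)
          (cscale (complex_of_real t) B1 + cscale (complex_of_real (1 - t)) B2)
        \<le> t * F A1 B1 + (1 - t) * F A2 B2)"

end

theory Submission
  imports Defs "HOL-Complex_Analysis.Conformal_Mappings"
begin

text \<open>
  Put \<open>r = - p\<close> and \<open>s = 1 / (1 - r)\<close>. On a finite set, a non-decreasing convex function is a
  nonnegative combination of a constant and hinges \<open>x \<mapsto> max 0 (x - c)\<close>, so it suffices to treat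
  \<open>Tr (M\<^sup>s - c)\<^sub>+\<close> with \<open>M = X\<^bsup>1/2\<^esup> Y X\<^bsup>1/2\<^esup>\<close>; here \<open>X = \<Phi>(A\<^sup>p)\<close> and \<open>Y = \<Psi>(B\<^sup>q)\<close>, or
  the inverses of \<open>\<Phi>(A\<^bsup>-p\<^esup>)\<close> and \<open>\<Psi>(B\<^bsup>-q\<^esup>)\<close>. By Young's inequality this trace is the supremum over
  \<open>Z \<ge> 0\<close> of \<open>s Tr Y Z - (s - 1) Tr (Z\<^bsup>1/2\<^esup> X\<^bsup>-1\<^esup> Z\<^bsup>1/2\<^esup>)\<^bsup>1/r\<^esup> - c rank Z\<close>. Since \<open>Y\<close> is operator convex
  in \<open>B\<close>, only the concavity of the second trace in \<open>A\<close> is at stake.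

  That concavity is proved by complex interpolation. For a unital positive map \<open>\<Theta>\<close>, a convex
  combination \<open>A = \<Sum> t\<^sub>i A\<^sub>i\<close> and \<open>S\<^sub>i = D\<^bsup>1/2\<^esup> \<Theta>(A\<^bsup>-r/2\<^esup> A\<^sub>i\<^sup>r A\<^bsup>-r/2\<^esup>) D\<^bsup>1/2\<^esup>\<close>, apply the three lines
  theorem at \<open>z = r\<close> to
  \<open>\<Sum> t\<^sub>i Tr S\<^sub>i\<^bsup>(1-z)/r\<^esup> D\<^bsup>z/2r\<^esup> \<Theta>(A\<^bsup>-z/2\<^esup> A\<^sub>i\<^sup>z A\<^bsup>-z/2\<^esup>) D\<^bsup>z/2r\<^esup>\<close>. On \<open>Re z = 0\<close> it is at most
  \<open>\<Sum> t\<^sub>i Tr S\<^sub>i\<^bsup>1/r\<^esup>\<close>, because positive unital maps are contractive on unitaries. On \<open>Re z = 1\<close> it is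
  at most \<open>Tr D\<^bsup>1/r\<^esup>\<close>, because the Cauchy-Schwarz bounds of the summands add up through
  \<open>\<Sum> t\<^sub>i A\<^bsup>-z/2\<^esup> A\<^sub>i (A\<^bsup>-z/2\<^esup>)\<^sup>* = 1\<close>. Hence \<open>\<Sum> t\<^sub>i Tr S\<^sub>i\<^bsup>1/r\<^esup> \<le> Tr D\<^bsup>1/r\<^esup>\<close>. Only positivity of \<open>\<Phi>\<close> is used,
  not complete positivity; the scalar-valued maps \<open>\<Theta> = \<langle>v, \<cdot> v\<rangle>\<close> give operator concavity of \<open>x\<^sup>r\<close>.
\<close>

section \<open>Complex inner product and adjoints\<close>

definition cinner :: "complex^'n \<Rightarrow> complex^'n \<Rightarrow> complex" where
  "cinner x y = (\<Sum>i\<in>UNIV. cnj (x $ i) * y $ i)"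

text \<open>For Hermitian \<open>A\<close> the form is real, so taking the real part loses nothing;
  in general it sees only the Hermitian part of \<open>A\<close>.\<close>

definition qform :: "complex^'n^'n \<Rightarrow> complex^'n \<Rightarrow> real" where
  "qform A x = Re (cinner x (A *v x))"

definition psd :: "complex^'n^'n \<Rightarrow> bool" where
  "psd A \<longleftrightarrow> hermitian A \<and> (\<forall>x. 0 \<le> qform A x)"

lemma cinner_add_left: "cinner (x + y) z = cinner x z + cinner y z"
  by (simp add: cinner_def algebra_simps sum.distrib)

lemma cinner_add_right: "cinner x (y + z) = cinner x y + cinner x z"
  by (simp add: cinner_def algebra_simps sum.distrib)

lemma cinner_diff_left: "cinner (x - y) z = cinner x z - cinner y z"
  by (simp add: cinner_def algebra_simps sum_subtractf)

lemma cinner_diff_right: "cinner x (y - z) = cinner x y - cinner x z"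
  by (simp add: cinner_def algebra_simps sum_subtractf)

lemma cinner_scale_left: "cinner (c *s x) y = cnj c * cinner x y"
  by (simp add: cinner_def sum_distrib_left algebra_simps)

lemma cinner_scale_right: "cinner x (c *s y) = c * cinner x y"
  by (simp add: cinner_def sum_distrib_left algebra_simps)

lemma cinner_zero [simp]: "cinner 0 x = 0" "cinner x 0 = 0"
  by (simp_all add: cinner_def)

lemma cinner_sum_right: "cinner x (\<Sum>i\<in>I. f i) = (\<Sum>i\<in>I. cinner x (f i))"
  by (induction I rule: infinite_finite_induct) (simp_all add: cinner_add_right)

lemmas cinner_simps = cinner_add_left cinner_add_right cinner_diff_left cinner_diff_right
  cinner_scale_left cinner_scale_right

lemma cnj_cinner: "cnj (cinner x y) = cinner y x"
  by (simp add: cinner_def algebra_simps)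

lemma Re_cinner: "Re (cinner x y) = inner x y"
  by (simp add: cinner_def inner_vec_def inner_complex_def)

lemma cinner_self: "cinner x x = of_real ((norm x)\<^sup>2)"
proof -
  have "Im (cinner x x) = 0"
    by (simp add: cinner_def)
  then show ?thesis
    by (simp add: complex_eq_iff Re_cinner power2_norm_eq_inner)
qed

lemma scaleR_eq_smult: "a *\<^sub>R (x :: complex^'n) = of_real a *s x"
  unfolding vec_eq_iff vector_scaleR_component vector_smult_component by (simp add: scaleR_conv_of_real)

lemma norm_smult: "norm (c *s (x :: complex^'n)) = cmod c * norm x"
proof -
  have "complex_of_real ((norm (c *s x))\<^sup>2) = of_real ((cmod c * norm x)\<^sup>2)"
    unfolding cinner_self[symmetric] cinner_scale_left cinner_scale_right
    by (simp add: cinner_self power_mult_distrib) (metis complex_norm_square of_real_power)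
  then show ?thesis
    unfolding of_real_eq_iff by (rule power2_eq_imp_eq) simp_all
qed

lemma matrix_vector_smult: "(A :: complex^'n^'m) *v (c *s x) = c *s (A *v x)"
  by (simp add: matrix_vector_mult_def vec_eq_iff sum_distrib_left algebra_simps)

lemma cscale_mult_vec: "cscale c A *v x = c *s (A *v x)"
  by (simp add: cscale_def matrix_vector_mult_def vec_eq_iff sum_distrib_left algebra_simps)

lemma cinner_axis_left: "cinner (axis i 1) x = x $ i"
proof -
  have "cinner (axis i 1) x = (\<Sum>k\<in>UNIV. if k = i then x $ k else 0)"
    unfolding cinner_def by (rule sum.cong) (auto simp: axis_def)
  then show ?thesis by simp
qed

lemma cinner_matrix: "cinner x (A *v y) = cinner (cadj A *v x) y"
proof -
  have "cinner x (A *v y) = (\<Sum>i\<in>UNIV. \<Sum>j\<in>UNIV. cnj (x $ i) * A $ i $ j * y $ j)"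
    by (simp add: cinner_def matrix_vector_mult_def sum_distrib_left algebra_simps)
  also have "\<dots> = (\<Sum>j\<in>UNIV. \<Sum>i\<in>UNIV. cnj (x $ i) * A $ i $ j * y $ j)"
    by (rule sum.swap)
  also have "\<dots> = cinner (cadj A *v x) y"
    by (simp add: cinner_def matrix_vector_mult_def cadj_def sum_distrib_right) (simp add: mult.commute)
  finally show ?thesis .
qed

lemma cadj_cadj [simp]: "cadj (cadj A) = A"
  by (simp add: cadj_def vec_eq_iff)

lemma cadj_mult: "cadj (A ** B) = cadj B ** cadj A"
  by (simp add: cadj_def vec_eq_iff matrix_matrix_mult_def algebra_simps)

lemma cadj_add: "cadj (A + B) = cadj A + cadj B"
  by (simp add: cadj_def vec_eq_iff)

lemma cadj_diff: "cadj (A - B) = cadj A - cadj B"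
  by (simp add: cadj_def vec_eq_iff)

lemma cadj_cscale: "cadj (cscale c A) = cscale (cnj c) (cadj A)"
  by (simp add: cadj_def cscale_def vec_eq_iff)

lemma cadj_mat1 [simp]: "cadj (mat 1) = mat 1"
  by (simp add: cadj_def mat_def vec_eq_iff)

lemma cscale_mult_left: "cscale c A ** B = cscale c (A ** B)"
  by (simp add: cscale_def matrix_matrix_mult_def vec_eq_iff sum_distrib_left algebra_simps)

lemma cscale_mult_right: "A ** cscale c B = cscale c (A ** B)"
  by (simp add: cscale_def matrix_matrix_mult_def vec_eq_iff sum_distrib_left algebra_simps)

lemma cscale_one [simp]: "cscale 1 A = A"
  by (simp add: cscale_def vec_eq_iff)

lemma cscale_cscale: "cscale c (cscale d A) = cscale (c * d) A"
  by (simp add: cscale_def vec_eq_iff)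

lemma qform_eq: "qform A x = Re (\<Sum>i\<in>UNIV. \<Sum>j\<in>UNIV. cnj (x $ i) * A $ i $ j * x $ j)"
  by (simp add: qform_def cinner_def matrix_vector_mult_def sum_distrib_left mult.assoc)

lemma posdef_iff: "posdef A \<longleftrightarrow> hermitian A \<and> (\<forall>x. x \<noteq> 0 \<longrightarrow> 0 < qform A x)"
  by (simp add: posdef_def qform_eq)

lemma qform_zero [simp]: "qform A 0 = 0"
  by (simp add: qform_def)

lemma posdef_imp_psd: "posdef A \<Longrightarrow> psd A"
  unfolding posdef_iff psd_def by (metis less_eq_real_def qform_zero)

lemma posdef_hermitian: "posdef A \<Longrightarrow> hermitian A"
  by (simp add: posdef_iff)

lemma psd_hermitian: "psd A \<Longrightarrow> hermitian A"
  by (simp add: psd_def)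

lemma qform_add: "qform (A + B) x = qform A x + qform B x"
  by (simp add: qform_def matrix_vector_mult_add_rdistrib cinner_add_right)

lemma qform_diff: "qform (A - B) x = qform A x - qform B x"
  by (simp add: qform_def matrix_vector_mult_diff_rdistrib cinner_diff_right)

lemma qform_cscale: "qform (cscale (of_real c) A) x = c * qform A x"
  by (simp add: qform_def cscale_mult_vec cinner_scale_right)

lemma qform_mat1 [simp]: "qform (mat 1) x = (norm x)\<^sup>2"
  by (simp add: qform_def cinner_self flip: of_real_power)

lemma qform_congruence: "qform (cadj K ** A ** K) x = qform A (K *v x)"
  by (simp add: qform_def cinner_matrix cadj_mult flip: matrix_vector_mul_assoc)

lemma hermitian_add: "hermitian A \<Longrightarrow> hermitian B \<Longrightarrow> hermitian (A + B)"
  by (simp add: hermitian_def cadj_add)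

lemma hermitian_diff: "hermitian A \<Longrightarrow> hermitian B \<Longrightarrow> hermitian (A - B)"
  by (simp add: hermitian_def cadj_diff)

lemma hermitian_cscale: "hermitian A \<Longrightarrow> hermitian (cscale (of_real c) A)"
  by (simp add: hermitian_def cadj_cscale)

lemma hermitian_congruence: "hermitian A \<Longrightarrow> hermitian (cadj K ** A ** K)"
  by (simp add: hermitian_def cadj_mult matrix_mul_assoc)

lemma hermitian_mat1 [simp]: "hermitian (mat 1)"
  by (simp add: hermitian_def)

lemma posdef_mat1 [simp]: "posdef (mat 1)"
  by (simp add: posdef_iff)

lemma psd_congruence: "psd A \<Longrightarrow> psd (cadj K ** A ** K)"
  by (simp add: psd_def hermitian_congruence qform_congruence)

lemma psd_mult_cadj: "psd (K ** cadj K)"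
  using psd_congruence[OF posdef_imp_psd[OF posdef_mat1], of "cadj K"] by simp

lemma posdef_convex_comb:
  assumes "posdef A" "posdef B" "0 \<le> t" "t \<le> 1"
  shows "posdef (cscale (of_real t) A + cscale (of_real (1 - t)) B)"
proof -
  have "0 < t * qform A x + (1 - t) * qform B x" if "x \<noteq> 0" for x
  proof (cases "t = 0")
    case False
    then show ?thesis
      using assms that unfolding posdef_iff
      by (intro add_pos_nonneg mult_pos_pos mult_nonneg_nonneg) (auto simp: less_imp_le)
  qed (use assms that in \<open>auto simp: posdef_iff\<close>)
  then show ?thesis
    using assms unfolding posdef_iff
    by (simp only: hermitian_add hermitian_cscale qform_add qform_cscale) blast
qed

lemma hermitian_cinner: "hermitian A \<Longrightarrow> cinner x (A *v y) = cinner (A *v x) y"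
  by (simp add: cinner_matrix hermitian_def)

lemma hermitian_cinner_real: "hermitian A \<Longrightarrow> cinner x (A *v x) = of_real (qform A x)"
  unfolding qform_def
  by (metis cnj_cinner hermitian_cinner complex_cnj_cancel_iff Reals_cnj_iff of_real_Re)

lemma qform_hermitian_add_vec:
  assumes "hermitian A"
  shows "qform A (x + y) = qform A x + 2 * Re (cinner y (A *v x)) + qform A y"
proof -
  have "Re (cinner x (A *v y)) = Re (cinner y (A *v x))"
    by (metis assms cnj_cinner complex_cnj(1) hermitian_cinner cnj.sel(1))
  then show ?thesis
    by (simp add: qform_def cinner_simps matrix_vector_right_distrib)
qed

lemma qform_smult: "qform A (c *s x) = (cmod c)\<^sup>2 * qform A x"
proof -
  have "cinner (c *s x) (A *v (c *s x)) = (c * cnj c) * cinner x (A *v x)"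
    by (simp add: cinner_simps matrix_vector_smult algebra_simps)
  then show ?thesis
    unfolding qform_def by (simp only: complex_norm_square[symmetric]) simp
qed

section \<open>Spectral theorem for commuting Hermitian matrices\<close>

text \<open>The Rayleigh quotient attains its maximum on the compact unit sphere of
  \<open>S\<close>, and a maximiser is an eigenvector because the first variation vanishes there.
  \<open>S\<close> is any invariant complex subspace, so that eigenvectors can later be found inside
  orthogonal complements and eigenspaces.\<close>

lemma hermitian_eigenvector:
  fixes H :: "complex^'n^'n"
  assumes H: "hermitian H" and ne: "v \<in> S" "v \<noteq> 0"
    and add: "\<And>x y. x \<in> S \<Longrightarrow> y \<in> S \<Longrightarrow> x + y \<in> S"
    and scale: "\<And>c x. x \<in> S \<Longrightarrow> c *s x \<in> S"
    and inv: "\<And>x. x \<in> S \<Longrightarrow> H *v x \<in> S"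
  obtains x a where "x \<in> S" "norm x = 1" "H *v x = of_real a *s x"
proof -
  have "subspace S"
    using ne add scale[of v 0] scale unfolding subspace_def by (auto simp: scaleR_eq_smult)
  then have "closed S" by (rule closed_subspace)
  let ?C = "S \<inter> sphere 0 1"
  have "compact ?C"
    using \<open>closed S\<close> by (simp add: closed_Int_compact)
  moreover have "of_real (inverse (norm v)) *s v \<in> ?C"
    using ne scale by (auto simp: norm_smult norm_inverse)
  moreover have "continuous_on ?C (qform H)"
    unfolding qform_eq by (intro continuous_intros)
  ultimately obtain x where x: "x \<in> ?C" and max: "\<And>y. y \<in> ?C \<Longrightarrow> qform H y \<le> qform H x"
    using continuous_attains_sup[of ?C "qform H"] by blast
  define a where "a = qform H x"
  have bound: "qform H y \<le> a * (norm y)\<^sup>2" if "y \<in> S" for y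
  proof (cases "y = 0")
    case False
    have "of_real (inverse (norm y)) *s y \<in> ?C"
      using False that scale by (auto simp: norm_smult norm_inverse)
    then have "qform H (of_real (inverse (norm y)) *s y) \<le> a"
      using max a_def by blast
    then have "(inverse (norm y))\<^sup>2 * qform H y \<le> a"
      by (simp add: qform_smult norm_inverse)
    then show ?thesis using False by (simp add: field_simps)
  qed simp
  \<comment> \<open>The residual of the eigenvalue equation. It lies in \<open>S\<close>, so
    \<open>x\<close> may be varied in its direction.\<close>
  define w where "w = H *v x - of_real a *s x"
  have xS: "x \<in> S" using x by simp
  have wS: "w \<in> S"
  proof -
    have w: "w = H *v x + (- 1) *s (of_real a *s x)" by (simp add: w_def vec_eq_iff)
    have "H *v x + (- 1) *s (of_real a *s x) \<in> S" by (intro add inv scale xS)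
    then show ?thesis unfolding w .
  qed
  have nx: "norm x = 1" using x by auto
  define C where "C = a * (norm w)\<^sup>2 - qform H w"
  \<comment> \<open>Insert \<open>x + e w\<close> into \<open>bound\<close>: the terms of order zero
    cancel and the linear term is a multiple of the squared norm of \<open>w\<close>, so dividing by
    \<open>e\<close> leaves a right-hand side that tends to 0 with \<open>e\<close>.\<close>
  have ineq: "2 * (norm w)\<^sup>2 \<le> e * C" if "e > 0" for e :: real
  proof -
    have 1: "qform H (x + of_real e *s w) = a + 2 * e * Re (cinner w (H *v x)) + e\<^sup>2 * qform H w"
      by (simp add: qform_hermitian_add_vec[OF H] qform_smult cinner_simps a_def)
    have "(norm (x + of_real e *s w))\<^sup>2 = qform (mat 1) (x + of_real e *s w)" by simp
    also have "\<dots> = 1 + 2 * e * Re (cinner w x) + e\<^sup>2 * (norm w)\<^sup>2"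
      by (subst qform_hermitian_add_vec) (simp_all add: qform_smult cinner_simps nx del: qform_mat1, simp_all add: nx)
    finally have 2: "(norm (x + of_real e *s w))\<^sup>2 = 1 + 2 * e * Re (cinner w x) + e\<^sup>2 * (norm w)\<^sup>2" .
    have "qform H (x + of_real e *s w) \<le> a * (norm (x + of_real e *s w))\<^sup>2"
      by (intro bound add scale wS xS)
    then have "a + 2 * e * Re (cinner w (H *v x)) + e\<^sup>2 * qform H w
        \<le> a * (1 + 2 * e * Re (cinner w x) + e\<^sup>2 * (norm w)\<^sup>2)"
      unfolding 1 2 .
    then have "2 * e * (Re (cinner w (H *v x)) - a * Re (cinner w x)) \<le> e\<^sup>2 * C"
      by (simp add: C_def algebra_simps)
    moreover have "Re (cinner w (H *v x)) - a * Re (cinner w x) = (norm w)\<^sup>2"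
    proof -
      have "(norm w)\<^sup>2 = Re (cinner w w)" by (simp add: cinner_self flip: of_real_power)
      also have "\<dots> = Re (cinner w (H *v x)) - a * Re (cinner w x)"
        by (subst (2) w_def) (simp add: cinner_simps)
      finally show ?thesis by simp
    qed
    ultimately have "e * (2 * (norm w)\<^sup>2) \<le> e * (e * C)"
      by (simp add: power2_eq_square algebra_simps)
    then show ?thesis using that by simp
  qed
  have "(norm w)\<^sup>2 = 0"
  proof (rule ccontr)
    assume "(norm w)\<^sup>2 \<noteq> 0"
    then have pos: "(norm w)\<^sup>2 > 0" by simp
    have "C > 0" using ineq[of 1] pos by linarith
    then have "0 < (norm w)\<^sup>2 / C" using pos by (rule divide_pos_pos[rotated])
    from ineq[OF this] \<open>C > 0\<close> have "2 * (norm w)\<^sup>2 \<le> (norm w)\<^sup>2" by simp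
    then show False using pos by linarith
  qed
  then have "H *v x = of_real a *s x" by (simp add: w_def)
  then show ?thesis using that x nx by blast
qed

text \<open>Complex orthogonality to \<open>u i\<close> is real orthogonality to both
  \<open>u i\<close> and \<open>\<i> *s u i\<close>, so fewer than \<open>n\<close> complex
  conditions are fewer than \<open>2 n\<close> real ones in a space of real dimension
  \<open>2 n\<close>.\<close>

lemma exists_cinner_orthogonal:
  fixes u :: "'n::finite \<Rightarrow> complex^'n"
  assumes "I \<noteq> UNIV"
  shows "\<exists>x. x \<noteq> 0 \<and> (\<forall>i\<in>I. cinner (u i) x = 0)"
proof -
  let ?S = "u ` I \<union> (\<lambda>i. \<i> *s u i) ` I"
  have "card I < CARD('n)"
    using assms by (simp add: psubset_card_mono psubset_eq)
  have "dim ?S \<le> card ?S" by (rule dim_le_card) (auto intro: span_base)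
  also have "\<dots> \<le> card I + card I"
    by (rule order_trans[OF card_Un_le]) (intro add_mono card_image_le; simp)
  also have "\<dots> < DIM(complex^'n)"
    using \<open>card I < CARD('n)\<close> by simp
  finally obtain x where x: "x \<noteq> 0" "\<And>y. y \<in> span ?S \<Longrightarrow> orthogonal x y"
    using orthogonal_to_subspace_exists by blast
  have "cinner (u i) x = 0" if "i \<in> I" for i
  proof -
    have "orthogonal x (u i)" "orthogonal x (\<i> *s u i)"
      using x(2) that by (auto intro!: span_base)
    then have "Re (cinner (u i) x) = 0" "Re (cinner (\<i> *s u i) x) = 0"
      by (simp_all add: Re_cinner orthogonal_def inner_commute)
    then show ?thesis by (simp add: cinner_scale_left complex_eq_iff)
  qed
  then show ?thesis using x(1) by blast
qed

definition cdiag :: "('n \<Rightarrow> complex) \<Rightarrow> complex^'n^'n" where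
  "cdiag c = (\<chi> i j. if i = j then c i else 0)"

text \<open>The eigenvalues may be complex, so that unitary matrices and complex powers of positive
  matrices have the same form as Hermitian ones.\<close>

definition spec :: "complex^'n^'n \<Rightarrow> ('n \<Rightarrow> complex) \<Rightarrow> complex^'n^'n" where
  "spec U c = U ** cdiag c ** cadj U"

lemma rdiag_eq_cdiag: "rdiag d = cdiag (\<lambda>i. of_real (d i))"
  by (simp add: rdiag_def cdiag_def)

lemma unitaryI: "cadj U ** U = mat 1 \<Longrightarrow> unitary U"
  unfolding unitary_def using matrix_left_right_inverse by blast

lemma unitary_cancel [simp]: "unitary U \<Longrightarrow> cadj U ** U = mat 1" "unitary U \<Longrightarrow> U ** cadj U = mat 1"
  by (simp_all add: unitary_def)

lemma cadj_mult_component: "(cadj U ** V) $ i $ j = cinner (column i U) (column j V)"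
  by (simp add: matrix_matrix_mult_def cadj_def cinner_def column_def)

lemma column_mult: "column j (A ** B) = A *v column j B"
  by (simp add: vec_eq_iff column_def matrix_matrix_mult_def matrix_vector_mult_def)

lemma mult_cdiag_component: "(U ** cdiag c) $ i $ j = U $ i $ j * c j"
  by (simp add: matrix_matrix_mult_def cdiag_def mult_delta_right)

lemma column_mult_cdiag: "column j (U ** cdiag c) = c j *s column j U"
  by (simp add: vec_eq_iff column_def mult_cdiag_component mult.commute)

lemma matrix_eq_columns: "(\<And>j. column j A = column j B) \<Longrightarrow> A = B"
  by (simp add: vec_eq_iff column_def)

lemma spec_eqI:
  assumes "unitary U" "\<And>j. A *v column j U = c j *s column j U"
  shows "A = spec U c"
proof -
  have "A ** U = U ** cdiag c"
    by (rule matrix_eq_columns) (metis assms(2) column_mult column_mult_cdiag)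
  then have "A ** U ** cadj U = spec U c" by (simp add: spec_def)
  then show ?thesis using assms(1) by (simp flip: matrix_mul_assoc)
qed

text \<open>An orthonormal family of common eigenvectors is enlarged one index at a time. The
  orthogonal complement of the vectors found so far is invariant under both matrices, and an
  eigenspace of \<open>H\<close> inside it is invariant under \<open>K\<close> because the two
  commute.\<close>

theorem commuting_hermitian_diagonalisation:
  fixes H K :: "complex^'n^'n"
  assumes H: "hermitian H" and K: "hermitian K" and comm: "H ** K = K ** H"
  obtains U a b where "unitary U" "H = spec U (\<lambda>i. of_real (a i))" "K = spec U (\<lambda>i. of_real (b i))"
proof -
  have "\<exists>u a b. \<forall>i\<in>I. H *v u i = of_real (a i) *s u i \<and> K *v u i = of_real (b i) *s u i \<and>
          (\<forall>j\<in>I. cinner (u i) (u j) = (if i = j then 1 else 0))" if "finite I" for I :: "'n set"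
    using that
  proof (induction I)
    case (insert k I)
    then obtain u a b where u: "\<And>i. i \<in> I \<Longrightarrow> H *v u i = of_real (a i) *s u i"
      "\<And>i. i \<in> I \<Longrightarrow> K *v u i = of_real (b i) *s u i"
      "\<And>i j. i \<in> I \<Longrightarrow> j \<in> I \<Longrightarrow> cinner (u i) (u j) = (if i = j then 1 else 0)"
      by blast
    define S where "S = {x. \<forall>i\<in>I. cinner (u i) x = 0}"
    have "I \<noteq> UNIV" using insert.hyps by blast
    then obtain v where v: "v \<in> S" "v \<noteq> 0"
      using exists_cinner_orthogonal[of I u] by (auto simp: S_def)
    have Sinv: "A *v x \<in> S" if "x \<in> S" "hermitian A" "\<And>i. i \<in> I \<Longrightarrow> A *v u i = of_real (c i) *s u i"
      for A x c
      using that unfolding S_def by (auto simp: hermitian_cinner cinner_scale_left)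
    obtain x \<alpha> where x: "x \<in> S" "norm x = 1" "H *v x = of_real \<alpha> *s x"
      by (rule hermitian_eigenvector[OF H v]) (use Sinv[OF _ H u(1)] in \<open>auto simp: S_def cinner_simps\<close>)
    \<comment> \<open>Any eigenvector of \<open>K\<close> in this eigenspace is automatically one of
      \<open>H\<close>.\<close>
    define S' where "S' = S \<inter> {x. H *v x = of_real \<alpha> *s x}"
    have "x \<in> S'" "x \<noteq> 0" using x by (auto simp: S'_def)
    then obtain y \<beta> where y: "y \<in> S'" "norm y = 1" "K *v y = of_real \<beta> *s y"
    proof (rule hermitian_eigenvector[OF K])
      fix z assume "z \<in> S'"
      then have "H *v (K *v z) = of_real \<alpha> *s (K *v z)"
        by (simp add: S'_def matrix_vector_mul_assoc comm)
          (simp flip: matrix_vector_mul_assoc add: matrix_vector_smult)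
      then show "K *v z \<in> S'"
        using \<open>z \<in> S'\<close> Sinv[OF _ K u(2)] by (auto simp: S'_def)
    qed (auto simp: S'_def S_def cinner_simps matrix_vector_right_distrib matrix_vector_smult
          vector_add_ldistrib mult.commute)
    have yo: "cinner (u i) y = 0" "cinner y (u i) = 0" if "i \<in> I" for i
      using y(1) that cnj_cinner[of "u i" y] unfolding S'_def S_def by auto
    have ny: "cinner y y = 1" using y(2) by (simp add: cinner_self)
    show ?case
      using insert.hyps u y yo ny
      by (intro exI[of _ "u(k := y)"] exI[of _ "a(k := \<alpha>)"] exI[of _ "b(k := \<beta>)"])
        (auto simp: S'_def)
  qed simp
  from this[of UNIV] obtain u :: "'n \<Rightarrow> complex^'n" and a b where
    "\<forall>i. H *v u i = of_real (a i) *s u i \<and> K *v u i = of_real (b i) *s u i \<and>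
          (\<forall>j. cinner (u i) (u j) = (if i = j then 1 else 0))"
    by (simp only: finite UNIV_I ball_UNIV) blast
  then have u: "\<And>i. H *v u i = of_real (a i) *s u i"
      "\<And>i. K *v u i = of_real (b i) *s u i" "\<And>i j. cinner (u i) (u j) = (if i = j then 1 else 0)"
    by simp_all
  define U :: "complex^'n^'n" where "U = (\<chi> i j. u j $ i)"
  have col: "column j U = u j" for j by (simp add: U_def column_def vec_eq_iff)
  have U: "unitary U"
    by (rule unitaryI) (simp add: vec_eq_iff cadj_mult_component col u mat_def)
  show ?thesis
    using that[OF U] spec_eqI[OF U] u col by metis
qed

lemma hermitian_diagonalisation:
  assumes "hermitian H"
  obtains U a where "unitary U" "H = spec U (\<lambda>i. of_real (a i))"
  using commuting_hermitian_diagonalisation[OF assms assms] by blast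

section \<open>Functional calculus\<close>

lemma cdiag_mult: "cdiag c ** cdiag d = cdiag (\<lambda>i. c i * d i)"
  by (simp add: vec_eq_iff mult_cdiag_component) (simp add: cdiag_def)

lemma cadj_cdiag: "cadj (cdiag c) = cdiag (\<lambda>i. cnj (c i))"
  by (simp add: cadj_def cdiag_def vec_eq_iff)

lemma cdiag_one [simp]: "cdiag (\<lambda>i. 1) = mat 1"
  by (simp add: cdiag_def mat_def)

lemma spec_mult:
  assumes "unitary U"
  shows "spec U c ** spec U d = spec U (\<lambda>i. c i * d i)"
proof -
  have "spec U c ** spec U d = U ** cdiag c ** (cadj U ** U) ** cdiag d ** cadj U"
    by (simp add: spec_def matrix_mul_assoc)
  also have "\<dots> = U ** (cdiag c ** cdiag d) ** cadj U"
    using assms by (simp add: matrix_mul_assoc)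
  finally show ?thesis by (simp add: spec_def cdiag_mult)
qed

lemma cadj_spec: "cadj (spec U c) = spec U (\<lambda>i. cnj (c i))"
  by (simp add: spec_def cadj_mult cadj_cdiag matrix_mul_assoc)

lemma spec_one: "unitary U \<Longrightarrow> spec U (\<lambda>i. 1) = mat 1"
  by (simp add: spec_def)

lemma unitary_spec:
  assumes "unitary U" "\<And>i. cmod (c i) = 1"
  shows "unitary (spec U c)"
proof (rule unitaryI)
  have "cnj (c i) * c i = 1" for i
    using complex_norm_square[of "c i"] assms(2)[of i] by (simp add: mult.commute)
  then show "cadj (spec U c) ** spec U c = mat 1"
    by (simp add: cadj_spec spec_mult[OF assms(1)] spec_one[OF assms(1)])
qed

lemma unitary_mult: "unitary U \<Longrightarrow> unitary V \<Longrightarrow> unitary (U ** V)"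
proof (rule unitaryI)
  assume *: "unitary U" "unitary V"
  have "cadj (U ** V) ** (U ** V) = cadj V ** (cadj U ** U) ** V"
    by (simp add: cadj_mult matrix_mul_assoc)
  then show "cadj (U ** V) ** (U ** V) = mat 1" using * by simp
qed

lemma unitary_cadj: "unitary U \<Longrightarrow> unitary (cadj U)"
  unfolding unitary_def by simp

lemma unitary_mat1 [simp]: "unitary (mat 1)"
  unfolding unitary_def by simp

lemma cinner_columns: "unitary U \<Longrightarrow> cinner (column i U) (column j U) = (if i = j then 1 else 0)"
  by (simp add: mat_def flip: cadj_mult_component)

lemma norm_column_unitary:
  assumes "unitary U"
  shows "norm (column j U) = 1"
proof -
  have "complex_of_real ((norm (column j U))\<^sup>2) = 1"
    unfolding cinner_self[symmetric] by (simp add: cinner_columns assms)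
  then have "(norm (column j U))\<^sup>2 = 1" by (metis of_real_eq_1_iff)
  then show ?thesis by (simp add: power2_eq_1_iff) (metis norm_ge_zero not_one_le_zero neg_0_le_iff_le)
qed

lemma cadj_mult_vec_component: "(cadj U *v x) $ j = cinner (column j U) x"
  by (simp add: matrix_vector_mult_def cadj_def cinner_def column_def)

lemma norm_unitary:
  assumes "unitary U"
  shows "norm (U *v x) = norm x"
proof -
  have "cinner (U *v x) (U *v x) = cinner x x"
    using assms by (simp add: cinner_matrix matrix_vector_mul_assoc)
  then show ?thesis unfolding cinner_self of_real_eq_iff by (rule power2_eq_imp_eq) simp_all
qed

lemma norm_sum_components: "(norm (x :: complex^'n))\<^sup>2 = (\<Sum>j\<in>UNIV. (cmod (x $ j))\<^sup>2)"
  by (simp add: norm_vec_def L2_set_def sum_nonneg)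

lemma parseval: "unitary U \<Longrightarrow> (\<Sum>j\<in>UNIV. (cmod (cinner (column j U) x))\<^sup>2) = (norm x)\<^sup>2"
  unfolding cadj_mult_vec_component[symmetric] norm_sum_components[symmetric]
  by (simp add: norm_unitary[OF unitary_cadj])

lemma spec_column: "unitary U \<Longrightarrow> spec U c *v column j U = c j *s column j U"
proof -
  assume U: "unitary U"
  have "spec U c *v column j U = column j (spec U c ** U)" by (simp add: column_mult)
  also have "spec U c ** U = U ** cdiag c" using U by (simp add: spec_def flip: matrix_mul_assoc)
  finally show ?thesis by (simp add: column_mult_cdiag)
qed

lemma trace_cdiag: "trace (cdiag c) = (\<Sum>i\<in>UNIV. c i)"
  by (simp add: trace_def cdiag_def)

lemma trace_conj:
  fixes A :: "complex^'n^'n"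
  assumes "unitary U"
  shows "trace (cadj U ** A ** U) = trace A"
proof -
  have "trace (cadj U ** A ** U) = trace (U ** (cadj U ** A))" by (rule trace_mul_sym)
  also have "U ** (cadj U ** A) = A" using assms by (simp add: matrix_mul_assoc)
  finally show ?thesis .
qed

lemma trace_spec: "unitary U \<Longrightarrow> trace (spec U c) = (\<Sum>i\<in>UNIV. c i)"
  using trace_conj[OF unitary_cadj, of U "cdiag c"] by (simp add: spec_def trace_cdiag)

lemma conj_component: "(cadj U ** A ** U) $ i $ j = cinner (column i U) (A *v column j U)"
  by (simp add: cadj_mult_component column_mult flip: matrix_mul_assoc)

lemma trace_eq_columns:
  "unitary U \<Longrightarrow> trace A = (\<Sum>j\<in>UNIV. cinner (column j U) (A *v column j U))"
  by (subst trace_conj[symmetric]) (simp_all add: trace_def conj_component)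

lemma cinner_spec:
  "cinner x (spec U c *v y) = (\<Sum>j\<in>UNIV. c j * cinner x (column j U) * cinner (column j U) y)"
proof -
  have "(cdiag c *v z) $ j = c j * z $ j" for z j
    by (simp add: matrix_vector_mult_def cdiag_def mult_delta_left)
  moreover have "cinner x (spec U c *v y) = cinner (cadj U *v x) (cdiag c *v (cadj U *v y))"
    by (simp add: spec_def flip: matrix_vector_mul_assoc) (metis cadj_cadj cinner_matrix)
  ultimately show ?thesis
    by (simp add: cinner_def[of "cadj U *v x"] cadj_mult_vec_component cnj_cinner mult_ac)
qed

lemma qform_spec:
  "qform (spec U c) x = (\<Sum>j\<in>UNIV. Re (c j) * (cmod (cinner (column j U) x))\<^sup>2)"
proof -
  have "c j * cinner x (column j U) * cinner (column j U) x
      = c j * of_real ((cmod (cinner (column j U) x))\<^sup>2)" for j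
    unfolding complex_norm_square cnj_cinner by (simp add: mult_ac)
  then have "qform (spec U c) x = Re (\<Sum>j\<in>UNIV. c j * of_real ((cmod (cinner (column j U) x))\<^sup>2))"
    unfolding qform_def cinner_spec by (simp only:)
  then show ?thesis by (simp del: of_real_power)
qed

lemma matrix_inv_eqI:
  fixes A :: "complex^'n^'n"
  assumes "A ** B = mat 1"
  shows "matrix_inv A = B"
proof -
  have "B ** A = mat 1" using assms matrix_left_right_inverse by blast
  then have "A ** matrix_inv A = mat 1"
    using assms unfolding matrix_inv_def by (metis (mono_tags, lifting) someI_ex)
  then show ?thesis
    by (metis \<open>B ** A = mat 1\<close> matrix_mul_assoc matrix_mul_lid matrix_mul_rid)
qed

text \<open>The functional calculus does not depend on the diagonalisation: columns of
  \<open>U\<close> and \<open>V\<close> are orthogonal unless their eigenvalues agree, and then the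
  values of \<open>f\<close> agree too.\<close>

lemma spec_of_real_cong:
  assumes U: "unitary U" and V: "unitary V"
    and eq: "spec U (\<lambda>i. of_real (d i)) = spec V (\<lambda>i. of_real (e i))"
  shows "spec U (\<lambda>i. of_real (f (d i))) = spec V (\<lambda>i. of_real (f (e i)))"
proof -
  let ?A = "spec U (\<lambda>i. of_real (d i))"
  have "spec V (\<lambda>i. of_real (f (e i))) *v column j U = of_real (f (d j)) *s column j U" for j
  proof -
    have *: "of_real (f (e k)) * cinner (column k V) (column j U)
            = of_real (f (d j)) * cinner (column k V) (column j U)" for k
    proof -
      \<comment> \<open>Letting \<open>?A\<close> act on either vector of the inner product leaves a
        zero overlap or \<open>d j = e k\<close>.\<close>
      have "of_real (d j) * cinner (column k V) (column j U) = cinner (column k V) (?A *v column j U)"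
        by (simp add: spec_column[OF U] cinner_scale_right)
      also have "\<dots> = cinner (cadj ?A *v column k V) (column j U)" by (rule cinner_matrix)
      also have "cadj ?A *v column k V = of_real (e k) *s column k V"
        unfolding eq by (simp add: cadj_spec spec_column[OF V])
      finally have "of_real (d j) * cinner (column k V) (column j U)
          = of_real (e k) * cinner (column k V) (column j U)" by (simp add: cinner_scale_left)
      then show ?thesis by auto
    qed
    have "cadj V *v (spec V (\<lambda>i. of_real (f (e i))) *v column j U)
        = cadj V *v (of_real (f (d j)) *s column j U)"
      unfolding vec_eq_iff cadj_mult_vec_component cinner_matrix[of _ "spec V _"]
      by (simp add: cadj_spec spec_column[OF V] cinner_simps *)
    then have "V *v (cadj V *v (spec V (\<lambda>i. of_real (f (e i))) *v column j U))
        = V *v (cadj V *v (of_real (f (d j)) *s column j U))" by simp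
    then show ?thesis using V by (simp add: matrix_vector_mul_assoc[of V])
  qed
  then show ?thesis by (rule spec_eqI[OF U, symmetric])
qed

text \<open>By \<open>spec_of_real_cong\<close> every admissible choice in \<open>matfun\<close>
  gives the same matrix.\<close>

lemma matfun_spec:
  assumes "unitary U"
  shows "matfun f (spec U (\<lambda>i. of_real (d i))) = spec U (\<lambda>i. of_real (f (d i)))"
  unfolding matfun_def
proof (rule some_equality)
  show "\<exists>V e. unitary V \<and> spec U (\<lambda>i. of_real (d i)) = V ** rdiag e ** cadj V \<and>
           spec U (\<lambda>i. of_real (f (d i))) = V ** rdiag (f \<circ> e) ** cadj V"
    using assms by (auto simp: spec_def rdiag_eq_cdiag)
next
  fix B
  assume "\<exists>V e. unitary V \<and> spec U (\<lambda>i. of_real (d i)) = V ** rdiag e ** cadj V \<and>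
           B = V ** rdiag (f \<circ> e) ** cadj V"
  then obtain V e where "unitary V" "spec U (\<lambda>i. of_real (d i)) = spec V (\<lambda>i. of_real (e i))"
    "B = spec V (\<lambda>i. of_real (f (e i)))"
    by (auto simp: spec_def rdiag_eq_cdiag)
  then show "B = spec U (\<lambda>i. of_real (f (d i)))"
    using spec_of_real_cong[OF assms, of V d e f] by simp
qed

lemma rtrace_matfun_spec:
  "unitary U \<Longrightarrow> rtrace (matfun f (spec U (\<lambda>i. of_real (d i)))) = (\<Sum>i\<in>UNIV. f (d i))"
  by (simp add: matfun_spec rtrace_def trace_spec flip: of_real_sum)

lemma qform_spec_column: "unitary U \<Longrightarrow> qform (spec U c) (column j U) = Re (c j)"
  by (simp add: qform_def spec_column cinner_scale_right cinner_columns)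

lemma hermitian_spec: "hermitian (spec U (\<lambda>i. of_real (d i)))"
  by (simp add: hermitian_def cadj_spec)

lemma psd_spec:
  assumes "unitary U"
  shows "psd (spec U (\<lambda>i. of_real (d i))) \<longleftrightarrow> (\<forall>i. 0 \<le> d i)"
proof
  assume "psd (spec U (\<lambda>i. of_real (d i)))"
  then show "\<forall>i. 0 \<le> d i" unfolding psd_def by (metis Re_complex_of_real assms qform_spec_column)
qed (simp add: psd_def hermitian_spec qform_spec sum_nonneg)

lemma posdef_spec:
  assumes "unitary U"
  shows "posdef (spec U (\<lambda>i. of_real (d i))) \<longleftrightarrow> (\<forall>i. 0 < d i)"
proof
  assume "posdef (spec U (\<lambda>i. of_real (d i)))"
  then show "\<forall>i. 0 < d i"
    unfolding posdef_iff
    by (metis Re_complex_of_real assms qform_spec_column norm_column_unitary norm_zero zero_neq_one)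
next
  assume d: "\<forall>i. 0 < d i"
  have "0 < qform (spec U (\<lambda>i. of_real (d i))) x" if "x \<noteq> 0" for x
  proof -
    have "(\<Sum>j\<in>UNIV. (cmod (cinner (column j U) x))\<^sup>2) \<noteq> 0"
      using that by (simp add: parseval[OF assms])
    then obtain j where j: "(cmod (cinner (column j U) x))\<^sup>2 \<noteq> 0"
      by (meson sum.not_neutral_contains_not_neutral)
    then have "0 < d j * (cmod (cinner (column j U) x))\<^sup>2" using d by simp
    then show ?thesis unfolding qform_spec
      using d by (intro sum_pos2[of _ j]) (auto simp: less_imp_le)
  qed
  then show "posdef (spec U (\<lambda>i. of_real (d i)))" by (simp add: posdef_iff hermitian_spec)
qed

lemma posdef_diagonalisation:
  assumes "posdef A"
  obtains U d where "unitary U" "A = spec U (\<lambda>i. of_real (d i))" "\<forall>i. 0 < d i"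
proof -
  obtain U d where "unitary U" "A = spec U (\<lambda>i. of_real (d i))"
    by (rule hermitian_diagonalisation[OF posdef_hermitian[OF assms]])
  then show ?thesis using that[of U d] posdef_spec[of U d] assms by simp
qed

lemma psd_diagonalisation:
  assumes "psd A"
  obtains U d where "unitary U" "A = spec U (\<lambda>i. of_real (d i))" "\<forall>i. 0 \<le> d i"
proof -
  obtain U d where "unitary U" "A = spec U (\<lambda>i. of_real (d i))"
    by (rule hermitian_diagonalisation[OF psd_hermitian[OF assms]])
  then show ?thesis using that[of U d] psd_spec[of U d] assms by simp
qed

section \<open>Real powers and inverses of positive definite matrices\<close>

lemma mpow_spec: "unitary U \<Longrightarrow> mpow (spec U (\<lambda>i. of_real (d i))) r = spec U (\<lambda>i. of_real (d i powr r))"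
  by (simp add: mpow_def matfun_spec)

lemma posdef_mpow:
  assumes "posdef A"
  shows "posdef (mpow A r)"
proof -
  obtain U d where U: "unitary U" and A: "A = spec U (\<lambda>i. of_real (d i))" and d: "\<forall>i. 0 < d i"
    by (rule posdef_diagonalisation[OF assms])
  show ?thesis using d unfolding A mpow_spec[OF U] posdef_spec[OF U]
    by (metis less_irrefl powr_gt_zero)
qed

lemma mpow_add:
  assumes "posdef A"
  shows "mpow A r ** mpow A s = mpow A (r + s)"
proof -
  obtain U d where U: "unitary U" and A: "A = spec U (\<lambda>i. of_real (d i))" and d: "\<forall>i. 0 < d i"
    by (rule posdef_diagonalisation[OF assms])
  show ?thesis by (simp add: A mpow_spec[OF U] spec_mult[OF U] powr_add)
qed

lemma mpow_zero:
  assumes "posdef A"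
  shows "mpow A 0 = mat 1"
proof -
  obtain U d where U: "unitary U" and A: "A = spec U (\<lambda>i. of_real (d i))" and d: "\<forall>i. 0 < d i"
    by (rule posdef_diagonalisation[OF assms])
  have "d i \<noteq> 0" for i using d[rule_format, of i] by simp
  then show ?thesis by (simp add: A mpow_spec[OF U] spec_one[OF U])
qed

lemma mpow_one:
  assumes "posdef A"
  shows "mpow A 1 = A"
proof -
  obtain U d where U: "unitary U" and A: "A = spec U (\<lambda>i. of_real (d i))" and d: "\<forall>i. 0 < d i"
    by (rule posdef_diagonalisation[OF assms])
  have "d i powr 1 = d i" for i using d[rule_format, of i] by simp
  then show ?thesis by (simp add: A mpow_spec[OF U])
qed

lemma mpow_cancel:
  assumes "posdef A"
  shows "mpow A r ** mpow A (- r) = mat 1" "mpow A (- r) ** mpow A r = mat 1"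
  by (simp_all add: mpow_add[OF assms] mpow_zero[OF assms])

lemma matrix_inv_mpow: "posdef A \<Longrightarrow> matrix_inv (mpow A r) = mpow A (- r)"
  by (rule matrix_inv_eqI) (rule mpow_cancel)

lemma matrix_inv_posdef: "posdef A \<Longrightarrow> matrix_inv A = mpow A (- 1)"
  using matrix_inv_mpow[of A 1] by (simp add: mpow_one)

lemma posdef_inv:
  assumes "posdef A"
  shows "A ** matrix_inv A = mat 1" "matrix_inv A ** A = mat 1" "posdef (matrix_inv A)"
  using assms mpow_cancel[OF assms, of 1] posdef_mpow[OF assms, of "-1"]
  by (simp_all add: matrix_inv_posdef mpow_one)

lemma hermitian_mpow: "posdef A \<Longrightarrow> cadj (mpow A r) = mpow A r"
  using posdef_hermitian[OF posdef_mpow] by (simp add: hermitian_def)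

lemma posdef_congruence:
  assumes "posdef A" "L ** K = mat 1"
  shows "posdef (cadj K ** A ** K)"
proof -
  have "K *v x \<noteq> 0" if "x \<noteq> 0" for x
    using that assms(2) by (metis matrix_vector_mul_assoc matrix_vector_mul_lid matrix_vector_mult_0_right)
  then show ?thesis
    using assms(1) by (simp add: posdef_iff hermitian_congruence qform_congruence)
qed

text \<open>Completing the square: the difference of the two sides is the form of \<open>C\<close>
  at \<open>matrix_inv C *v w - y\<close>. Together with \<open>qform_inv_eq\<close> this writes the
  inverse as a supremum over \<open>y\<close> of functions affine in \<open>C\<close> and
  \<open>w\<close>.\<close>

lemma qform_inv_ge:
  assumes "posdef C"
  shows "2 * Re (cinner y w) - qform C y \<le> qform (matrix_inv C) w"
proof -
  let ?v = "matrix_inv C *v w"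
  have H: "hermitian C" using assms posdef_hermitian by blast
  have Cv: "C *v ?v = w" by (simp add: matrix_vector_mul_assoc posdef_inv[OF assms])
  have "qform C ?v = qform (matrix_inv C) w"
    unfolding qform_def[of C] Cv by (simp add: qform_def) (metis cnj_cinner complex_cnj(1) cnj.sel(1))
  moreover have "qform C ((- 1) *s y) = qform C y" unfolding qform_smult by simp
  moreover have "0 \<le> qform C (?v + (- 1) *s y)"
    using posdef_imp_psd[OF assms] psd_def by blast
  ultimately show ?thesis
    unfolding qform_hermitian_add_vec[OF H] Cv cinner_scale_left by simp
qed

lemma qform_inv_eq:
  assumes "posdef C"
  shows "qform (matrix_inv C) w = 2 * Re (cinner (matrix_inv C *v w) w) - qform C (matrix_inv C *v w)"
proof -
  let ?v = "matrix_inv C *v w"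
  have Cv: "C *v ?v = w" by (simp add: matrix_vector_mul_assoc posdef_inv[OF assms])
  have "Re (cinner ?v w) = qform (matrix_inv C) w"
    by (simp add: qform_def) (metis cnj_cinner cnj.sel(1))
  then show ?thesis by (simp add: qform_def[of C] Cv)
qed

text \<open>The squared overlaps \<open>p j a\<close> of the two bases are doubly stochastic: sums
  over \<open>a\<close> equal to 1 permit Jensen's inequality for each \<open>j\<close>, and sums
  over \<open>j\<close> equal to 1 recover the eigenvalue sum.\<close>

lemma peierls:
  assumes U: "unitary U" and V: "unitary V" and cv: "convex_on I h" and d: "\<And>i. d i \<in> I"
  shows "(\<Sum>j\<in>UNIV. h (qform (spec U (\<lambda>i. of_real (d i))) (column j V))) \<le> (\<Sum>i\<in>UNIV. h (d i))"
proof -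
  define p where "p j a = (cmod (cinner (column a U) (column j V)))\<^sup>2" for j a
  have p: "p j a \<ge> 0" for j a by (simp add: p_def)
  have s1: "(\<Sum>a\<in>UNIV. p j a) = 1" for j
    by (simp add: p_def parseval[OF U] norm_column_unitary[OF V])
  have s2: "(\<Sum>j\<in>UNIV. p j a) = 1" for a
  proof -
    have "p j a = (cmod (cinner (column j V) (column a U)))\<^sup>2" for j
      unfolding p_def by (metis cnj_cinner complex_mod_cnj)
    then show ?thesis by (simp add: parseval[OF V] norm_column_unitary[OF U])
  qed
  have "(\<Sum>j\<in>UNIV. h (qform (spec U (\<lambda>i. of_real (d i))) (column j V)))
      = (\<Sum>j\<in>UNIV. h (\<Sum>a\<in>UNIV. p j a *\<^sub>R d a))"
    by (simp add: qform_spec p_def mult.commute)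
  also have "\<dots> \<le> (\<Sum>j\<in>UNIV. \<Sum>a\<in>UNIV. p j a * h (d a))"
    by (intro sum_mono convex_on_sum[OF _ _ cv]) (auto simp: s1 p d)
  also have "\<dots> = (\<Sum>a\<in>UNIV. \<Sum>j\<in>UNIV. p j a * h (d a))" by (rule sum.swap)
  also have "\<dots> = (\<Sum>a\<in>UNIV. h (d a))" by (simp add: s2 flip: sum_distrib_right)
  finally show ?thesis .
qed

section \<open>Positive linear maps\<close>

definition posmap :: "(complex^'n^'n \<Rightarrow> complex^'l^'l) \<Rightarrow> bool" where
  "posmap \<Phi> \<longleftrightarrow> clinear_map \<Phi> \<and> (\<forall>P. psd P \<longrightarrow> psd (\<Phi> P))"

lemma clinear_map_add: "clinear_map \<Phi> \<Longrightarrow> \<Phi> (A + B) = \<Phi> A + \<Phi> B"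
  by (simp add: clinear_map_def)

lemma clinear_map_cscale: "clinear_map \<Phi> \<Longrightarrow> \<Phi> (cscale c A) = cscale c (\<Phi> A)"
  by (simp add: clinear_map_def)

lemma clinear_map_zero:
  assumes "clinear_map \<Phi>"
  shows "\<Phi> 0 = 0"
  using clinear_map_add[OF assms, of 0 0] by simp

lemma clinear_map_sum:
  assumes "clinear_map \<Phi>"
  shows "\<Phi> (\<Sum>i\<in>I. f i) = (\<Sum>i\<in>I. \<Phi> (f i))"
  by (induction I rule: infinite_finite_induct)
    (simp_all add: clinear_map_zero[OF assms] clinear_map_add[OF assms])

lemma clinear_map_diff:
  assumes "clinear_map \<Phi>"
  shows "\<Phi> (A - B) = \<Phi> A - \<Phi> B"
  using clinear_map_add[OF assms, of "A - B" B] by (simp add: algebra_simps)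

text \<open>Adding \<open>e\<close> times the identity makes \<open>P\<close> positive definite, so
  nonnegativity of the form follows in the limit as \<open>e\<close> tends to 0. Hermiticity of
  \<open>\<Phi> P\<close> follows at \<open>e = 1\<close> by subtracting
  \<open>\<Phi> (mat 1)\<close>.\<close>

lemma strictly_positive_posmap:
  assumes lin: "clinear_map \<Phi>" and pos: "strictly_positive \<Phi>"
  shows "posmap \<Phi>"
proof -
  have "psd (\<Phi> P)" if "psd P" for P
  proof -
    have eps: "posdef (P + cscale (of_real e) (mat 1))" if "e > 0" for e :: real
      using \<open>psd P\<close> that unfolding psd_def posdef_iff
      by (auto simp: qform_add qform_cscale hermitian_add hermitian_cscale intro: add_nonneg_pos)
    have eps': "posdef (\<Phi> P + cscale (of_real e) (\<Phi> (mat 1)))" if "e > 0" for e :: real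
      using eps[OF that] pos unfolding strictly_positive_def
      by (metis lin clinear_map_add clinear_map_cscale)
    have h1: "hermitian (\<Phi> (mat 1))"
      using pos posdef_hermitian posdef_mat1 unfolding strictly_positive_def by blast
    have "hermitian (\<Phi> P)"
      using hermitian_diff[OF posdef_hermitian[OF eps'[of 1]] h1] by simp
    moreover have "0 \<le> qform (\<Phi> P) x" for x
    proof (rule tendsto_lowerbound)
      show "((\<lambda>e. qform (\<Phi> P) x + e * qform (\<Phi> (mat 1)) x) \<longlongrightarrow> qform (\<Phi> P) x) (at_right 0)"
        by (auto intro!: tendsto_eq_intros)
      show "\<forall>\<^sub>F e in at_right 0. 0 \<le> qform (\<Phi> P) x + e * qform (\<Phi> (mat 1)) x"
      proof (rule eventually_at_right_less[THEN eventually_mono])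
        fix e :: real assume "0 < e"
        then show "0 \<le> qform (\<Phi> P) x + e * qform (\<Phi> (mat 1)) x"
          using posdef_imp_psd[OF eps'] by (simp add: psd_def qform_add qform_cscale)
      qed
    qed simp
    ultimately show ?thesis by (simp add: psd_def)
  qed
  then show ?thesis using lin by (simp add: posmap_def)
qed

lemma matrix_distribs:
  fixes A A' :: "complex^'n^'m" and B B' :: "complex^'k^'n"
  shows "A ** (B + B') = A ** B + A ** B'" "(A + A') ** B = A ** B + A' ** B"
    "A ** (B - B') = A ** B - A ** B'" "(A - A') ** B = A ** B - A' ** B"
  by (simp_all add: matrix_matrix_mult_def vec_eq_iff algebra_simps sum.distrib sum_subtractf)

lemma posmap_congruence:
  assumes "posmap \<Phi>"
  shows "posmap (\<lambda>Y. cadj K ** \<Phi> (L ** Y ** cadj L) ** K)"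
proof -
  have lin: "clinear_map \<Phi>" using assms posmap_def by blast
  have "psd (L ** P ** cadj L)" if "psd P" for P
    using psd_congruence[OF that, of "cadj L"] by simp
  then show ?thesis
    using assms unfolding posmap_def clinear_map_def
    by (auto simp: psd_congruence cscale_mult_left cscale_mult_right matrix_distribs)
qed

section \<open>Rank-one expansion and Cauchy-Schwarz inequalities for positive maps\<close>

definition proj :: "complex^'n \<Rightarrow> complex^'n^'n" where
  "proj u = (\<chi> i k. u $ i * cnj (u $ k))"

lemma proj_mult_vec: "proj u *v x = cinner u x *s u"
  by (simp add: proj_def cinner_def matrix_vector_mult_def vec_eq_iff sum_distrib_left mult_ac)

lemma psd_proj: "psd (proj u)"
proof -
  have "qform (proj u) x = (cmod (cinner u x))\<^sup>2" for x
  proof -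
    have "cinner x (proj u *v x) = of_real ((cmod (cinner u x))\<^sup>2)"
      unfolding proj_mult_vec cinner_scale_right complex_norm_square cnj_cinner by (rule refl)
    then show ?thesis by (simp add: qform_def del: of_real_power)
  qed
  moreover have "hermitian (proj u)"
    by (simp add: hermitian_def cadj_def proj_def vec_eq_iff mult.commute)
  ultimately show ?thesis by (simp add: psd_def)
qed

lemma spec_eq_sum_proj: "spec U c = (\<Sum>j\<in>UNIV. cscale (c j) (proj (column j U)))"
  by (simp add: vec_eq_iff spec_def cscale_def proj_def column_def)
    (simp add: matrix_matrix_mult_def[of "U ** cdiag c"] mult_cdiag_component cadj_def mult_ac)

lemma matrix_sum_mult_vec: "(\<Sum>j\<in>I. A j) *v y = (\<Sum>j\<in>I. A j *v (y :: complex^'n))"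
  by (induction I rule: infinite_finite_induct) (simp_all add: matrix_vector_mult_add_rdistrib)

text \<open>A linear map acts on a spectral sum only through its values on rank-one matrices, which
  are positive semidefinite for a positive map. Operator estimates thereby become sums over
  \<open>j\<close>.\<close>

lemma cinner_linear_spec:
  assumes "clinear_map \<Phi>"
  shows "cinner x (\<Phi> (spec U c) *v y) = (\<Sum>j\<in>UNIV. c j * cinner x (\<Phi> (proj (column j U)) *v y))"
  by (simp add: spec_eq_sum_proj clinear_map_sum[OF assms] clinear_map_cscale[OF assms]
      matrix_sum_mult_vec cinner_sum_right cscale_mult_vec cinner_scale_right)

lemma unimodular_phase: "\<exists>\<alpha>. cmod \<alpha> = 1 \<and> \<alpha> * z = of_real (cmod z)"
proof (cases "z = 0")
  case False
  have "cnj z / of_real (cmod z) * z = of_real (cmod z)"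
    using False by (simp add: field_simps power2_eq_square[symmetric] complex_norm_square[symmetric] mult.commute)
  moreover have "cmod (cnj z / of_real (cmod z)) = 1" using False by (simp add: norm_divide)
  ultimately show ?thesis by blast
qed (auto intro: exI[of _ 1])

text \<open>The arithmetic mean replaces the geometric one on the right, so that the bound can be
  summed over several \<open>P\<close>. A phase turns the cross term into its modulus.\<close>

lemma psd_cauchy_schwarz:
  assumes "psd P"
  shows "2 * cmod (cinner x (P *v y)) \<le> qform P x + qform P y"
proof -
  obtain \<alpha> where \<alpha>: "cmod \<alpha> = 1" "\<alpha> * cinner x (P *v y) = of_real (cmod (cinner x (P *v y)))"
    using unimodular_phase by blast
  have "0 \<le> qform P (y + (- cnj \<alpha>) *s x)" using assms by (simp add: psd_def)
  also have "\<dots> = qform P y - 2 * Re (\<alpha> * cinner x (P *v y)) + qform P x"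
    unfolding qform_hermitian_add_vec[OF psd_hermitian[OF assms]] qform_smult cinner_scale_left
    using \<alpha>(1) by simp
  finally show ?thesis by (simp add: \<alpha>(2))
qed

text \<open>\<open>\<Omega>\<close> is applied to the square of \<open>\<alpha> K - L\<close> for a
  phase \<open>\<alpha>\<close>. This uses positivity on squares alone, at the price of the same
  vector \<open>x\<close> on both sides.\<close>

lemma posmap_cauchy_schwarz:
  assumes "posmap \<Omega>"
  shows "2 * cmod (cinner x (\<Omega> (K ** cadj L) *v x))
    \<le> qform (\<Omega> (K ** cadj K)) x + qform (\<Omega> (L ** cadj L)) x"
proof -
  have lin: "clinear_map \<Omega>" using assms posmap_def by blast
  define z where "z = cinner x (\<Omega> (K ** cadj L) *v x)"
  define w where "w = cinner x (\<Omega> (L ** cadj K) *v x)"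
  have exp: "(cscale \<alpha> K - L) ** cadj (cscale \<alpha> K - L)
      = cscale (\<alpha> * cnj \<alpha>) (K ** cadj K) + L ** cadj L
        - (cscale \<alpha> (K ** cadj L) + cscale (cnj \<alpha>) (L ** cadj K))" for \<alpha>
    by (simp add: cadj_diff cadj_cscale matrix_distribs cscale_mult_left
        cscale_mult_right cscale_cscale mult.commute)
      (simp add: cscale_def vec_eq_iff algebra_simps)
  have val: "cinner x (\<Omega> ((cscale \<alpha> K - L) ** cadj (cscale \<alpha> K - L)) *v x)
      = cinner x (\<Omega> (K ** cadj K) *v x) + cinner x (\<Omega> (L ** cadj L) *v x) - (\<alpha> * z + cnj \<alpha> * w)"
    if "cmod \<alpha> = 1" for \<alpha>
  proof -
    have "\<alpha> * cnj \<alpha> = 1" using complex_norm_square[of \<alpha>] that by simp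
    then show ?thesis unfolding exp
      by (simp add: clinear_map_add[OF lin] clinear_map_diff[OF lin] clinear_map_cscale[OF lin]
          matrix_vector_mult_add_rdistrib matrix_vector_mult_diff_rdistrib cscale_mult_vec cinner_simps
          z_def w_def)
  qed
  have real: "cinner x (\<Omega> (M ** cadj M) *v x) = of_real (qform (\<Omega> (M ** cadj M)) x)"
    and pos: "0 \<le> qform (\<Omega> (M ** cadj M)) x" for M
    using assms psd_mult_cadj[of M] unfolding posmap_def by (auto simp: psd_def hermitian_cinner_real)
  have im: "Im (\<alpha> * z + cnj \<alpha> * w) = 0" if "cmod \<alpha> = 1" for \<alpha>
    using arg_cong[OF val[OF that], of Im] unfolding real by simp
  \<comment> \<open>That \<open>\<Omega>\<close> respects adjoints at \<open>x\<close> is read off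
    from the vanishing imaginary parts for the phases 1 and \<open>\<i>\<close>.\<close>
  have "Im z + Im w = 0" "Re z - Re w = 0" using im[of 1] im[of \<i>] by simp_all
  then have w: "w = cnj z" by (simp add: complex_eq_iff)
  obtain \<alpha> where \<alpha>: "cmod \<alpha> = 1" "\<alpha> * z = of_real (cmod z)"
    using unimodular_phase by blast
  have "cnj \<alpha> * w = of_real (cmod z)"
    unfolding w by (metis \<alpha>(2) complex_cnj_complex_of_real complex_cnj_mult)
  then show ?thesis
    using arg_cong[OF val[OF \<alpha>(1)], of Re] pos[of "cscale \<alpha> K - L"] \<alpha>(2)
    unfolding real z_def[symmetric] by simp
qed

text \<open>The real and imaginary parts \<open>H\<close> and \<open>K\<close> of a unitary matrix
  are commuting Hermitian matrices and so share an eigenbasis; the eigenvalues are unimodular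
  because \<open>W\<close> preserves norms.\<close>

lemma unitary_diagonalisation:
  fixes W :: "complex^'n^'n"
  assumes "unitary W"
  obtains U c where "unitary U" "W = spec U c" "\<forall>i. cmod (c i) = 1"
proof -
  define H where "H = cscale (1/2) (W + cadj W)"
  define K where "K = cscale (- \<i>/2) (W - cadj W)"
  have "hermitian H" by (simp add: H_def hermitian_def cadj_cscale cadj_add add.commute)
  moreover have "hermitian K"
    by (simp add: K_def hermitian_def cadj_cscale cadj_diff) (simp add: cscale_def vec_eq_iff algebra_simps)
  moreover have "H ** K = K ** H"
    using assms by (simp add: H_def K_def cscale_mult_left cscale_mult_right cscale_cscale
        matrix_distribs mult.commute) (simp add: cscale_def vec_eq_iff algebra_simps)
  ultimately obtain U a b where U: "unitary U" and "H = spec U (\<lambda>i. of_real (a i))"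
      "K = spec U (\<lambda>i. of_real (b i))"
    by (rule commuting_hermitian_diagonalisation)
  moreover have "W = H + cscale \<i> K"
    by (simp add: H_def K_def cscale_def vec_eq_iff field_simps)
  ultimately have W: "W = spec U (\<lambda>i. of_real (a i) + \<i> * of_real (b i))"
    by (intro spec_eqI) (simp_all add: matrix_vector_mult_add_rdistrib cscale_mult_vec spec_column[OF U]
        vector_sadd_rdistrib vector_smult_assoc)
  have "cmod (of_real (a i) + \<i> * of_real (b i)) = 1" for i
  proof -
    have "norm (W *v column i U) = norm (column i U)" by (rule norm_unitary[OF assms])
    then show ?thesis unfolding W spec_column[OF U] norm_smult norm_column_unitary[OF U] by simp
  qed
  then show ?thesis using that[OF U W] by blast
qed

text \<open>In the eigenbasis of \<open>W\<close>, apply Cauchy-Schwarz to the image under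
  \<open>\<Theta>\<close> of each rank-one projection. The eigenvalues are unimodular and the images
  add up to the identity.\<close>

lemma posmap_unitary_contraction:
  assumes "posmap \<Theta>" and unital: "\<Theta> (mat 1) = mat 1" and "unitary W"
  shows "2 * cmod (cinner x (\<Theta> W *v y)) \<le> (norm x)\<^sup>2 + (norm y)\<^sup>2"
proof -
  have lin: "clinear_map \<Theta>" using assms posmap_def by blast
  obtain U c where U: "unitary U" and W: "W = spec U c" and c: "\<forall>i. cmod (c i) = 1"
    by (rule unitary_diagonalisation[OF assms(3)])
  have P: "psd (\<Theta> (proj (column j U)))" for j using assms psd_proj posmap_def by blast
  have sum: "(\<Sum>j\<in>UNIV. qform (\<Theta> (proj (column j U))) x) = (norm x)\<^sup>2" for x
    using arg_cong[OF cinner_linear_spec[OF lin, of x U "\<lambda>_. 1" x], of Re]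
    by (simp add: spec_one[OF U] unital qform_def cinner_self flip: of_real_power)
  have "2 * cmod (cinner x (\<Theta> W *v y)) \<le> 2 * (\<Sum>j\<in>UNIV. cmod (cinner x (\<Theta> (proj (column j U)) *v y)))"
    unfolding W cinner_linear_spec[OF lin]
    by (intro mult_left_mono order.trans[OF norm_sum]) (simp_all add: norm_mult c)
  also have "\<dots> \<le> (\<Sum>j\<in>UNIV. qform (\<Theta> (proj (column j U))) x + qform (\<Theta> (proj (column j U))) y)"
    unfolding sum_distrib_left by (intro sum_mono psd_cauchy_schwarz P)
  finally show ?thesis by (simp add: sum.distrib sum)
qed

lemma trace_spec_mult:
  assumes U: "unitary U"
  shows "trace (spec U c ** M) = (\<Sum>j\<in>UNIV. c j * cinner (column j U) (M *v column j U))"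
proof -
  have "cinner (column j U) (spec U c *v y) = c j * cinner (column j U) y" for j y
    unfolding cinner_matrix[of _ "spec U c"] by (simp add: cadj_spec spec_column[OF U] cinner_scale_left)
  then show ?thesis by (simp add: trace_eq_columns[OF U] flip: matrix_vector_mul_assoc)
qed

text \<open>In the eigenbasis of \<open>N\<close> the trace is a sum of unimodular multiples of
  diagonal values, to which \<open>posmap_cauchy_schwarz\<close> applies one vector at a
  time.\<close>

lemma posmap_trace_unitary:
  assumes "posmap \<Omega>" and "unitary N"
  shows "2 * cmod (trace (N ** \<Omega> (K ** cadj L))) \<le> rtrace (\<Omega> (K ** cadj K)) + rtrace (\<Omega> (L ** cadj L))"
proof -
  obtain U c where U: "unitary U" and N: "N = spec U c" and c: "\<forall>i. cmod (c i) = 1"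
    by (rule unitary_diagonalisation[OF assms(2)])
  have tr: "rtrace M = (\<Sum>j\<in>UNIV. qform M (column j U))" for M
    by (simp add: rtrace_def trace_eq_columns[OF U] qform_def)
  have "trace (N ** \<Omega> (K ** cadj L)) = (\<Sum>j\<in>UNIV. c j * cinner (column j U) (\<Omega> (K ** cadj L) *v column j U))"
    unfolding N by (rule trace_spec_mult[OF U])
  then have "2 * cmod (trace (N ** \<Omega> (K ** cadj L)))
      \<le> 2 * (\<Sum>j\<in>UNIV. cmod (cinner (column j U) (\<Omega> (K ** cadj L) *v column j U)))"
    by (simp only:) (intro mult_left_mono order.trans[OF norm_sum], simp_all add: norm_mult c)
  also have "\<dots> \<le> (\<Sum>j\<in>UNIV. qform (\<Omega> (K ** cadj K)) (column j U) + qform (\<Omega> (L ** cadj L)) (column j U))"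
    unfolding sum_distrib_left by (intro sum_mono posmap_cauchy_schwarz assms)
  finally show ?thesis by (simp add: sum.distrib tr)
qed

text \<open>A Kadison-Schwarz inequality. Conjugation by \<open>T\<close> turns \<open>E\<close>
  into a Hermitian \<open>H\<close> with eigenvalues \<open>a j\<close>; a sum of nonnegative forms
  at the vectors \<open>a j x + y\<close> is a quadratic in \<open>y\<close> whose minimum is the
  difference of the two sides.\<close>

lemma posmap_schwarz:
  assumes "posmap \<Phi>" and C: "posdef C" and E: "hermitian E" and FC: "posdef (\<Phi> C)"
  shows "qform (\<Phi> E ** matrix_inv (\<Phi> C) ** \<Phi> E) x \<le> qform (\<Phi> (E ** matrix_inv C ** E)) x"
proof -
  have lin: "clinear_map \<Phi>" using assms posmap_def by blast
  define S T where "S = mpow C (1/2)" and "T = mpow C (- (1/2))"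
  have ST: "S ** T = mat 1" "T ** S = mat 1" "S ** S = C" "T ** T = matrix_inv C"
    unfolding S_def T_def using mpow_cancel[OF C, of "1/2"]
    by (simp_all add: mpow_add[OF C] mpow_one[OF C] matrix_inv_posdef[OF C])
  have adj: "cadj S = S" "cadj T = T" "cadj E = E"
    using hermitian_mpow[OF C] E by (simp_all add: S_def T_def hermitian_def)
  define \<Psi> where "\<Psi> Y = \<Phi> (S ** Y ** S)" for Y
  have \<Psi>: "posmap \<Psi>"
    using posmap_congruence[OF assms(1), of "mat 1" S] by (simp add: \<Psi>_def[abs_def] adj)
  then have lin': "clinear_map \<Psi>" by (simp add: posmap_def)
  define H where "H = T ** E ** T"
  have "hermitian H" by (simp add: hermitian_def H_def cadj_mult adj matrix_mul_assoc)
  then obtain U a where U: "unitary U" and H: "H = spec U (\<lambda>i. of_real (a i))"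
    by (rule hermitian_diagonalisation)
  have SHS: "S ** H ** S = E"
    unfolding H_def by (metis ST(1,2) matrix_mul_assoc matrix_mul_lid matrix_mul_rid)
  have SHHS: "S ** (H ** H) ** S = E ** matrix_inv C ** E"
    unfolding H_def ST(4)[symmetric] by (metis ST(1,2) matrix_mul_assoc matrix_mul_lid matrix_mul_rid)
  have H2: "H ** H = spec U (\<lambda>i. of_real ((a i)\<^sup>2))"
    unfolding H spec_mult[OF U] by (simp add: power2_eq_square)
  \<comment> \<open>The minimiser of
    \<open>qform (\<Phi> C) y + 2 * Re (cinner y (\<Phi> E *v x))\<close>.\<close>
  define y where "y = - (matrix_inv (\<Phi> C) *v (\<Phi> E *v x))"
  have P: "psd (\<Psi> (proj (column j U)))" for j using \<Psi> psd_proj posmap_def by blast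
  \<comment> \<open>Hermiticity of \<open>\<Phi> E\<close> comes from the rank-one expansion, whose
    coefficients \<open>a j\<close> are real.\<close>
  have hE: "hermitian (\<Phi> E)"
  proof -
    have "cinner v (\<Psi> (proj (column j U)) *v w) = cinner (\<Psi> (proj (column j U)) *v v) w" for v w j
      using P psd_hermitian hermitian_cinner by blast
    then have "cinner v (\<Phi> E *v w) = cnj (cinner w (\<Phi> E *v v))" for v w
      unfolding SHS[symmetric] \<Psi>_def[symmetric] H cinner_linear_spec[OF lin']
      by (simp add: cnj_cinner)
    then have "cinner v (\<Phi> E *v w) = cinner v (cadj (\<Phi> E) *v w)" for v w
      by (simp add: cnj_cinner cinner_matrix[of v "cadj _"])
    then have "cadj (\<Phi> E) *v w = \<Phi> E *v w" for w
      by (metis (no_types, lifting) cinner_axis_left vec_eq_iff)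
    then show ?thesis unfolding hermitian_def by (simp add: matrix_eq)
  qed
  have "0 \<le> (\<Sum>j\<in>UNIV. qform (\<Psi> (proj (column j U))) (of_real (a j) *s x + y))"
    using P by (auto intro: sum_nonneg simp: psd_def)
  also have "\<dots> = (\<Sum>j\<in>UNIV. (a j)\<^sup>2 * Re (cinner x (\<Psi> (proj (column j U)) *v x))
        + 2 * (a j * Re (cinner y (\<Psi> (proj (column j U)) *v x)))
        + Re (cinner y (\<Psi> (proj (column j U)) *v y)))"
    by (intro sum.cong refl)
      (simp add: qform_hermitian_add_vec[OF psd_hermitian[OF P]] qform_smult matrix_vector_smult cinner_simps,
       simp add: qform_def)
  also have "\<dots> = Re (cinner x (\<Psi> (H ** H) *v x)) + 2 * Re (cinner y (\<Psi> H *v x)) + Re (cinner y (\<Psi> (mat 1) *v y))"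
    unfolding H2 unfolding H spec_one[OF U, symmetric] cinner_linear_spec[OF lin']
    by (simp add: sum.distrib sum_distrib_left flip: of_real_power)
  also have "\<dots> = qform (\<Phi> (E ** matrix_inv C ** E)) x + 2 * Re (cinner y (\<Phi> E *v x)) + qform (\<Phi> C) y"
    by (simp add: \<Psi>_def SHS SHHS ST qform_def)
  finally have main: "- 2 * Re (cinner y (\<Phi> E *v x)) - qform (\<Phi> C) y \<le> qform (\<Phi> (E ** matrix_inv C ** E)) x"
    by simp
  have "qform (\<Phi> E ** matrix_inv (\<Phi> C) ** \<Phi> E) x = qform (matrix_inv (\<Phi> C)) (\<Phi> E *v x)"
    using qform_congruence[of "\<Phi> E" "matrix_inv (\<Phi> C)" x] hE by (simp add: hermitian_def)
  also have "\<dots> = 2 * Re (cinner (- y) (\<Phi> E *v x)) - qform (\<Phi> C) (- y)"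
    using qform_inv_eq[OF FC, of "\<Phi> E *v x"] by (simp add: y_def)
  also have "\<dots> = - 2 * Re (cinner y (\<Phi> E *v x)) - qform (\<Phi> C) y"
    using cinner_scale_left[of "-1" y] qform_smult[of "\<Phi> C" "-1" y] by simp
  finally show ?thesis using main by simp
qed

section \<open>Interpolation\<close>

text \<open>Holomorphy is asked on the whole plane, since all functions below are entire; this
  avoids any discussion of boundary values. Boundedness is asked on the strip only.\<close>

definition strip_bounded :: "(complex \<Rightarrow> complex) \<Rightarrow> bool" where
  "strip_bounded h \<longleftrightarrow> h holomorphic_on UNIV \<and> (\<exists>C. \<forall>z. 0 \<le> Re z \<and> Re z \<le> 1 \<longrightarrow> cmod (h z) \<le> C)"

text \<open>Dividing by \<open>M0^(1-z) M1^z\<close> makes both boundary bounds equal to 1. A factor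
  \<open>exp (\<epsilon> (z^2 - 1))\<close> gives decay at infinity, so the maximum modulus
  principle applies on a tall rectangle; then \<open>\<epsilon>\<close> tends to 0.\<close>

theorem three_lines:
  assumes h: "strip_bounded h" and M: "0 < M0" "0 < M1"
    and h0: "\<And>z. Re z = 0 \<Longrightarrow> cmod (h z) \<le> M0" and h1: "\<And>z. Re z = 1 \<Longrightarrow> cmod (h z) \<le> M1"
    and \<theta>: "0 \<le> \<theta>" "\<theta> \<le> 1"
  shows "cmod (h (of_real \<theta>)) \<le> M0 powr (1 - \<theta>) * M1 powr \<theta>"
proof -
  define k where "k z = h z * exp (- (1 - z) * of_real (ln M0) - z * of_real (ln M1))" for z
  have nk: "cmod (k z) = cmod (h z) * exp (- (1 - Re z) * ln M0 - Re z * ln M1)" for z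
    by (simp add: k_def norm_mult norm_exp_eq_Re)
  have k0: "cmod (k z) \<le> 1" if "Re z = 0" for z
    using h0[OF that] M unfolding nk by (simp add: that exp_minus field_simps)
  have k1: "cmod (k z) \<le> 1" if "Re z = 1" for z
    using h1[OF that] M unfolding nk by (simp add: that exp_minus field_simps)
  obtain C where C: "\<And>z. 0 \<le> Re z \<Longrightarrow> Re z \<le> 1 \<Longrightarrow> cmod (h z) \<le> C"
    using h unfolding strip_bounded_def by blast
  \<comment> \<open>The added 1 ensures that \<open>ln B\<close> is nonnegative, as the square root
    in \<open>Y\<close> requires.\<close>
  define B where "B = \<bar>C\<bar> * exp (\<bar>ln M0\<bar> + \<bar>ln M1\<bar>) + 1"
  have kB: "cmod (k z) \<le> B" if "0 \<le> Re z" "Re z \<le> 1" for z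
  proof -
    have "- (1 - Re z) * ln M0 \<le> \<bar>- (1 - Re z)\<bar> * \<bar>ln M0\<bar>" "- (Re z) * ln M1 \<le> \<bar>- Re z\<bar> * \<bar>ln M1\<bar>"
      unfolding abs_mult[symmetric] by (rule abs_ge_self)+
    moreover have "\<bar>- (1 - Re z)\<bar> * \<bar>ln M0\<bar> \<le> 1 * \<bar>ln M0\<bar>" "\<bar>- Re z\<bar> * \<bar>ln M1\<bar> \<le> 1 * \<bar>ln M1\<bar>"
      using that by (intro mult_right_mono; simp)+
    ultimately have "- (1 - Re z) * ln M0 - Re z * ln M1 \<le> \<bar>ln M0\<bar> + \<bar>ln M1\<bar>" by simp
    then have "cmod (k z) \<le> \<bar>C\<bar> * exp (\<bar>ln M0\<bar> + \<bar>ln M1\<bar>)"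
      unfolding nk using C[OF that] by (intro mult_mono) auto
    then show ?thesis by (simp add: B_def)
  qed
  have Bpos: "B \<ge> 1" by (simp add: B_def)
  have holk: "k holomorphic_on UNIV"
    using h unfolding k_def strip_bounded_def by (auto intro!: holomorphic_intros)
  have eps: "cmod (k (of_real \<theta>)) \<le> exp \<epsilon>" if "\<epsilon> > 0" for \<epsilon>
  proof -
    define g where "g z = k z * exp (of_real \<epsilon> * (z\<^sup>2 - 1))" for z
    have ng: "cmod (g z) = cmod (k z) * exp (\<epsilon> * ((Re z)\<^sup>2 - (Im z)\<^sup>2 - 1))" for z
      by (simp add: g_def norm_mult norm_exp_eq_Re power2_eq_square)
    have le: "exp (\<epsilon> * ((Re z)\<^sup>2 - (Im z)\<^sup>2 - 1)) \<le> exp (- \<epsilon> * (Im z)\<^sup>2)" if "0 \<le> Re z" "Re z \<le> 1" for z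
    proof -
      have "(Re z)\<^sup>2 \<le> 1" using that by (simp add: power_le_one)
      then have "\<epsilon> * ((Re z)\<^sup>2 - (Im z)\<^sup>2 - 1) \<le> \<epsilon> * (- (Im z)\<^sup>2)"
        using \<open>\<epsilon> > 0\<close> by (intro mult_left_mono) auto
      then show ?thesis by simp
    qed
    \<comment> \<open>A height at which the Gaussian factor beats \<open>B\<close> on the horizontal
      sides; the added 1 keeps it positive.\<close>
    define Y where "Y = sqrt (ln B / \<epsilon>) + 1"
    have Y0: "Y > 0" using Bpos that by (simp add: Y_def add_nonneg_pos)
    have Y: "B * exp (- \<epsilon> * Y\<^sup>2) \<le> 1"
    proof -
      have "ln B / \<epsilon> \<le> Y\<^sup>2"
        unfolding Y_def using Bpos that by (subst power2_sum) simp
      then have "ln B \<le> \<epsilon> * Y\<^sup>2" using that by (simp add: field_simps)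
      then have "B \<le> exp (\<epsilon> * Y\<^sup>2)" using Bpos by (metis exp_le_cancel_iff exp_ln less_le_trans zero_less_one)
      then show ?thesis by (simp add: exp_minus field_simps)
    qed
    let ?S = "cbox (Complex 0 (- Y)) (Complex 1 Y)"
    have "cmod (g (of_real \<theta>)) \<le> 1"
    proof (rule maximum_modulus_frontier[of g ?S])
      show "g holomorphic_on interior ?S"
        unfolding g_def by (intro holomorphic_intros holomorphic_on_subset[OF holk]) auto
      show "continuous_on (closure ?S) g"
        unfolding g_def
        by (intro continuous_intros holomorphic_on_imp_continuous_on holomorphic_on_subset[OF holk]) auto
      show "of_real \<theta> \<in> ?S" using \<theta> Y0 by (simp add: in_cbox_complex_iff)
      fix z assume "z \<in> frontier ?S"
      then have z: "0 \<le> Re z" "Re z \<le> 1" "- Y \<le> Im z" "Im z \<le> Y"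
        and or: "Re z = 0 \<or> Re z = 1 \<or> Im z = Y \<or> Im z = - Y"
        by (auto simp: frontier_def in_cbox_complex_iff in_box_complex_iff not_less)
      have e1: "exp (- \<epsilon> * (Im z)\<^sup>2) \<le> 1" using that by simp
      from or consider "Re z = 0 \<or> Re z = 1" | "(Im z)\<^sup>2 = Y\<^sup>2" by auto
      then show "cmod (g z) \<le> 1"
      proof cases
        case 1
        then have "cmod (k z) \<le> 1" using k0 k1 by blast
        moreover have "exp (\<epsilon> * ((Re z)\<^sup>2 - (Im z)\<^sup>2 - 1)) \<le> 1" using le[OF z(1,2)] e1 by linarith
        ultimately show ?thesis unfolding ng by (intro mult_le_one) auto
      next
        case 2
        then have "cmod (g z) \<le> B * exp (- \<epsilon> * Y\<^sup>2)"
          unfolding ng using le[OF z(1,2)] kB[OF z(1,2)] Bpos by (intro mult_mono) auto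
        then show ?thesis using Y by linarith
      qed
    qed simp
    then have "cmod (k (of_real \<theta>)) * exp (\<epsilon> * (\<theta>\<^sup>2 - 1)) \<le> 1" by (simp add: ng)
    then have "cmod (k (of_real \<theta>)) \<le> exp (\<epsilon> * (1 - \<theta>\<^sup>2))"
      by (simp add: exp_minus[symmetric] field_simps exp_diff)
    also have "\<dots> \<le> exp \<epsilon>" using that by (simp add: algebra_simps)
    finally show ?thesis .
  qed
  have "cmod (k (of_real \<theta>)) \<le> 1"
  proof (rule tendsto_lowerbound)
    show "((\<lambda>\<epsilon>. exp \<epsilon>) \<longlongrightarrow> (1::real)) (at_right 0)" by (auto intro!: tendsto_eq_intros)
    show "\<forall>\<^sub>F \<epsilon> in at_right 0. cmod (k (of_real \<theta>)) \<le> exp \<epsilon>"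
      by (rule eventually_at_right_less[THEN eventually_mono]) (rule eps)
  qed simp
  then have "cmod (h (of_real \<theta>)) \<le> exp ((1 - \<theta>) * ln M0 + \<theta> * ln M1)"
    unfolding nk by (simp add: exp_add exp_diff exp_minus field_simps)
  then show ?thesis using M by (simp add: powr_def exp_add)
qed

section \<open>Scalar and matrix-valued entire functions bounded on the strip\<close>

lemma strip_bounded_const: "strip_bounded (\<lambda>z. c)"
  by (auto simp: strip_bounded_def)

lemma strip_bounded_add:
  assumes "strip_bounded f" "strip_bounded g"
  shows "strip_bounded (\<lambda>z. f z + g z)"
proof -
  obtain C D where "\<forall>z. 0 \<le> Re z \<and> Re z \<le> 1 \<longrightarrow> cmod (f z) \<le> C" "\<forall>z. 0 \<le> Re z \<and> Re z \<le> 1 \<longrightarrow> cmod (g z) \<le> D"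
    using assms unfolding strip_bounded_def by blast
  then have "\<forall>z. 0 \<le> Re z \<and> Re z \<le> 1 \<longrightarrow> cmod (f z + g z) \<le> C + D"
    by (meson add_mono norm_triangle_ineq order_trans)
  then show ?thesis
    using assms unfolding strip_bounded_def by (auto intro: holomorphic_on_add)
qed

lemma strip_bounded_mult:
  assumes "strip_bounded f" "strip_bounded g"
  shows "strip_bounded (\<lambda>z. f z * g z)"
proof -
  obtain C D where "\<forall>z. 0 \<le> Re z \<and> Re z \<le> 1 \<longrightarrow> cmod (f z) \<le> C" "\<forall>z. 0 \<le> Re z \<and> Re z \<le> 1 \<longrightarrow> cmod (g z) \<le> D"
    using assms unfolding strip_bounded_def by blast
  then have "\<forall>z. 0 \<le> Re z \<and> Re z \<le> 1 \<longrightarrow> cmod (f z * g z) \<le> C * D"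
    unfolding norm_mult by (meson mult_mono norm_ge_zero order_trans)
  then show ?thesis
    using assms unfolding strip_bounded_def by (auto intro: holomorphic_on_mult)
qed

lemma strip_bounded_sum:
  "(\<And>i. i \<in> I \<Longrightarrow> strip_bounded (f i)) \<Longrightarrow> strip_bounded (\<lambda>z. \<Sum>i\<in>I. f i z)"
  by (induction I rule: infinite_finite_induct) (auto intro: strip_bounded_const strip_bounded_add)

lemma norm_of_real_powr: "0 \<le> d \<Longrightarrow> cmod (of_real d powr w) = d powr Re w"
  by (cases "d = 0") (auto simp: norm_powr_real_powr)

text \<open>For \<open>d = 0\<close> this is the zero function by the convention for powers of 0;
  otherwise the modulus depends only on \<open>Re z\<close>, which is bounded on the strip.\<close>

lemma strip_bounded_powr:
  assumes d: "0 \<le> d"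
  shows "strip_bounded (\<lambda>z. of_real d powr (of_real \<alpha> * z + of_real \<beta>))"
proof (cases "d = 0")
  case True
  then show ?thesis using strip_bounded_const[of 0] by simp
next
  case False
  then have hol: "(\<lambda>z. complex_of_real d powr (of_real \<alpha> * z + of_real \<beta>)) holomorphic_on UNIV"
    by (simp add: powr_def) (intro holomorphic_intros)
  have "cmod (complex_of_real d powr (of_real \<alpha> * z + of_real \<beta>)) \<le> exp ((\<bar>\<alpha>\<bar> + \<bar>\<beta>\<bar>) * \<bar>ln d\<bar>)"
    if "0 \<le> Re z" "Re z \<le> 1" for z
  proof -
    have "(\<alpha> * Re z + \<beta>) * ln d \<le> \<bar>\<alpha> * Re z + \<beta>\<bar> * \<bar>ln d\<bar>"
      by (metis abs_ge_self abs_mult)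
    also have "\<dots> \<le> (\<bar>\<alpha>\<bar> + \<bar>\<beta>\<bar>) * \<bar>ln d\<bar>"
    proof (intro mult_right_mono)
      have "\<bar>\<alpha> * Re z\<bar> \<le> \<bar>\<alpha>\<bar> * 1" unfolding abs_mult using that by (intro mult_left_mono) auto
      then show "\<bar>\<alpha> * Re z + \<beta>\<bar> \<le> \<bar>\<alpha>\<bar> + \<bar>\<beta>\<bar>" by simp
    qed simp
    finally show ?thesis using False d by (simp add: norm_of_real_powr powr_def)
  qed
  then show ?thesis using hol unfolding strip_bounded_def by blast
qed

definition matrix_strip_bounded :: "(complex \<Rightarrow> complex^'n^'m) \<Rightarrow> bool" where
  "matrix_strip_bounded F \<longleftrightarrow> (\<forall>i j. strip_bounded (\<lambda>z. F z $ i $ j))"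

lemma matrix_strip_bounded_const: "matrix_strip_bounded (\<lambda>z. A)"
  by (simp add: matrix_strip_bounded_def strip_bounded_const)

lemma matrix_strip_bounded_mult:
  "matrix_strip_bounded F \<Longrightarrow> matrix_strip_bounded G \<Longrightarrow> matrix_strip_bounded (\<lambda>z. F z ** G z)"
  by (auto simp: matrix_strip_bounded_def matrix_matrix_mult_def intro!: strip_bounded_sum strip_bounded_mult)

lemma matrix_strip_bounded_cdiag:
  "(\<And>i. strip_bounded (\<lambda>z. c z i)) \<Longrightarrow> matrix_strip_bounded (\<lambda>z. cdiag (c z))"
proof -
  assume c: "\<And>i. strip_bounded (\<lambda>z. c z i)"
  have "strip_bounded (\<lambda>z. cdiag (c z) $ i $ j)" for i j
    using c[of i] by (cases "i = j") (simp_all add: cdiag_def strip_bounded_const)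
  then show ?thesis by (simp add: matrix_strip_bounded_def)
qed

lemma matrix_strip_bounded_spec:
  "(\<And>i. strip_bounded (\<lambda>z. c z i)) \<Longrightarrow> matrix_strip_bounded (\<lambda>z. spec U (c z))"
  unfolding spec_def
  by (intro matrix_strip_bounded_mult matrix_strip_bounded_const matrix_strip_bounded_cdiag)

text \<open>Expansion in the matrix units \<open>E i j\<close> makes every entry of
  \<open>\<Theta> (F z)\<close> a fixed linear combination of entries of \<open>F z\<close>.\<close>

lemma matrix_strip_bounded_linear:
  fixes \<Theta> :: "complex^'n^'n \<Rightarrow> complex^'l^'l"
  assumes lin: "clinear_map \<Theta>" and F: "matrix_strip_bounded F"
  shows "matrix_strip_bounded (\<lambda>z. \<Theta> (F z))"
proof -
  define E :: "'n \<Rightarrow> 'n \<Rightarrow> complex^'n^'n" where "E i j = (\<chi> k l. if k = i \<and> l = j then 1 else 0)" for i j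
  have "Y = (\<Sum>i\<in>UNIV. \<Sum>j\<in>UNIV. cscale (Y $ i $ j) (E i j))" for Y :: "complex^'n^'n"
  proof -
    have "(\<Sum>i\<in>UNIV. \<Sum>j\<in>UNIV. Y $ i $ j * (if k = i \<and> l = j then 1 else 0)) = Y $ k $ l" for k l
    proof -
      have "(\<Sum>j\<in>UNIV. Y $ i $ j * (if k = i \<and> l = j then 1 else 0)) = (if k = i then Y $ i $ l else 0)" for i
        by (cases "k = i") (auto simp: mult_delta_right)
      then show ?thesis by simp
    qed
    then show ?thesis by (simp add: vec_eq_iff cscale_def E_def)
  qed
  then have expand: "\<Theta> Y = (\<Sum>i\<in>UNIV. \<Sum>j\<in>UNIV. cscale (Y $ i $ j) (\<Theta> (E i j)))" for Y
    by (metis (no_types, lifting) clinear_map_cscale[OF lin] clinear_map_sum[OF lin] sum.cong)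
  have "\<Theta> Y $ a $ b = (\<Sum>i\<in>UNIV. \<Sum>j\<in>UNIV. Y $ i $ j * \<Theta> (E i j) $ a $ b)" for Y a b
    by (subst expand) (simp add: cscale_def)
  then have "(\<lambda>z. \<Theta> (F z) $ a $ b) = (\<lambda>z. \<Sum>i\<in>UNIV. \<Sum>j\<in>UNIV. F z $ i $ j * \<Theta> (E i j) $ a $ b)" for a b
    by (rule ext)
  then show ?thesis
    using F unfolding matrix_strip_bounded_def
    by (auto simp only: intro!: strip_bounded_sum strip_bounded_mult strip_bounded_const)
qed

lemma strip_bounded_trace: "matrix_strip_bounded F \<Longrightarrow> strip_bounded (\<lambda>z. trace (F z))"
  unfolding trace_def matrix_strip_bounded_def by (intro strip_bounded_sum) blast

section \<open>The interpolating function and its boundary bounds\<close>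

lemma cdiag_mult_vec: "(cdiag c *v x) $ j = c j * x $ j"
  by (simp add: matrix_vector_mult_def cdiag_def mult_delta_left)

lemma norm_cdiag_le:
  assumes "\<And>i. cmod (c i) \<le> 1"
  shows "norm (cdiag c *v x) \<le> norm x"
proof (rule power2_le_imp_le)
  show "(norm (cdiag c *v x))\<^sup>2 \<le> (norm x)\<^sup>2"
    unfolding norm_sum_components cdiag_mult_vec norm_mult power_mult_distrib
    using assms by (intro sum_mono mult_left_le_one_le) (auto simp: power_le_one)
qed simp

lemma spec_mat1: "spec (mat 1) c = cdiag c"
  by (simp add: spec_def)

lemma of_real_powr_real: "0 \<le> x \<Longrightarrow> complex_of_real x powr of_real y = of_real (x powr y)"
  by (simp add: powr_of_real)

text \<open>All powers use the convention \<open>0 powr z = 0\<close>, so \<open>d\<close> and \<open>s\<close> may have zeros.\<close>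

locale interpolation_term =
  fixes \<Theta> :: "complex^'n^'n \<Rightarrow> complex^'l^'l" and U V :: "complex^'n^'n" and a b :: "'n \<Rightarrow> real"
    and d s :: "'l \<Rightarrow> real" and W :: "complex^'l^'l" and r :: real
  assumes pos: "posmap \<Theta>" and unital: "\<Theta> (mat 1) = mat 1"
    and U: "unitary U" and V: "unitary V" and W: "unitary W"
    and a: "\<And>i. 0 < a i" and b: "\<And>i. 0 < b i" and d: "\<And>i. 0 \<le> d i" and s: "\<And>i. 0 \<le> s i"
    and r: "0 < r" "r < 1"
    and S: "rdiag (\<lambda>i. d i powr (1/2))
        ** \<Theta> (spec U (\<lambda>i. of_real (a i powr (- (r/2)))) ** spec V (\<lambda>i. of_real (b i powr r))
              ** spec U (\<lambda>i. of_real (a i powr (- (r/2)))))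
        ** rdiag (\<lambda>i. d i powr (1/2)) = spec W (\<lambda>i. of_real (s i))"
begin

definition Az where "Az z = spec U (\<lambda>i. of_real (a i) powr (- (z/2)))"
definition Bz where "Bz z = spec V (\<lambda>i. of_real (b i) powr z)"
definition Dz where "Dz z = cdiag (\<lambda>i. of_real (d i) powr (z / (2 * of_real r)))"
definition Sz where "Sz z = spec W (\<lambda>i. of_real (s i) powr ((1 - z) / of_real r))"

text \<open>At \<open>z = r\<close> the inner sandwich is the matrix of assumption \<open>S\<close>
  and \<open>Sz\<close> is its power \<open>(1 - r)/r\<close>, so the product has power
  \<open>1/r\<close>. On \<open>Re z = 0\<close> the outer \<open>Dz\<close> are contractions; on
  \<open>Re z = 1\<close> the factor \<open>Sz\<close> is a partial isometry.\<close>

definition h where "h z = trace (Sz z ** (Dz z ** \<Theta> (Az z ** Bz z ** Az z) ** Dz z))"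

lemma strip_bounded_h: "strip_bounded h"
proof -
  have A: "matrix_strip_bounded Az" unfolding Az_def
    by (intro matrix_strip_bounded_spec)
      (use strip_bounded_powr[OF less_imp_le[OF a], of _ "-1/2" 0] in simp)
  have B: "matrix_strip_bounded Bz" unfolding Bz_def
    by (intro matrix_strip_bounded_spec)
      (use strip_bounded_powr[OF less_imp_le[OF b], of _ 1 0] in simp)
  have D: "matrix_strip_bounded Dz" unfolding Dz_def
    by (intro matrix_strip_bounded_cdiag)
      (use strip_bounded_powr[OF d, of _ "1/(2*r)" 0] in simp)
  have S: "matrix_strip_bounded Sz" unfolding Sz_def
    by (intro matrix_strip_bounded_spec)
      (use strip_bounded_powr[OF s, of _ "-1/r" "1/r"] in \<open>simp add: diff_divide_distrib\<close>)
  have lin: "clinear_map \<Theta>" using pos by (simp add: posmap_def)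
  note mult = matrix_strip_bounded_mult
  show ?thesis unfolding h_def[abs_def]
    by (rule strip_bounded_trace
        [OF mult[OF S mult[OF mult[OF D matrix_strip_bounded_linear[OF lin mult[OF mult[OF A B] A]]] D]]])
qed

lemma h_at_r: "h (of_real r) = of_real (\<Sum>i\<in>UNIV. s i powr (1/r))"
proof -
  have "Dz (of_real r) = rdiag (\<lambda>i. d i powr (1/2))"
    using r by (simp add: Dz_def rdiag_eq_cdiag) (simp add: of_real_powr_real[OF d, of _ "1/2", simplified])
  moreover have "Az (of_real r) = spec U (\<lambda>i. of_real (a i powr (- (r/2))))"
    using of_real_powr_real[OF less_imp_le[OF a], of _ "-(r/2)"] by (simp add: Az_def)
  moreover have "Bz (of_real r) = spec V (\<lambda>i. of_real (b i powr r))"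
    using of_real_powr_real[OF less_imp_le[OF b], of _ r] by (simp add: Bz_def)
  moreover have "Sz (of_real r) = spec W (\<lambda>i. of_real (s i powr ((1 - r)/r)))"
    using of_real_powr_real[OF s, of _ "(1-r)/r"] by (simp add: Sz_def)
  ultimately have "h (of_real r) = (\<Sum>i\<in>UNIV. of_real (s i powr ((1 - r)/r)) * of_real (s i))"
    unfolding h_def by (simp add: S spec_mult[OF W] trace_spec[OF W])
  moreover have "s i powr ((1 - r)/r) * s i = s i powr (1/r)" for i
  proof (cases "s i = 0")
    case False
    then have "s i powr ((1 - r)/r) * s i = s i powr ((1 - r)/r) * s i powr 1"
      using s[of i] by simp
    also have "\<dots> = s i powr (1/r)"
      unfolding powr_add[symmetric] using r by (simp add: field_simps)
    finally show ?thesis .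
  qed simp
  ultimately show ?thesis by (simp flip: of_real_mult)
qed

text \<open>Here \<open>Az\<close> and \<open>Bz\<close> are unitary and \<open>Dz\<close> is a
  contraction, so \<open>posmap_unitary_contraction\<close> bounds each diagonal entry of the
  sandwich by 1, while the eigenvalues of \<open>Sz z\<close> have modulus
  \<open>s i powr (1/r)\<close>.\<close>

lemma h_bound_left:
  assumes z: "Re z = 0"
  shows "cmod (h z) \<le> (\<Sum>i\<in>UNIV. s i powr (1/r))"
proof -
  have "cmod (of_real (a i) powr (- (z/2))) = 1" "cmod (of_real (b i) powr z) = 1" for i
    using a[of i] b[of i] z by (simp_all add: norm_of_real_powr)
  then have uni: "unitary (Az z ** Bz z ** Az z)"
    unfolding Az_def Bz_def by (intro unitary_mult unitary_spec U V) auto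
  have dl: "cmod (of_real (d i) powr (z / (2 * of_real r))) \<le> 1" for i
    using d[of i] z by (simp add: norm_of_real_powr powr_def)
  define X where "X = Dz z ** \<Theta> (Az z ** Bz z ** Az z) ** Dz z"
  have le1: "cmod (cinner (column j W) (X *v column j W)) \<le> 1" for j
  proof -
    let ?w = "column j W"
    have nw: "norm ?w = 1" by (rule norm_column_unitary[OF W])
    have "norm (Dz z *v ?w) \<le> 1" "norm (cadj (Dz z) *v ?w) \<le> 1"
      unfolding Dz_def cadj_cdiag nw[symmetric] by (intro norm_cdiag_le; simp add: dl)+
    then have sq: "(norm (Dz z *v ?w))\<^sup>2 \<le> 1" "(norm (cadj (Dz z) *v ?w))\<^sup>2 \<le> 1"
      by (simp_all add: power_le_one)
    have "cinner ?w (X *v ?w) = cinner (cadj (Dz z) *v ?w) (\<Theta> (Az z ** Bz z ** Az z) *v (Dz z *v ?w))"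
      unfolding X_def by (simp add: cinner_matrix[of _ "Dz z"] flip: matrix_vector_mul_assoc)
    then have "2 * cmod (cinner ?w (X *v ?w)) \<le> (norm (cadj (Dz z) *v ?w))\<^sup>2 + (norm (Dz z *v ?w))\<^sup>2"
      using posmap_unitary_contraction[OF pos unital uni] by simp
    then show ?thesis using sq by linarith
  qed
  have cs: "cmod (of_real (s i) powr ((1 - z) / of_real r)) = s i powr (1/r)" for i
    using z r by (simp add: norm_of_real_powr[OF s] Re_divide_of_real)
  have "h z = (\<Sum>j\<in>UNIV. of_real (s j) powr ((1 - z) / of_real r) * cinner (column j W) (X *v column j W))"
    unfolding h_def Sz_def X_def[symmetric] by (rule trace_spec_mult[OF W])
  then have "cmod (h z) \<le> (\<Sum>j\<in>UNIV. cmod (of_real (s j) powr ((1 - z) / of_real r)) * cmod (cinner (column j W) (X *v column j W)))"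
    by (metis (no_types, lifting) norm_mult norm_sum sum.cong)
  also have "\<dots> \<le> (\<Sum>j\<in>UNIV. s j powr (1/r))"
    unfolding cs using le1 by (intro sum_mono mult_right_le_one_le) auto
  finally show ?thesis .
qed

text \<open>\<open>\<Theta>\<close> framed by the moduli of \<open>Dz z\<close> on the line
  \<open>Re z = 1\<close>.\<close>

definition Om where "Om Y = rdiag (\<lambda>i. d i powr (1/(2*r))) ** \<Theta> Y ** rdiag (\<lambda>i. d i powr (1/(2*r)))"

lemma posmap_Om: "posmap Om"
  using posmap_congruence[OF pos, of "rdiag (\<lambda>i. d i powr (1/(2*r)))" "mat 1"]
  by (simp add: Om_def[abs_def] rdiag_eq_cdiag cadj_cdiag)

text \<open>The product \<open>Az Bz Az\<close> is split as \<open>K\<close> times the adjoint of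
  \<open>L\<close>, and the phases of \<open>Dz\<close> go into unitary matrices
  \<open>N \<sigma>\<close>. The resulting bound is linear in \<open>spec V b\<close>, so bounds for
  different terms can be averaged.\<close>

lemma h_bound_right:
  assumes z: "Re z = 1"
  shows "2 * cmod (h z) \<le> rtrace (Om (Az z ** spec V (\<lambda>i. of_real (b i)) ** cadj (Az z)))
    + rtrace (Om (cadj (Az z) ** spec V (\<lambda>i. of_real (b i)) ** Az z))"
proof -
  \<comment> \<open>On \<open>Re z = 1\<close> the power \<open>z - 1/2\<close> has modulus
    \<open>b i powr (1/2)\<close>, the same as the factor left to \<open>L\<close>; both Gram
    matrices therefore contain the first power of \<open>b\<close>.\<close>
  define K where "K = Az z ** spec V (\<lambda>i. of_real (b i) powr (z - 1/2))"
  define L where "L = cadj (Az z) ** spec V (\<lambda>i. of_real (b i powr (1/2)))"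
  have b12: "complex_of_real (b i powr (1/2)) = of_real (b i) powr (1/2)" for i
    using of_real_powr_real[OF less_imp_le[OF b], of i "1/2"] by simp
  have "spec V (\<lambda>i. of_real (b i) powr (z - 1/2)) ** spec V (\<lambda>i. of_real (b i powr (1/2))) = Bz z"
    unfolding spec_mult[OF V] Bz_def b12 by (simp flip: powr_add)
  then have KL: "K ** cadj L = Az z ** Bz z ** Az z"
    unfolding K_def L_def cadj_mult cadj_spec
    by (simp add: matrix_mul_assoc) (simp flip: matrix_mul_assoc)
  have "of_real (b i) powr (z - 1/2) * cnj (of_real (b i) powr (z - 1/2)) = complex_of_real (b i)" for i
  proof -
    have "(b i powr Re (z - 1/2))\<^sup>2 = b i"
      using z b[of i] by (simp add: powr_half_sqrt)
    then show ?thesis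
      unfolding complex_norm_square[symmetric] norm_of_real_powr[OF less_imp_le[OF b]] by simp
  qed
  then have KK: "K ** cadj K = Az z ** spec V (\<lambda>i. of_real (b i)) ** cadj (Az z)"
    unfolding K_def cadj_mult cadj_spec
    by (simp add: spec_mult[OF V] matrix_mul_assoc)
       (simp add: spec_mult[OF V] flip: matrix_mul_assoc)
  have "complex_of_real (b i powr (1/2)) * of_real (b i powr (1/2)) = of_real (b i)" for i
    using b[of i] by (simp add: powr_half_sqrt flip: of_real_mult)
  then have LL: "L ** cadj L = cadj (Az z) ** spec V (\<lambda>i. of_real (b i)) ** Az z"
    unfolding L_def cadj_mult cadj_spec
    by (simp add: matrix_mul_assoc) (simp add: spec_mult[OF V] flip: matrix_mul_assoc)
  \<comment> \<open>The phases of \<open>Dz z\<close>. The value 1 at \<open>d i = 0\<close> keeps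
    \<open>cdiag e\<close> unitary and is harmless, because the modulus there is 0.\<close>
  define e where "e i = (if d i = 0 then 1 else complex_of_real (d i) powr (z / (2 * of_real r) - of_real (1/(2*r))))" for i
  have ne: "cmod (e i) = 1" for i
    using d[of i] z r by (simp add: e_def norm_of_real_powr Re_divide_of_real)
  have uE: "unitary (cdiag e)"
    using unitary_spec[OF unitary_mat1 ne] by (simp add: spec_mat1)
  have ed: "e i * of_real (d i powr (1/(2*r))) = of_real (d i) powr (z / (2 * of_real r))" for i
  proof (cases "d i = 0")
    case False
    then show ?thesis
      unfolding of_real_powr_real[OF d, symmetric] by (simp add: e_def flip: powr_add)
  qed (simp add: e_def)
  let ?D = "rdiag (\<lambda>i. d i powr (1/(2*r)))"
  have Dz: "Dz z = cdiag e ** ?D" "Dz z = ?D ** cdiag e"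
    unfolding rdiag_eq_cdiag cdiag_mult Dz_def using ed by (simp_all add: mult.commute)
  \<comment> \<open>\<open>Sz z\<close> vanishes on the kernel of \<open>S\<close>, so it is the mean of two unitaries rather than unitary.\<close>
  define c where "c \<sigma> i = (if s i = 0 then \<sigma> else of_real (s i) powr ((1 - z) / of_real r))" for \<sigma> i
  define N where "N \<sigma> = cdiag e ** spec W (c \<sigma>) ** cdiag e" for \<sigma>
  have uN: "unitary (N \<sigma>)" if "cmod \<sigma> = 1" for \<sigma>
  proof -
    have "cmod (c \<sigma> i) = 1" for i
      using that s[of i] z r by (simp add: c_def norm_of_real_powr Re_divide_of_real)
    then show ?thesis unfolding N_def by (intro unitary_mult uE unitary_spec W)
  qed
  define Y where "Y = K ** cadj L"
  \<comment> \<open>Cyclicity moves the left \<open>cdiag e\<close> to the right end, where phases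
    and moduli recombine to \<open>Dz z\<close> on both sides of \<open>\<Theta> Y\<close>.\<close>
  have trN: "trace (N \<sigma> ** Om Y) = (\<Sum>j\<in>UNIV. c \<sigma> j * cinner (column j W) ((Dz z ** \<Theta> Y ** Dz z) *v column j W))" for \<sigma>
  proof -
    have "trace (N \<sigma> ** Om Y) = trace (cdiag e ** (spec W (c \<sigma>) ** cdiag e ** Om Y))"
      by (simp add: N_def matrix_mul_assoc)
    also have "\<dots> = trace (spec W (c \<sigma>) ** cdiag e ** Om Y ** cdiag e)" by (rule trace_mul_sym)
    also have "spec W (c \<sigma>) ** cdiag e ** Om Y ** cdiag e = spec W (c \<sigma>) ** ((cdiag e ** ?D) ** \<Theta> Y ** (?D ** cdiag e))"
      by (simp add: Om_def matrix_mul_assoc)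
    also have "\<dots> = spec W (c \<sigma>) ** (Dz z ** \<Theta> Y ** Dz z)" by (simp flip: Dz)
    finally show ?thesis by (simp add: trace_spec_mult[OF W])
  qed
  have "2 * h z = trace (N 1 ** Om Y) + trace (N (-1) ** Om Y)"
  proof -
    have "c 1 j + c (-1) j = 2 * of_real (s j) powr ((1 - z) / of_real r)" for j
      by (simp add: c_def)
    then have "c 1 j * x + c (-1) j * x = 2 * (of_real (s j) powr ((1 - z) / of_real r) * x)" for j x
      by (metis distrib_right mult.assoc)
    then show ?thesis
      unfolding trN unfolding h_def Sz_def trace_spec_mult[OF W] Y_def KL sum.distrib[symmetric] sum_distrib_left
      by simp
  qed
  then have "2 * cmod (h z) \<le> cmod (trace (N 1 ** Om Y)) + cmod (trace (N (-1) ** Om Y))"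
    by (metis norm_mult norm_numeral norm_triangle_ineq)
  moreover have "2 * cmod (trace (N \<sigma> ** Om Y)) \<le> rtrace (Om (K ** cadj K)) + rtrace (Om (L ** cadj L))"
    if "cmod \<sigma> = 1" for \<sigma>
    unfolding Y_def by (rule posmap_trace_unitary[OF posmap_Om uN[OF that]])
  from this[of 1] this[of "-1"] have
    "2 * cmod (trace (N 1 ** Om Y)) \<le> rtrace (Om (K ** cadj K)) + rtrace (Om (L ** cadj L))"
    "2 * cmod (trace (N (-1) ** Om Y)) \<le> rtrace (Om (K ** cadj K)) + rtrace (Om (L ** cadj L))" by simp_all
  ultimately show ?thesis unfolding KK LL by linarith
qed

end


section \<open>The interpolated trace inequality for unital positive maps\<close>

lemma rtrace_add: "rtrace (A + B) = rtrace A + rtrace B"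
  by (simp add: rtrace_def trace_add)

lemma rtrace_cscale: "rtrace (cscale (of_real c) A) = c * rtrace A"
  by (simp add: rtrace_def trace_def cscale_def sum_distrib_left)

text \<open>Three lines for the convex combination \<open>H\<close> of two interpolating functions.
  Its value at \<open>r\<close> is the left-hand side \<open>\<Sigma>\<close>, which also bounds it
  on \<open>Re z = 0\<close>, and the right-hand side \<open>c\<close> bounds it on
  \<open>Re z = 1\<close>. So \<open>\<Sigma>\<close> is at most \<open>\<Sigma>^(1-r) c^r\<close>,
  hence at most \<open>c\<close>.\<close>

theorem trace_power_interpolation:
  fixes \<Theta> :: "complex^'n^'n \<Rightarrow> complex^'l^'l" and A1 A2 :: "complex^'n^'n"
  assumes pos: "posmap \<Theta>" and unital: "\<Theta> (mat 1) = mat 1"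
    and A1: "posdef A1" and A2: "posdef A2" and t: "0 \<le> t" "t \<le> 1"
    and d: "\<And>i. 0 \<le> d i" and r: "0 < r" "r < 1"
    and A_def: "A = cscale (of_real t) A1 + cscale (of_real (1 - t)) A2"
    and S_def: "\<And>B. S B = rdiag (\<lambda>i. d i powr (1/2)) ** \<Theta> (mpow A (- (r/2)) ** mpow B r ** mpow A (- (r/2)))
                      ** rdiag (\<lambda>i. d i powr (1/2))"
  shows "t * rtrace (matfun (\<lambda>x. x powr (1/r)) (S A1)) + (1 - t) * rtrace (matfun (\<lambda>x. x powr (1/r)) (S A2))
    \<le> (\<Sum>i\<in>UNIV. d i powr (1/r))"
proof -
  have A: "posdef A" unfolding A_def by (rule posdef_convex_comb[OF A1 A2 t])
  obtain U a where U: "unitary U" and Aeq: "A = spec U (\<lambda>i. of_real (a i))" and a: "\<forall>i. 0 < a i"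
    by (rule posdef_diagonalisation[OF A])
  have psdS: "psd (S B)" if "posdef B" for B
  proof -
    have "psd (mpow A (- (r/2)) ** mpow B r ** mpow A (- (r/2)))"
      using psd_congruence[OF posdef_imp_psd[OF posdef_mpow[OF that, of r]], of "mpow A (- (r/2))"]
      by (simp add: hermitian_mpow[OF A])
    then have "psd (\<Theta> (mpow A (- (r/2)) ** mpow B r ** mpow A (- (r/2))))"
      using pos by (simp add: posmap_def)
    from psd_congruence[OF this, of "rdiag (\<lambda>i. d i powr (1/2))"] show ?thesis
      by (simp add: S_def rdiag_eq_cdiag cadj_cdiag)
  qed
  have ex: "\<exists>V b W s. unitary W \<and> S B = spec W (\<lambda>i. of_real (s i)) \<and> B = spec V (\<lambda>i. of_real (b i))
      \<and> interpolation_term \<Theta> U V a b d s W r" if B: "posdef B" for B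
  proof -
    obtain V b where V: "unitary V" and Beq: "B = spec V (\<lambda>i. of_real (b i))" and b: "\<forall>i. 0 < b i"
      by (rule posdef_diagonalisation[OF B])
    obtain W s where W: "unitary W" and Seq: "S B = spec W (\<lambda>i. of_real (s i))" and s: "\<forall>i. 0 \<le> s i"
      by (rule psd_diagonalisation[OF psdS[OF B]])
    have "interpolation_term \<Theta> U V a b d s W r"
    proof
      show "rdiag (\<lambda>i. d i powr (1/2))
        ** \<Theta> (spec U (\<lambda>i. of_real (a i powr (- (r/2)))) ** spec V (\<lambda>i. of_real (b i powr r))
              ** spec U (\<lambda>i. of_real (a i powr (- (r/2)))))
        ** rdiag (\<lambda>i. d i powr (1/2)) = spec W (\<lambda>i. of_real (s i))"
        unfolding Seq[symmetric] S_def unfolding Beq Aeq mpow_spec[OF U] mpow_spec[OF V] by (rule refl)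
    qed (use pos unital U V W a b d s r in auto)
    then show ?thesis using Beq Seq W by blast
  qed
  from ex[OF A1] obtain V1 b1 W1 s1 where W1: "unitary W1" and S1: "S A1 = spec W1 (\<lambda>i. of_real (s1 i))"
    and A1eq: "A1 = spec V1 (\<lambda>i. of_real (b1 i))" and T1: "interpolation_term \<Theta> U V1 a b1 d s1 W1 r" by blast
  from ex[OF A2] obtain V2 b2 W2 s2 where W2: "unitary W2" and S2: "S A2 = spec W2 (\<lambda>i. of_real (s2 i))"
    and A2eq: "A2 = spec V2 (\<lambda>i. of_real (b2 i))" and T2: "interpolation_term \<Theta> U V2 a b2 d s2 W2 r" by blast
  interpret T1: interpolation_term \<Theta> U V1 a b1 d s1 W1 r by (rule T1)
  interpret T2: interpolation_term \<Theta> U V2 a b2 d s2 W2 r by (rule T2)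
  define \<Sigma> where "\<Sigma> = t * (\<Sum>i\<in>UNIV. s1 i powr (1/r)) + (1 - t) * (\<Sum>i\<in>UNIV. s2 i powr (1/r))"
  define c where "c = (\<Sum>i\<in>UNIV. d i powr (1/r))"
  define H where "H z = of_real t * T1.h z + of_real (1 - t) * T2.h z" for z
  have H: "strip_bounded H" unfolding H_def[abs_def]
    by (rule strip_bounded_add[OF strip_bounded_mult[OF strip_bounded_const T1.strip_bounded_h]
          strip_bounded_mult[OF strip_bounded_const T2.strip_bounded_h]])
  have Hr: "H (of_real r) = of_real \<Sigma>"
    unfolding H_def \<Sigma>_def T1.h_at_r T2.h_at_r by simp
  have Hle: "cmod (H z) \<le> t * cmod (T1.h z) + (1 - t) * cmod (T2.h z)" for z
    unfolding H_def using t by (intro order_trans[OF norm_triangle_ineq]) (simp add: norm_mult flip: of_real_diff)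
  have H0: "cmod (H z) \<le> \<Sigma>" if "Re z = 0" for z
    unfolding \<Sigma>_def using t T1.h_bound_left[OF that] T2.h_bound_left[OF that]
    by (intro order_trans[OF Hle] add_mono mult_left_mono) auto
  have H1: "cmod (H z) \<le> c" if z: "Re z = 1" for z
  proof -
    have lin: "clinear_map T1.Om" using T1.posmap_Om by (simp add: posmap_def)
    \<comment> \<open>Both terms are built from the same \<open>A\<close> and \<open>d\<close>, so
      they share \<open>Az\<close> and \<open>Om\<close>, and the averaged bounds see
      \<open>A1\<close> and \<open>A2\<close> only through \<open>A\<close>.\<close>
    have comb: "t * rtrace (T1.Om (K ** A1 ** L)) + (1 - t) * rtrace (T1.Om (K ** A2 ** L)) = rtrace (T1.Om (K ** A ** L))" for K L
      by (simp add: A_def matrix_distribs cscale_mult_left cscale_mult_right clinear_map_add[OF lin]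
          clinear_map_cscale[OF lin] rtrace_add rtrace_cscale del: of_real_diff)
    have "(a i powr Re (- (z/2)))\<^sup>2 * a i = 1" for i
      using a[rule_format, of i] z by (simp add: powr_minus powr_half_sqrt field_simps)
    then have one: "of_real (a i) powr (- (z/2)) * of_real (a i) * cnj (of_real (a i) powr (- (z/2))) = (1::complex)" for i
    proof -
      have "of_real (a i) powr (- (z/2)) * of_real (a i) * cnj (of_real (a i) powr (- (z/2)))
          = complex_of_real ((cmod (of_real (a i) powr (- (z/2))))\<^sup>2) * of_real (a i)"
        unfolding complex_norm_square by (simp add: mult_ac)
      also have "\<dots> = of_real ((a i powr Re (- (z/2)))\<^sup>2 * a i)"
        by (subst norm_of_real_powr) (use a in \<open>auto simp: less_imp_le\<close>)
      finally show ?thesis unfolding \<open>(a i powr Re (- (z/2)))\<^sup>2 * a i = 1\<close> by simp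
    qed
    have "T1.Az z ** A ** cadj (T1.Az z) = mat 1" "cadj (T1.Az z) ** A ** T1.Az z = mat 1"
      unfolding T1.Az_def Aeq cadj_spec spec_mult[OF U] using one
      by (simp_all add: spec_one[OF U] mult_ac)
    moreover have "rtrace (T1.Om (mat 1)) = c"
    proof -
      have "d i powr (1/(2*r)) * d i powr (1/(2*r)) = d i powr (1/r)" for i
        by (simp flip: powr_add)
      then show ?thesis
        by (simp add: T1.Om_def unital rdiag_eq_cdiag cdiag_mult rtrace_def trace_cdiag c_def flip: of_real_mult)
    qed
    ultimately have "t * (2 * cmod (T1.h z)) + (1 - t) * (2 * cmod (T2.h z)) \<le> 2 * c"
      using mult_left_mono[OF T1.h_bound_right[OF z] t(1)]
        mult_left_mono[OF T2.h_bound_right[OF z], of "1 - t"] t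
        comb[of "T1.Az z" "cadj (T1.Az z)"] comb[of "cadj (T1.Az z)" "T1.Az z"]
      unfolding A1eq[symmetric] A2eq[symmetric] distrib_left by simp
    then show ?thesis using Hle[of z] by simp
  qed
  have c0: "0 \<le> c" by (simp add: c_def sum_nonneg)
  have "\<Sigma> \<le> c"
  proof (cases "\<Sigma> > 0")
    case True
    show ?thesis
    \<comment> \<open>\<open>three_lines\<close> wants positive bounds, while \<open>c\<close> is
      only known to be nonnegative.\<close>
    proof (rule field_le_epsilon)
      fix \<delta> :: real assume "\<delta> > 0"
      then have c': "0 < c + \<delta>" using c0 by simp
      have "\<Sigma> \<le> \<Sigma> powr (1 - r) * (c + \<delta>) powr r"
        using three_lines[OF H True c' H0, of r] H1 \<open>\<delta> > 0\<close> r True unfolding Hr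
        by (metis (no_types, lifting) abs_of_pos add.commute add_increasing less_imp_le norm_of_real)
      then have "\<Sigma> powr (1 - r) * \<Sigma> powr r \<le> \<Sigma> powr (1 - r) * (c + \<delta>) powr r"
        using True by (simp flip: powr_add)
      then have "\<Sigma> powr r \<le> (c + \<delta>) powr r" using True by simp
      then show "\<Sigma> \<le> c + \<delta>" using c' True r by (metis linorder_not_le powr_less_mono2 less_imp_le)
    qed
  qed (use c0 in simp)
  then show ?thesis
    unfolding S1 S2 rtrace_matfun_spec[OF W1] rtrace_matfun_spec[OF W2] \<Sigma>_def c_def .
qed

section \<open>Operator convexity of powers\<close>

text \<open>Interpolation with \<open>d = 1\<close> for the scalar-valued map given by the vector
  state of \<open>v\<close>, the normalised \<open>B^(r/2) x\<close>. With \<open>c\<close> the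
  ratio of the forms of \<open>C^r\<close> and \<open>B^r\<close> at \<open>x\<close>, it bounds the
  average of \<open>c^(1/r)\<close> by 1, and Young's inequality passes to \<open>c\<close>
  itself.\<close>

lemma mpow_concave:
  fixes B1 B2 :: "complex^'n^'n"
  assumes B1: "posdef B1" and B2: "posdef B2" and t: "0 \<le> t" "t \<le> 1" and r: "0 \<le> r" "r \<le> 1"
    and B_def: "B = cscale (of_real t) B1 + cscale (of_real (1 - t)) B2"
  shows "t * qform (mpow B1 r) x + (1 - t) * qform (mpow B2 r) x \<le> qform (mpow B r) x"
proof -
  have B: "posdef B" unfolding B_def by (rule posdef_convex_comb[OF B1 B2 t])
  consider "r = 0" | "r = 1" | "x = 0" | "0 < r" "r < 1" "x \<noteq> 0" using r by force
  then show ?thesis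
  proof cases
    case 1
    then show ?thesis by (simp add: mpow_zero B B1 B2 algebra_simps)
  next
    case 2
    then show ?thesis
      by (simp add: mpow_one B B1 B2) (simp add: B_def qform_add qform_cscale del: of_real_diff)
  next
    case 3
    then show ?thesis by simp
  next
    case 4
    let ?E = "mpow B (- (r/2))"
    define y where "y = mpow B (r/2) *v x"
    have Ey: "?E *v y = x"
      unfolding y_def by (simp add: matrix_vector_mul_assoc mpow_cancel[OF B])
    then have y0: "y \<noteq> 0" using 4 by auto
    define n where "n = norm y"
    have n0: "n > 0" using y0 by (simp add: n_def)
    have qB: "qform (mpow B r) x = n\<^sup>2"
    proof -
      have "mpow B r = cadj (mpow B (r/2)) ** mat 1 ** mpow B (r/2)"
        by (simp add: hermitian_mpow[OF B] mpow_add[OF B])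
      then show ?thesis unfolding n_def y_def by (simp only: qform_congruence qform_mat1)
    qed
    define v where "v = of_real (1/n) *s y"
    have v1: "cinner v v = 1"
      using n0 by (simp add: cinner_self v_def norm_smult norm_divide n_def[symmetric])
    \<comment> \<open>The scalar is stored as a multiple of the identity; traces then carry a factor
      \<open>CARD('n)\<close>, which cancels below.\<close>
    define \<Theta> :: "complex^'n^'n \<Rightarrow> complex^'n^'n" where "\<Theta> Y = cscale (cinner v (Y *v v)) (mat 1)" for Y
    have "posmap \<Theta>"
      unfolding posmap_def clinear_map_def
    proof (intro conjI allI impI)
      fix A C show "\<Theta> (A + C) = \<Theta> A + \<Theta> C"
        by (simp add: \<Theta>_def matrix_vector_mult_add_rdistrib cinner_simps) (simp add: cscale_def vec_eq_iff algebra_simps)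
    next
      fix c A show "\<Theta> (cscale c A) = cscale c (\<Theta> A)"
        by (simp add: \<Theta>_def cscale_mult_vec cinner_simps cscale_cscale)
    next
      fix P :: "complex^'n^'n" assume "psd P"
      then show "psd (\<Theta> P)"
        unfolding \<Theta>_def psd_def by (simp add: hermitian_cinner_real hermitian_cscale qform_cscale)
    qed
    moreover have "\<Theta> (mat 1) = mat 1" by (simp add: \<Theta>_def v1)
    ultimately have interp: "t * rtrace (matfun (\<lambda>x. x powr (1/r)) (\<Theta> (?E ** mpow B1 r ** ?E)))
        + (1 - t) * rtrace (matfun (\<lambda>x. x powr (1/r)) (\<Theta> (?E ** mpow B2 r ** ?E))) \<le> real CARD('n)"
      using trace_power_interpolation[of \<Theta> B1 B2 t "\<lambda>_. 1" r B
          "\<lambda>C. rdiag (\<lambda>_. 1) ** \<Theta> (?E ** mpow C r ** ?E) ** rdiag (\<lambda>_. 1)"]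
        B1 B2 t 4 B_def by (simp add: rdiag_eq_cdiag)
    define c where "c C = qform (mpow C r) x / n\<^sup>2" for C
    have cval: "\<Theta> (?E ** mpow C r ** ?E) = spec (mat 1) (\<lambda>_. of_real (c C))" if C: "posdef C" for C
    proof -
      have herm: "hermitian (?E ** mpow C r ** ?E)"
        using hermitian_congruence[OF posdef_hermitian[OF posdef_mpow[OF C, of r]], of ?E]
        by (simp add: hermitian_mpow[OF B])
      have "qform (?E ** mpow C r ** ?E) v = qform (mpow C r) (?E *v v)"
        using qform_congruence[of ?E "mpow C r" v] by (simp add: hermitian_mpow[OF B])
      also have "\<dots> = c C"
        using n0 by (simp add: v_def matrix_vector_smult Ey qform_smult c_def norm_divide power_divide)
      finally have "cinner v ((?E ** mpow C r ** ?E) *v v) = of_real (c C)"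
        by (simp add: hermitian_cinner_real[OF herm])
      then show ?thesis
        unfolding spec_mat1 by (simp add: \<Theta>_def cdiag_def cscale_def mat_def vec_eq_iff)
    qed
    have c0: "0 \<le> c C" if "posdef C" for C
      using posdef_imp_psd[OF posdef_mpow[OF that, of r]] by (simp add: c_def psd_def)
    have "real CARD('n) * (t * c B1 powr (1/r) + (1 - t) * c B2 powr (1/r)) \<le> real CARD('n) * 1"
      using interp unfolding cval[OF B1] cval[OF B2] rtrace_matfun_spec[OF unitary_mat1]
      by (simp add: algebra_simps)
    then have le1: "t * c B1 powr (1/r) + (1 - t) * c B2 powr (1/r) \<le> 1"
      by (simp del: mult_1_right)
    have young: "c C \<le> r * c C powr (1/r) + (1 - r)" if "posdef C" for C
      using Youngs_inequality[of "1/r" "1/(1-r)" "c C" 1] 4 c0[OF that] by (simp add: mult.commute)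
    have "t * c B1 + (1 - t) * c B2
        \<le> t * (r * c B1 powr (1/r) + (1 - r)) + (1 - t) * (r * c B2 powr (1/r) + (1 - r))"
      using young[OF B1] young[OF B2] t by (intro add_mono mult_left_mono) auto
    also have "\<dots> = r * (t * c B1 powr (1/r) + (1 - t) * c B2 powr (1/r)) + (1 - r)"
      by (simp add: algebra_simps)
    also have "\<dots> \<le> r * 1 + (1 - r)" using le1 r by (intro add_mono mult_left_mono) auto
    finally have "t * c B1 + (1 - t) * c B2 \<le> 1" by simp
    then have "n\<^sup>2 * (t * c B1 + (1 - t) * c B2) \<le> n\<^sup>2"
      using n0 by (simp add: mult_left_le)
    moreover have "n\<^sup>2 * c C = qform (mpow C r) x" for C using n0 by (simp add: c_def)
    then have "n\<^sup>2 * (t * c B1 + (1 - t) * c B2) = t * qform (mpow B1 r) x + (1 - t) * qform (mpow B2 r) x"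
      by (simp only: distrib_left mult.left_commute[of "n\<^sup>2"])
    ultimately show ?thesis by (simp add: qB)
  qed
qed

text \<open>A supremum of functions affine in \<open>C\<close> and \<open>w\<close> is jointly
  convex: the \<open>y\<close> that is optimal for the left-hand side is inserted into the
  variational bound at both ends. Assuming an inequality between the forms lets \<open>C\<close>
  depend concavely on a parameter.\<close>

lemma inv_jointly_convex:
  assumes C: "posdef C" "posdef C1" "posdef C2" and t: "0 \<le> t" "t \<le> 1"
    and le: "\<And>y. t * qform C1 y + (1 - t) * qform C2 y \<le> qform C y"
    and w: "w = of_real t *s w1 + of_real (1 - t) *s w2"
  shows "qform (matrix_inv C) w \<le> t * qform (matrix_inv C1) w1 + (1 - t) * qform (matrix_inv C2) w2"
proof -
  define y where "y = matrix_inv C *v w"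
  have "qform (matrix_inv C) w = 2 * Re (cinner y w) - qform C y"
    unfolding y_def by (rule qform_inv_eq[OF C(1)])
  also have "\<dots> \<le> t * (2 * Re (cinner y w1) - qform C1 y) + (1 - t) * (2 * Re (cinner y w2) - qform C2 y)"
    using le[of y] by (simp add: w cinner_simps algebra_simps)
  also have "\<dots> \<le> t * qform (matrix_inv C1) w1 + (1 - t) * qform (matrix_inv C2) w2"
    using t by (intro add_mono mult_left_mono qform_inv_ge C) auto
  finally show ?thesis .
qed

lemma smult_convex_comb_same: "of_real t *s x + of_real (1 - t) *s x = (x :: complex^'n)"
  by (simp flip: vector_sadd_rdistrib)

text \<open>\<open>B^q\<close> is the inverse of \<open>B^(-q)\<close>, which is operator concave as
  \<open>-q\<close> lies in \<open>[0, 1]\<close>; joint convexity of the inverse is used with a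
  constant vector.\<close>

lemma mpow_convex_neg:
  assumes B1: "posdef B1" and B2: "posdef B2" and t: "0 \<le> t" "t \<le> 1" and q: "-1 \<le> q" "q \<le> 0"
    and B_def: "B = cscale (of_real t) B1 + cscale (of_real (1 - t)) B2"
  shows "qform (mpow B q) x \<le> t * qform (mpow B1 q) x + (1 - t) * qform (mpow B2 q) x"
proof -
  have B: "posdef B" unfolding B_def by (rule posdef_convex_comb[OF B1 B2 t])
  show ?thesis
    using inv_jointly_convex[OF posdef_mpow[OF B, of "-q"] posdef_mpow[OF B1, of "-q"] posdef_mpow[OF B2, of "-q"] t
        mpow_concave[OF B1 B2 t _ _ B_def, of "-q"] smult_convex_comb_same[of t x, symmetric]] q
    by (simp add: matrix_inv_mpow B B1 B2)
qed

text \<open>The form of \<open>B^q\<close> at \<open>x\<close> is that of the inverse of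
  \<open>B^(2-q)\<close> at \<open>B x\<close>. The vector is affine in \<open>B\<close>, and the
  matrix is operator concave because \<open>2 - q\<close> lies in \<open>[0, 1]\<close>.\<close>

lemma mpow_convex_12:
  assumes B1: "posdef B1" and B2: "posdef B2" and t: "0 \<le> t" "t \<le> 1" and q: "1 \<le> q" "q \<le> 2"
    and B_def: "B = cscale (of_real t) B1 + cscale (of_real (1 - t)) B2"
  shows "qform (mpow B q) x \<le> t * qform (mpow B1 q) x + (1 - t) * qform (mpow B2 q) x"
proof -
  have B: "posdef B" unfolding B_def by (rule posdef_convex_comb[OF B1 B2 t])
  have eq: "qform (mpow C q) x = qform (matrix_inv (mpow C (2 - q))) (C *v x)" if C: "posdef C" for C
  proof -
    have "mpow C q = cadj C ** mpow C (q - 2) ** C"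
    proof -
      have "cadj C = C" using posdef_hermitian[OF C] by (simp add: hermitian_def)
      moreover have "C ** mpow C (q - 2) ** C = mpow C 1 ** mpow C (q - 2) ** mpow C 1"
        by (simp add: mpow_one[OF C])
      ultimately show ?thesis by (simp add: mpow_add[OF C])
    qed
    then show ?thesis by (simp add: qform_congruence matrix_inv_mpow[OF C])
  qed
  have w: "B *v x = of_real t *s (B1 *v x) + of_real (1 - t) *s (B2 *v x)"
    unfolding B_def by (simp add: matrix_vector_mult_add_rdistrib cscale_mult_vec del: of_real_diff)
  show ?thesis
    unfolding eq[OF B] eq[OF B1] eq[OF B2]
    using inv_jointly_convex[OF posdef_mpow[OF B, of "2-q"] posdef_mpow[OF B1, of "2-q"] posdef_mpow[OF B2, of "2-q"] t
        mpow_concave[OF B1 B2 t _ _ B_def, of "2-q"] w] q by simp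
qed

section \<open>Transport of convexity and concavity through positive maps\<close>

lemma posmap_mono:
  assumes \<Phi>: "posmap \<Phi>" and AB: "hermitian A" "hermitian B" and le: "\<And>x. qform A x \<le> qform B x"
  shows "qform (\<Phi> A) x \<le> qform (\<Phi> B) x"
proof -
  have "psd (B - A)" using AB le by (simp add: psd_def hermitian_diff qform_diff)
  then have "psd (\<Phi> (B - A))" using \<Phi> by (simp add: posmap_def)
  then show ?thesis
    using \<Phi> by (simp add: posmap_def clinear_map_diff psd_def qform_diff)
qed

lemma qform_clinear_comb:
  assumes "clinear_map \<Phi>"
  shows "qform (\<Phi> (cscale (of_real s) A + cscale (of_real t) B)) x = s * qform (\<Phi> A) x + t * qform (\<Phi> B) x"
  by (simp add: clinear_map_add[OF assms] clinear_map_cscale[OF assms] qform_add qform_cscale)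

lemma posmap_mpow_convex:
  assumes \<Psi>: "posmap \<Psi>" and B1: "posdef B1" and B2: "posdef B2" and t: "0 \<le> t" "t \<le> 1"
    and q: "q \<in> {-1..0} \<union> {1..2}"
    and B_def: "B = cscale (of_real t) B1 + cscale (of_real (1 - t)) B2"
  shows "qform (\<Psi> (mpow B q)) x \<le> t * qform (\<Psi> (mpow B1 q)) x + (1 - t) * qform (\<Psi> (mpow B2 q)) x"
proof -
  have B: "posdef B" unfolding B_def by (rule posdef_convex_comb[OF B1 B2 t])
  let ?R = "cscale (of_real t) (mpow B1 q) + cscale (of_real (1 - t)) (mpow B2 q)"
  have "qform (mpow B q) x \<le> qform ?R x" for x
    unfolding qform_add qform_cscale
    using q mpow_convex_neg[OF B1 B2 t _ _ B_def, of q x] mpow_convex_12[OF B1 B2 t _ _ B_def, of q x] by auto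
  then have "qform (\<Psi> (mpow B q)) x \<le> qform (\<Psi> ?R) x"
    by (intro posmap_mono[OF \<Psi>] hermitian_add hermitian_cscale posdef_hermitian posdef_mpow B B1 B2)
  then show ?thesis using \<Psi> by (simp only: posmap_def qform_clinear_comb)
qed

lemma posmap_mpow_concave:
  assumes \<Psi>: "posmap \<Psi>" and B1: "posdef B1" and B2: "posdef B2" and t: "0 \<le> t" "t \<le> 1"
    and q: "0 \<le> q" "q \<le> 1"
    and B_def: "B = cscale (of_real t) B1 + cscale (of_real (1 - t)) B2"
  shows "t * qform (\<Psi> (mpow B1 q)) x + (1 - t) * qform (\<Psi> (mpow B2 q)) x \<le> qform (\<Psi> (mpow B q)) x"
proof -
  have B: "posdef B" unfolding B_def by (rule posdef_convex_comb[OF B1 B2 t])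
  let ?R = "cscale (of_real t) (mpow B1 q) + cscale (of_real (1 - t)) (mpow B2 q)"
  have "qform ?R x \<le> qform (mpow B q) x" for x
    unfolding qform_add qform_cscale by (rule mpow_concave[OF B1 B2 t q B_def])
  then have "qform (\<Psi> ?R) x \<le> qform (\<Psi> (mpow B q)) x"
    by (intro posmap_mono[OF \<Psi>] hermitian_add hermitian_cscale posdef_hermitian posdef_mpow B B1 B2)
  then show ?thesis using \<Psi> by (simp only: posmap_def qform_clinear_comb)
qed

section \<open>Trace inequalities\<close>

text \<open>\<open>y\<close> is the orthogonal projection of \<open>x\<close> onto the span of the
  family, and \<open>x - y\<close> has nonnegative squared norm.\<close>

lemma bessel:
  assumes fin: "finite I" and on: "\<And>i j. i \<in> I \<Longrightarrow> j \<in> I \<Longrightarrow> cinner (v i) (v j) = (if i = j then 1 else 0)"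
  shows "(\<Sum>i\<in>I. (cmod (cinner (v i) x))\<^sup>2) \<le> (norm x)\<^sup>2"
proof -
  define y where "y = (\<Sum>i\<in>I. cinner (v i) x *s v i)"
  have vy: "cinner (v i) y = cinner (v i) x" if "i \<in> I" for i
  proof -
    have "cinner (v i) y = (\<Sum>j\<in>I. if j = i then cinner (v i) x else 0)"
      unfolding y_def cinner_sum_right using on that by (intro sum.cong) (auto simp: cinner_scale_right)
    then show ?thesis using fin that by simp
  qed
  have yv: "cinner z y = (\<Sum>i\<in>I. cinner (v i) x * cinner z (v i))" for z
    unfolding y_def cinner_sum_right by (simp add: cinner_scale_right)
  have zv: "cinner z (v i) = cnj (cinner (v i) z)" for z i by (simp add: cnj_cinner)
  have yy: "cinner y y = (\<Sum>i\<in>I. of_real ((cmod (cinner (v i) x))\<^sup>2))"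
    unfolding yv[of y] by (intro sum.cong refl) (simp only: zv vy complex_norm_square)
  have xy: "cinner x y = (\<Sum>i\<in>I. of_real ((cmod (cinner (v i) x))\<^sup>2))"
    unfolding yv[of x] by (intro sum.cong refl) (simp only: zv complex_norm_square)
  have yx: "cinner y x = (\<Sum>i\<in>I. of_real ((cmod (cinner (v i) x))\<^sup>2))"
    using xy cnj_cinner[of x y] by (simp del: of_real_power)
  have "0 \<le> Re (cinner (x - y) (x - y))" by (simp add: cinner_self flip: of_real_power)
  also have "\<dots> = Re (cinner x x) - (\<Sum>i\<in>I. (cmod (cinner (v i) x))\<^sup>2)"
    unfolding cinner_diff_left cinner_diff_right yy xy yx by (simp del: of_real_power)
  finally show ?thesis by (simp add: cinner_self flip: of_real_power)
qed

lemma qform_eq_norm: "qform (cadj T ** T) x = (norm (T *v x))\<^sup>2"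
  using qform_congruence[of T "mat 1" x] by simp

lemma rtrace_congruence_columns:
  assumes "unitary W"
  shows "rtrace (cadj T ** M ** T) = (\<Sum>b\<in>UNIV. qform M (T *v column b W))"
  by (simp add: rtrace_def trace_eq_columns[OF assms] flip: qform_congruence) (simp add: qform_def)

text \<open>Positive arguments are covered by \<open>powr_convex\<close>; the end point 0 reduces to
  \<open>u powr s \<le> u\<close> for a weight \<open>u\<close> in \<open>[0, 1]\<close>.\<close>

lemma powr_convex_nonneg:
  assumes s: "1 \<le> s"
  shows "convex_on {0..} (\<lambda>x::real. x powr s)"
proof (rule convex_onI)
  fix t x y :: real
  assume t: "0 < t" "t < 1" and xy: "x \<in> {0..}" "y \<in> {0..}"
  have scale: "(u * z) powr s \<le> u * z powr s" if "0 \<le> u" "u \<le> 1" "0 \<le> z" for u z :: real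
  proof -
    have "u powr s \<le> u powr 1" using that s by (intro powr_mono') auto
    then have "u powr s * z powr s \<le> u * z powr s" using that by (intro mult_right_mono) auto
    then show ?thesis using that by (simp add: powr_mult)
  qed
  consider "x = 0" | "y = 0" | "0 < x" "0 < y" using xy by force
  then show "((1 - t) *\<^sub>R x + t *\<^sub>R y) powr s \<le> (1 - t) * x powr s + t * y powr s"
  proof cases
    case 3
    then show ?thesis using convex_onD[OF powr_convex[OF s], of t x y] t by simp
  qed (use scale[of t y] scale[of "1 - t" x] t xy s in auto)
qed simp

text \<open>The matrix \<open>V\<close> has rank at most \<open>card J\<close>, and the last two terms on the right dominate
  \<open>Tr P (R Y R)\<^sup>s\<close> for every projection \<open>P\<close> of at most that rank.\<close>

lemma trace_young:
  fixes V Y R L :: "complex^'l^'l"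
  assumes Y: "posdef Y" and R: "hermitian R" and L: "hermitian L" and RL: "R ** L = mat 1"
    and V0: "\<And>j. j \<notin> J \<Longrightarrow> column j V = 0"
    and r: "0 < r" "r < 1" and s: "s = 1 / (1 - r)" and c: "0 \<le> c"
  shows "s * rtrace (cadj V ** Y ** V) \<le>
    (s - 1) * rtrace (matfun (\<lambda>x. x powr (1/r)) (cadj V ** (L ** L) ** V)) + c * real (card J)
    + rtrace (matfun (\<lambda>x. max 0 (x powr s - c)) (R ** Y ** R))"
proof -
  have s1: "s > 1" "s - 1 = s * r" using r by (simp_all add: s field_simps)
  have LR: "L ** R = mat 1" using RL matrix_left_right_inverse by blast
  have adj: "cadj R = R" "cadj L = L" using R L by (simp_all add: hermitian_def)
  have posM: "posdef (R ** Y ** R)"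
    using posdef_congruence[OF Y LR] by (simp add: adj)
  obtain P m where P: "unitary P" and M: "R ** Y ** R = spec P (\<lambda>i. of_real (m i))" and m: "\<forall>i. 0 < m i"
    by (rule posdef_diagonalisation[OF posM])
  \<comment> \<open>In terms of \<open>T\<close> the first trace is taken against
    \<open>R Y R\<close>, and the second involves only the Gram matrix of \<open>T\<close>.\<close>
  define T where "T = L ** V"
  have VT: "V = R ** T" by (simp add: T_def matrix_mul_assoc RL)
  have G: "cadj V ** (L ** L) ** V = cadj T ** T"
    by (simp add: T_def cadj_mult adj matrix_mul_assoc)
  have VYV: "cadj V ** Y ** V = cadj T ** (R ** Y ** R) ** T"
    unfolding VT by (simp add: cadj_mult adj matrix_mul_assoc)
  have "psd (cadj T ** T)" using psd_congruence[OF posdef_imp_psd[OF posdef_mat1], of T] by simp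
  then obtain W g where W: "unitary W" and Geq: "cadj T ** T = spec W (\<lambda>i. of_real (g i))" and g: "\<forall>i. 0 \<le> g i"
    by (rule psd_diagonalisation)
  let ?w = "\<lambda>b. column b W"
  have inn: "cinner (T *v ?w i) (T *v ?w j) = (if i = j then of_real (g j) else 0)" for i j
  proof -
    have "cinner (T *v ?w i) (T *v ?w j) = cinner (?w i) ((cadj T ** T) *v ?w j)"
      using cinner_matrix[of "?w i" "cadj T" "T *v ?w j"] by (simp add: matrix_vector_mul_assoc)
    then show ?thesis unfolding Geq by (simp add: spec_column[OF W] cinner_simps cinner_columns[OF W])
  qed
  have nT: "(norm (T *v ?w b))\<^sup>2 = g b" for b
    using qform_eq_norm[of T "?w b"] unfolding Geq by (simp add: qform_spec_column[OF W])
  \<comment> \<open>Only eigenvectors with positive eigenvalue contribute; their normalised images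
    under \<open>T\<close> are the orthonormal vectors \<open>v b\<close>.\<close>
  define I where "I = {b. 0 < g b}"
  have g0: "g b = 0" if "b \<notin> I" for b using g[rule_format, of b] that by (simp add: I_def)
  have Tw0: "T *v ?w b = 0" if "b \<notin> I" for b using nT[of b] g0[OF that] by simp
  define v where "v b = of_real (1 / sqrt (g b)) *s (T *v ?w b)" for b
  have on: "cinner (v i) (v j) = (if i = j then 1 else 0)" if "i \<in> I" "j \<in> I" for i j
  proof (cases "i = j")
    case True
    have "complex_of_real (sqrt (g i)) * of_real (sqrt (g i)) = of_real (g i)"
      using that by (simp add: I_def flip: of_real_mult)
    then show ?thesis using that True by (simp add: v_def cinner_simps inn I_def field_simps)
  qed (simp add: v_def cinner_simps inn)
  \<comment> \<open>Weights of \<open>v b\<close> in the eigenbasis of \<open>R Y R\<close>: their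
    sum over \<open>a\<close> is 1 by Parseval, their sum over \<open>b\<close> at most 1 by
    Bessel.\<close>
  define p where "p b a = (cmod (cinner (column a P) (v b)))\<^sup>2" for b a
  have p0: "0 \<le> p b a" for b a by (simp add: p_def)
  have psum: "(\<Sum>a\<in>UNIV. p b a) = 1" if "b \<in> I" for b
  proof -
    have "complex_of_real ((norm (v b))\<^sup>2) = 1" unfolding cinner_self[symmetric] using on[OF that that] by simp
    then have "(norm (v b))\<^sup>2 = 1" by (metis of_real_eq_1_iff)
    then show ?thesis by (simp add: p_def parseval[OF P])
  qed
  have pbessel: "(\<Sum>b\<in>I. p b a) \<le> 1" for a
  proof -
    have "p b a = (cmod (cinner (v b) (column a P)))\<^sup>2" for b
      unfolding p_def by (metis cnj_cinner complex_mod_cnj)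
    then show ?thesis using bessel[of I v "column a P", OF _ on] by (simp add: norm_column_unitary[OF P])
  qed
  let ?k = "\<lambda>a. max 0 (m a powr s - c)"
  have bound: "s * qform (R ** Y ** R) (T *v ?w b) \<le> (s - 1) * g b powr (1/r) + c + (\<Sum>a\<in>UNIV. p b a * ?k a)"
    if b: "b \<in> I" for b
  proof -
    have gb: "g b > 0" using b by (simp add: I_def)
    define \<mu> where "\<mu> = (\<Sum>a\<in>UNIV. p b a * m a)"
    have mu0: "0 \<le> \<mu>" using m p0 by (auto simp: \<mu>_def less_imp_le intro!: sum_nonneg)
    have "T *v ?w b = of_real (sqrt (g b)) *s v b"
      using gb by (simp add: v_def vector_smult_assoc)
    then have "qform (R ** Y ** R) (T *v ?w b) = g b * qform (R ** Y ** R) (v b)"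
      using gb by (simp add: qform_smult)
    also have "qform (R ** Y ** R) (v b) = \<mu>"
      unfolding M qform_spec \<mu>_def p_def by (simp add: mult.commute)
    finally have q: "qform (R ** Y ** R) (T *v ?w b) = g b * \<mu>" .
    \<comment> \<open>\<open>s\<close> and \<open>1/r\<close> are conjugate exponents, since
      \<open>1/s = 1 - r\<close>.\<close>
    have "\<mu> * g b \<le> \<mu> powr s / s + g b powr (1/r) / (1/r)"
      using s1 r gb mu0 by (intro Youngs_inequality) (auto simp: s field_simps)
    then have "s * (\<mu> * g b) \<le> s * (\<mu> powr s / s + g b powr (1/r) / (1/r))"
      using s1 by (intro mult_left_mono) auto
    also have "\<dots> = \<mu> powr s + (s - 1) * g b powr (1/r)"
      using s1 by (simp add: distrib_left)
    finally have 1: "s * (\<mu> * g b) \<le> \<mu> powr s + (s - 1) * g b powr (1/r)" .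
    have "(\<Sum>a\<in>UNIV. p b a *\<^sub>R m a) powr s \<le> (\<Sum>a\<in>UNIV. p b a * m a powr s)"
      using convex_on_sum[OF _ _ powr_convex[of s], of UNIV "p b" m] s1 psum[OF b] p0 m by auto
    then have "\<mu> powr s \<le> (\<Sum>a\<in>UNIV. p b a * m a powr s)" by (simp add: \<mu>_def)
    \<comment> \<open>Passing from the power to the hinge costs \<open>c\<close> for each vector
      \<open>v b\<close>, hence \<open>c\<close> times their number in total.\<close>
    also have "\<dots> \<le> (\<Sum>a\<in>UNIV. p b a * (c + ?k a))"
      using p0 by (intro sum_mono mult_left_mono) auto
    also have "\<dots> = c + (\<Sum>a\<in>UNIV. p b a * ?k a)"
      using psum[OF b] by (simp add: distrib_left sum.distrib flip: sum_distrib_right)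
    finally show ?thesis using 1 unfolding q by (simp add: mult_ac)
  qed
  \<comment> \<open>Eigenvectors of \<open>cadj T ** T\<close> with positive eigenvalue vanish off
    \<open>J\<close>; summing their squared entries coordinate by coordinate bounds their number by
    \<open>card J\<close>.\<close>
  have cardI: "card I \<le> card J"
  proof -
    have wz: "?w b $ j = 0" if "b \<in> I" "j \<notin> J" for b j
    proof -
      have "column j T = 0" using V0[OF that(2)] by (simp add: T_def column_mult)
      then have "((cadj T ** T) *v ?w b) $ j = 0"
        by (simp add: cadj_mult_vec_component flip: matrix_vector_mul_assoc)
      then show ?thesis using that(1) unfolding Geq spec_column[OF W] by (simp add: I_def)
    qed
    have "real (card I) = (\<Sum>b\<in>I. \<Sum>j\<in>UNIV. (cmod (?w b $ j))\<^sup>2)"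
      unfolding norm_sum_components[symmetric] by (simp add: norm_column_unitary[OF W])
    also have "\<dots> = (\<Sum>b\<in>I. \<Sum>j\<in>J. (cmod (?w b $ j))\<^sup>2)"
      using wz by (intro sum.cong sum.mono_neutral_right) auto
    also have "\<dots> \<le> (\<Sum>b\<in>UNIV. \<Sum>j\<in>J. (cmod (?w b $ j))\<^sup>2)"
      by (intro sum_mono2) (auto intro: sum_nonneg)
    also have "\<dots> = (\<Sum>j\<in>J. \<Sum>b\<in>UNIV. (cmod (?w b $ j))\<^sup>2)" by (rule sum.swap)
    also have "\<dots> = (\<Sum>j\<in>J. 1)"
    proof (intro sum.cong refl)
      fix j
      have "(cmod (?w b $ j))\<^sup>2 = (cmod (cinner (?w b) (axis j 1)))\<^sup>2" for b
        by (metis cinner_axis_left cnj_cinner complex_mod_cnj)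
      then show "(\<Sum>b\<in>UNIV. (cmod (?w b $ j))\<^sup>2) = 1"
        using parseval[OF W, of "axis j 1"] by simp
    qed
    finally show ?thesis by simp
  qed
  have "s * rtrace (cadj V ** Y ** V) = (\<Sum>b\<in>UNIV. s * qform (R ** Y ** R) (T *v ?w b))"
    unfolding VYV rtrace_congruence_columns[OF W] by (rule sum_distrib_left)
  also have "\<dots> = (\<Sum>b\<in>I. s * qform (R ** Y ** R) (T *v ?w b))"
    using Tw0 by (intro sum.mono_neutral_right) auto
  also have "\<dots> \<le> (\<Sum>b\<in>I. (s - 1) * g b powr (1/r) + c + (\<Sum>a\<in>UNIV. p b a * ?k a))"
    by (intro sum_mono bound)
  also have "\<dots> = (s - 1) * (\<Sum>b\<in>I. g b powr (1/r)) + c * card I + (\<Sum>b\<in>I. \<Sum>a\<in>UNIV. p b a * ?k a)"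
    by (simp add: sum.distrib sum_distrib_left)
  also have "(\<Sum>b\<in>I. g b powr (1/r)) = (\<Sum>b\<in>UNIV. g b powr (1/r))"
    using g0 by (intro sum.mono_neutral_left) auto
  also have "(\<Sum>b\<in>I. \<Sum>a\<in>UNIV. p b a * ?k a) = (\<Sum>a\<in>UNIV. (\<Sum>b\<in>I. p b a) * ?k a)"
    unfolding sum_distrib_right by (rule sum.swap)
  also have "(s - 1) * (\<Sum>b\<in>UNIV. g b powr (1/r)) + c * card I + (\<Sum>a\<in>UNIV. (\<Sum>b\<in>I. p b a) * ?k a)
     \<le> (s - 1) * (\<Sum>b\<in>UNIV. g b powr (1/r)) + c * card J + (\<Sum>a\<in>UNIV. 1 * ?k a)"
    using pbessel cardI c by (intro add_mono sum_mono mult_right_mono mult_left_mono order_refl) auto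
  finally show ?thesis
    unfolding G Geq M rtrace_matfun_spec[OF W] rtrace_matfun_spec[OF P] by simp
qed

text \<open>A suitable \<open>V\<close> gives equality in \<open>trace_young\<close> for
  \<open>R\<close> and \<open>Y\<close>, and the same \<open>V\<close> is inserted into the
  inequality at both end points. \<open>HY\<close> compares the linear traces, \<open>HX\<close> the
  traces of the power \<open>1/r\<close>.\<close>

lemma trace_hinge_convex:
  fixes Y Y1 Y2 R R1 R2 L1 L2 :: "complex^'l^'l"
  assumes Y: "posdef Y" "posdef Y1" "posdef Y2" and t: "0 \<le> t" "t \<le> 1"
    and R: "posdef R" "hermitian R1" "hermitian R2" and L: "hermitian L1" "hermitian L2"
    and RL: "R1 ** L1 = mat 1" "R2 ** L2 = mat 1"
    and r: "0 < r" "r < 1" and s: "s = 1 / (1 - r)" and c: "0 \<le> c"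
    and HY: "\<And>x. qform Y x \<le> t * qform Y1 x + (1 - t) * qform Y2 x"
    and HX: "\<And>U d V. unitary U \<Longrightarrow> (\<And>i. 0 \<le> d i) \<Longrightarrow> V = R ** U ** rdiag (\<lambda>i. d i powr (1/2)) \<Longrightarrow>
       t * rtrace (matfun (\<lambda>x. x powr (1/r)) (cadj V ** (L1 ** L1) ** V))
       + (1 - t) * rtrace (matfun (\<lambda>x. x powr (1/r)) (cadj V ** (L2 ** L2) ** V)) \<le> (\<Sum>i\<in>UNIV. d i powr (1/r))"
    and h: "h = (\<lambda>x. max 0 (x powr s - c))"
  shows "rtrace (matfun h (R ** Y ** R)) \<le>
    t * rtrace (matfun h (R1 ** Y1 ** R1)) + (1 - t) * rtrace (matfun h (R2 ** Y2 ** R2))"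
proof -
  have s1: "s > 1" "(s - 1) / r = s" using r by (simp_all add: s field_simps)
  have adj: "cadj R = R" using posdef_hermitian[OF R(1)] by (simp add: hermitian_def)
  have posM: "posdef (R ** Y ** R)"
    using posdef_congruence[OF Y(1) posdef_inv(2)[OF R(1)]] by (simp add: adj)
  obtain U m where U: "unitary U" and M: "R ** Y ** R = spec U (\<lambda>i. of_real (m i))" and m: "\<forall>i. 0 < m i"
    by (rule posdef_diagonalisation[OF posM])
  \<comment> \<open>\<open>J\<close> selects the eigenvalues above the threshold, and
    \<open>d\<close> is the equality case of Young's inequality: \<open>d a * m a\<close> and
    \<open>d a powr (1/r)\<close> both equal \<open>m a powr s\<close> on \<open>J\<close> and
    vanish elsewhere.\<close>
  define J where "J = {a. c < m a powr s}"
  define d where "d a = (if a \<in> J then m a powr (s - 1) else 0)" for a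
  have d0: "0 \<le> d a" for a by (simp add: d_def)
  let ?D = "rdiag (\<lambda>i. d i powr (1/2))"
  define V where "V = R ** U ** ?D"
  have V0: "column j V = 0" if "j \<notin> J" for j
    using that unfolding V_def rdiag_eq_cdiag column_mult_cdiag by (simp add: d_def)
  have dr: "d a powr (1/r) = (if a \<in> J then m a powr s else 0)" for a
    using s1 by (simp add: d_def powr_powr)
  have VYV: "cadj V ** Y ** V = cdiag (\<lambda>a. of_real (d a * m a))"
  proof -
    have "cadj V ** Y ** V = ?D ** (cadj U ** (R ** Y ** R) ** U) ** ?D"
      by (simp add: V_def cadj_mult adj rdiag_eq_cdiag cadj_cdiag matrix_mul_assoc)
    also have "cadj U ** (R ** Y ** R) ** U = cdiag (\<lambda>i. of_real (m i))"
    proof -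
      have "cadj U ** spec U (\<lambda>i. of_real (m i)) ** U
          = (cadj U ** U) ** cdiag (\<lambda>i. of_real (m i)) ** (cadj U ** U)"
        unfolding spec_def by (simp only: matrix_mul_assoc)
      then show ?thesis unfolding M using U by simp
    qed
    finally show ?thesis
    proof -
      assume *: "cadj V ** Y ** V = ?D ** cdiag (\<lambda>i. of_real (m i)) ** ?D"
      have "d i powr (1/2) * m i * d i powr (1/2) = d i * m i" for i
        using d0[of i] by (simp add: powr_half_sqrt)
      then show ?thesis unfolding * rdiag_eq_cdiag cdiag_mult of_real_mult[symmetric] by (simp only:)
    qed
  qed
  have dm: "d a * m a = (if a \<in> J then m a powr s else 0)" for a
    using m[rule_format, of a] by (simp add: d_def powr_diff)
  define \<Sigma> where "\<Sigma> = (\<Sum>a\<in>J. m a powr s)"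
  have sumJ: "(\<Sum>a\<in>UNIV. if a \<in> J then k a else 0) = (\<Sum>a\<in>J. k a)" for k :: "'l \<Rightarrow> real"
    by (simp add: sum.If_cases)
  have trV: "rtrace (cadj V ** Y ** V) = \<Sigma>"
    unfolding VYV rtrace_def trace_cdiag by (simp add: dm sumJ \<Sigma>_def flip: of_real_sum of_real_mult)
  have mono: "rtrace (cadj V ** Y ** V) \<le> t * rtrace (cadj V ** Y1 ** V) + (1 - t) * rtrace (cadj V ** Y2 ** V)"
    unfolding rtrace_congruence_columns[OF unitary_mat1] sum_distrib_left sum.distrib[symmetric]
    by (intro sum_mono HY)
  let ?G = "\<lambda>L. rtrace (matfun (\<lambda>x. x powr (1/r)) (cadj V ** (L ** L) ** V))"
  have y1: "s * rtrace (cadj V ** Y1 ** V) \<le> (s - 1) * ?G L1 + c * real (card J) + rtrace (matfun h (R1 ** Y1 ** R1))"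
    unfolding h by (rule trace_young[OF Y(2) R(2) L(1) RL(1) V0 r s c])
  have y2: "s * rtrace (cadj V ** Y2 ** V) \<le> (s - 1) * ?G L2 + c * real (card J) + rtrace (matfun h (R2 ** Y2 ** R2))"
    unfolding h by (rule trace_young[OF Y(3) R(3) L(2) RL(2) V0 r s c])
  have "t * ?G L1 + (1 - t) * ?G L2 \<le> \<Sigma>"
    using HX[OF U d0 V_def] by (simp add: dr sumJ \<Sigma>_def)
  then have G: "(s - 1) * (t * ?G L1 + (1 - t) * ?G L2) \<le> (s - 1) * \<Sigma>"
    using s1 by (intro mult_left_mono) auto
  \<comment> \<open>Both traces of the optimal \<open>V\<close> equal \<open>\<Sigma>\<close>, and
    \<open>s - (s - 1) = 1\<close>, so what remains is \<open>\<Sigma>\<close> minus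
    \<open>c\<close> times \<open>card J\<close>, the hinge trace on the left.\<close>
  have "s * \<Sigma> \<le> s * (t * rtrace (cadj V ** Y1 ** V) + (1 - t) * rtrace (cadj V ** Y2 ** V))"
    using mono s1 unfolding trV by (intro mult_left_mono) auto
  also have "\<dots> = t * (s * rtrace (cadj V ** Y1 ** V)) + (1 - t) * (s * rtrace (cadj V ** Y2 ** V))"
    by (simp add: algebra_simps)
  also have "\<dots> \<le> t * ((s - 1) * ?G L1 + c * real (card J) + rtrace (matfun h (R1 ** Y1 ** R1)))
      + (1 - t) * ((s - 1) * ?G L2 + c * real (card J) + rtrace (matfun h (R2 ** Y2 ** R2)))"
    using t y1 y2 by (intro add_mono mult_left_mono) auto
  also have "\<dots> = (s - 1) * (t * ?G L1 + (1 - t) * ?G L2) + c * real (card J)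
      + (t * rtrace (matfun h (R1 ** Y1 ** R1)) + (1 - t) * rtrace (matfun h (R2 ** Y2 ** R2)))"
    by (simp add: algebra_simps)
  finally have "\<Sigma> - c * real (card J)
      \<le> t * rtrace (matfun h (R1 ** Y1 ** R1)) + (1 - t) * rtrace (matfun h (R2 ** Y2 ** R2))"
    using G by (simp add: algebra_simps)
  moreover have "rtrace (matfun h (R ** Y ** R)) = \<Sigma> - c * real (card J)"
  proof -
    have "h (m a) = (if a \<in> J then m a powr s - c else 0)" for a
      by (auto simp: h J_def)
    then show ?thesis
      unfolding M rtrace_matfun_spec[OF U] by (simp add: sumJ \<Sigma>_def sum_subtractf)
  qed
  ultimately show ?thesis by simp
qed

text \<open>The induction adds the points of \<open>S\<close> in increasing order; the interpolating function is affine
  to the right of the last point and stays below \<open>g\<close> there.\<close>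

lemma convex_mono_hinge_induct:
  fixes g :: "real \<Rightarrow> real"
  assumes const: "\<And>k. P (\<lambda>_. k)"
    and hinge: "\<And>\<phi> b c. P \<phi> \<Longrightarrow> 0 \<le> b \<Longrightarrow> 0 \<le> c \<Longrightarrow> P (\<lambda>x. \<phi> x + b * max 0 (x - c))"
    and g: "convex_on {0<..} g" "mono_on {0<..} g"
    and S: "finite S" "S \<subseteq> {0<..}" "S \<noteq> {}"
  shows "\<exists>\<phi>. P \<phi> \<and> (\<forall>x\<in>S. \<phi> x = g x)"
proof -
  have "\<exists>\<phi> \<alpha> \<beta>. P \<phi> \<and> (\<forall>x\<in>S. \<phi> x = g x) \<and> (\<forall>x\<ge>Max S. \<phi> x = \<alpha> + \<beta> * x) \<and> (\<forall>x\<ge>Max S. \<phi> x \<le> g x)"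
    using S
  proof (induction S rule: finite_linorder_max_induct)
    case (insert x A)
    show ?case
    proof (cases "A = {}")
      case True
      have "g x \<le> g y" if "y \<ge> x" for y
        using insert.prems that by (intro mono_onD[OF g(2)]) auto
      then show ?thesis
        using const[of "g x"] True by (intro exI[of _ "\<lambda>_. g x"] exI[of _ "g x"] exI[of _ 0]) auto
    next
      case False
      then obtain \<phi> \<alpha> \<beta> where \<phi>: "P \<phi>" "\<forall>x\<in>A. \<phi> x = g x" "\<forall>x\<ge>Max A. \<phi> x = \<alpha> + \<beta> * x" "\<forall>x\<ge>Max A. \<phi> x \<le> g x"
        using insert by auto
      define y where "y = Max A"
      have yA: "y \<in> A" unfolding y_def using insert.hyps False by (intro Max_in) auto
      have yx: "y < x" using insert.hyps yA by blast
      have y0: "y > 0" using yA insert.prems by auto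
      have Ay: "a \<le> y" if "a \<in> A" for a unfolding y_def using insert.hyps that by simp
      have Mx: "Max (insert x A) = x"
        using insert.hyps by (intro Max_eqI) auto
      \<comment> \<open>The change of slope at \<open>y\<close> that makes the new function meet
        \<open>g\<close> at \<open>x\<close>; it is nonnegative because the old function lies below
        \<open>g\<close> there.\<close>
      define b where "b = (g x - \<phi> x) / (x - y)"
      have b0: "b \<ge> 0" unfolding b_def using \<phi>(4) yx by (simp add: y_def)
      define \<psi> where "\<psi> u = \<phi> u + b * max 0 (u - y)" for u
      have \<psi>y: "\<psi> u = (\<alpha> - b * y) + (\<beta> + b) * u" if "u \<ge> y" for u
        using \<phi>(3) that by (simp add: \<psi>_def y_def algebra_simps)
      have \<psi>x: "\<psi> x = g x" using yx by (simp add: \<psi>_def b_def)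
      have \<psi>yy: "\<psi> y = g y" using \<phi>(2) yA by (simp add: \<psi>_def)
      have le: "\<psi> u \<le> g u" if "u \<ge> x" for u
      proof (cases "u = x")
        case False
        then have xu: "x < u" using that by simp
        define t where "t = (x - y) / (u - y)"
        have t: "0 < t" "t < 1" using yx xu by (simp_all add: t_def)
        have xt: "(1 - t) * y + t * u = x"
        proof -
          have "t * (u - y) = x - y" using yx xu by (simp add: t_def)
          then show ?thesis by (simp add: algebra_simps)
        qed
        \<comment> \<open>\<open>g\<close> is convex and \<open>\<psi>\<close> affine on the points
          \<open>y < x < u\<close>; as they agree at \<open>y\<close> and \<open>x\<close>,
          \<open>\<psi>\<close> cannot exceed \<open>g\<close> at \<open>u\<close>.\<close>
        have "g ((1 - t) *\<^sub>R y + t *\<^sub>R u) \<le> (1 - t) * g y + t * g u"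
          using t y0 yx xu by (intro convex_onD[OF g(1)]) auto
        then have "\<psi> x \<le> (1 - t) * \<psi> y + t * g u" by (simp add: xt \<psi>x \<psi>yy)
        moreover have "\<psi> x = (1 - t) * \<psi> y + t * \<psi> u"
        proof -
          have "\<psi> x = (\<alpha> - b * y) + (\<beta> + b) * ((1 - t) * y + t * u)" using \<psi>y[of x] yx by (simp add: xt)
          also have "\<dots> = (1 - t) * ((\<alpha> - b * y) + (\<beta> + b) * y) + t * ((\<alpha> - b * y) + (\<beta> + b) * u)"
            by (simp add: algebra_simps)
          finally show ?thesis using \<psi>y[of y] \<psi>y[of u] yx xu by simp
        qed
        ultimately have "t * \<psi> u \<le> t * g u" by simp
        then show ?thesis using t by simp
      qed (simp add: \<psi>x)
      have "P \<psi>" unfolding \<psi>_def[abs_def] using hinge[OF \<phi>(1) b0] y0 by simp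
      moreover have "\<forall>u\<in>insert x A. \<psi> u = g u"
      proof
        fix u assume "u \<in> insert x A"
        then show "\<psi> u = g u"
          using \<psi>x \<phi>(2) Ay[of u] by (cases "u = x") (auto simp: \<psi>_def)
      qed
      ultimately show ?thesis
        unfolding Mx using \<psi>y yx le
        by (intro exI[of _ \<psi>] exI[of _ "\<alpha> - b * y"] exI[of _ "\<beta> + b"]) auto
    qed
  qed simp
  then show ?thesis by blast
qed

text \<open>Only finitely many eigenvalues occur, so on their \<open>s\<close>-th powers the convex
  function \<open>g\<close> may be replaced by a constant plus nonnegative multiples of hinges, and
  each hinge is handled by \<open>trace_hinge_convex\<close>.\<close>

theorem trace_fun_convex:
  fixes Y Y1 Y2 R R1 R2 L1 L2 :: "complex^'l^'l"
  assumes Y: "posdef Y" "posdef Y1" "posdef Y2" and t: "0 \<le> t" "t \<le> 1"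
    and R: "posdef R" "hermitian R1" "hermitian R2" and L: "hermitian L1" "hermitian L2"
    and RL: "R1 ** L1 = mat 1" "R2 ** L2 = mat 1"
    and r: "0 < r" "r < 1"
    and HY: "\<And>x. qform Y x \<le> t * qform Y1 x + (1 - t) * qform Y2 x"
    and HX: "\<And>U d V. unitary U \<Longrightarrow> (\<And>i. 0 \<le> d i) \<Longrightarrow> V = R ** U ** rdiag (\<lambda>i. d i powr (1/2)) \<Longrightarrow>
       t * rtrace (matfun (\<lambda>x. x powr (1/r)) (cadj V ** (L1 ** L1) ** V))
       + (1 - t) * rtrace (matfun (\<lambda>x. x powr (1/r)) (cadj V ** (L2 ** L2) ** V)) \<le> (\<Sum>i\<in>UNIV. d i powr (1/r))"
    and f: "mono_on {0<..} f" "convex_on {0<..} (\<lambda>x. f (x powr (1 - r)))"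
  shows "rtrace (matfun f (R ** Y ** R)) \<le>
    t * rtrace (matfun f (R1 ** Y1 ** R1)) + (1 - t) * rtrace (matfun f (R2 ** Y2 ** R2))"
proof -
  define s where "s = 1 / (1 - r)"
  have pd: "posdef (K ** Z ** K)" if "posdef Z" "hermitian K" "K ** N = mat 1" for K Z N :: "complex^'l^'l"
    using posdef_congruence[OF that(1), of N K] that(2,3) matrix_left_right_inverse[of K N]
    by (simp add: hermitian_def)
  obtain U m where U: "unitary U" and M: "R ** Y ** R = spec U (\<lambda>i. of_real (m i))" and m: "\<forall>i. 0 < m i"
    by (rule posdef_diagonalisation[OF pd[OF Y(1) posdef_hermitian[OF R(1)] posdef_inv(1)[OF R(1)]]])
  obtain U1 m1 where U1: "unitary U1" and M1: "R1 ** Y1 ** R1 = spec U1 (\<lambda>i. of_real (m1 i))" and m1: "\<forall>i. 0 < m1 i"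
    by (rule posdef_diagonalisation[OF pd[OF Y(2) R(2) RL(1)]])
  obtain U2 m2 where U2: "unitary U2" and M2: "R2 ** Y2 ** R2 = spec U2 (\<lambda>i. of_real (m2 i))" and m2: "\<forall>i. 0 < m2 i"
    by (rule posdef_diagonalisation[OF pd[OF Y(3) R(3) RL(2)]])
  define P where "P \<phi> \<longleftrightarrow> (\<Sum>i\<in>UNIV. \<phi> (m i powr s)) \<le> t * (\<Sum>i\<in>UNIV. \<phi> (m1 i powr s)) + (1 - t) * (\<Sum>i\<in>UNIV. \<phi> (m2 i powr s))"
    for \<phi> :: "real \<Rightarrow> real"
  have hin: "P (\<lambda>x. max 0 (x - c))" if "0 \<le> c" for c
    using trace_hinge_convex[OF Y t R L RL r s_def that HY HX refl]
    unfolding M M1 M2 P_def by (simp add: rtrace_matfun_spec U U1 U2)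
  define g where "g x = f (x powr (1 - r))" for x
  have fg: "f x = g (x powr s)" if "0 < x" for x
    using that r by (simp add: g_def s_def powr_powr)
  have "mono_on {0<..} g"
    unfolding g_def using r by (intro mono_onI mono_onD[OF f(1)]) (auto intro: powr_mono2)
  define S where "S = range (\<lambda>i. m i powr s) \<union> range (\<lambda>i. m1 i powr s) \<union> range (\<lambda>i. m2 i powr s)"
  have pos: "0 < m i powr s" "0 < m1 i powr s" "0 < m2 i powr s" for i
    using m[rule_format, of i] m1[rule_format, of i] m2[rule_format, of i] by simp_all
  have "\<exists>\<phi>. P \<phi> \<and> (\<forall>x\<in>S. \<phi> x = g x)"
  proof (rule convex_mono_hinge_induct)
    show "P (\<lambda>_. k)" for k unfolding P_def by (simp add: algebra_simps)
    show "P (\<lambda>x. \<phi> x + b * max 0 (x - c))" if "P \<phi>" "0 \<le> b" "0 \<le> c" for \<phi> b c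
    proof -
      have "b * (\<Sum>i\<in>UNIV. max 0 (m i powr s - c))
          \<le> b * (t * (\<Sum>i\<in>UNIV. max 0 (m1 i powr s - c)) + (1 - t) * (\<Sum>i\<in>UNIV. max 0 (m2 i powr s - c)))"
        using hin[OF that(3)] that(2) unfolding P_def by (intro mult_left_mono)
      then show ?thesis
        using that(1) unfolding P_def sum.distrib sum_distrib_left[symmetric] by (simp add: algebra_simps)
    qed
    show "convex_on {0<..} g" using f(2) by (simp add: g_def[abs_def])
    show "finite S" "S \<noteq> {}" by (auto simp: S_def)
    show "S \<subseteq> {0<..}" using pos unfolding S_def by blast
  qed fact
  then obtain \<phi> where "P \<phi>" and \<phi>: "\<And>x. x \<in> S \<Longrightarrow> \<phi> x = g x" by blast
  moreover have "\<phi> (m i powr s) = f (m i)" "\<phi> (m1 i powr s) = f (m1 i)" "\<phi> (m2 i powr s) = f (m2 i)" for i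
    using m m1 m2 by (simp_all add: fg \<phi> S_def)
  ultimately show ?thesis
    unfolding M M1 M2 P_def by (simp add: rtrace_matfun_spec U U1 U2)
qed

text \<open>For \<open>p = 0\<close> the outer factor does not vary. In the eigenbasis of
  \<open>R Y R\<close> the trace is a sum of \<open>f\<close> over diagonal entries; monotonicity
  and convexity act entrywise, and \<open>peierls\<close> leads back to traces.\<close>

lemma trace_fun_convex_fixed:
  fixes Y Y1 Y2 R :: "complex^'l^'l"
  assumes Y: "posdef Y" "posdef Y1" "posdef Y2" and t: "0 \<le> t" "t \<le> 1" and R: "posdef R"
    and HY: "\<And>x. qform Y x \<le> t * qform Y1 x + (1 - t) * qform Y2 x"
    and f: "mono_on {0<..} f" "convex_on {0<..} f"
  shows "rtrace (matfun f (R ** Y ** R)) \<le>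
    t * rtrace (matfun f (R ** Y1 ** R)) + (1 - t) * rtrace (matfun f (R ** Y2 ** R))"
proof -
  have adj: "cadj R = R" using posdef_hermitian[OF R] by (simp add: hermitian_def)
  have pd: "posdef (R ** Z ** R)" if "posdef Z" for Z
    using posdef_congruence[OF that posdef_inv(2)[OF R]] by (simp add: adj)
  have qR: "qform (R ** Z ** R) x = qform Z (R *v x)" for Z x
    using qform_congruence[of R Z x] by (simp add: adj)
  obtain U m where U: "unitary U" and M: "R ** Y ** R = spec U (\<lambda>i. of_real (m i))" and m: "\<forall>i. 0 < m i"
    by (rule posdef_diagonalisation[OF pd[OF Y(1)]])
  have pei: "(\<Sum>j\<in>UNIV. f (qform (R ** Z ** R) (column j U))) \<le> rtrace (matfun f (R ** Z ** R))" if pdZ: "posdef Z" for Z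
  proof -
    obtain W k where W: "unitary W" and Z: "R ** Z ** R = spec W (\<lambda>i. of_real (k i))" and k: "\<forall>i. 0 < k i"
      by (rule posdef_diagonalisation[OF pd[OF pdZ]])
    show ?thesis unfolding Z rtrace_matfun_spec[OF W] using k by (intro peierls[OF W U f(2)]) auto
  qed
  have pos: "0 < qform (R ** Z ** R) (column j U)" if "posdef Z" for Z j
    using pd[OF that] norm_column_unitary[OF U, of j] unfolding posdef_iff by (metis norm_zero zero_neq_one)
  have "rtrace (matfun f (R ** Y ** R)) = (\<Sum>j\<in>UNIV. f (qform (R ** Y ** R) (column j U)))"
    unfolding M rtrace_matfun_spec[OF U] by (simp add: qform_spec_column[OF U])
  also have "\<dots> \<le> (\<Sum>j\<in>UNIV. t * f (qform (R ** Y1 ** R) (column j U)) + (1 - t) * f (qform (R ** Y2 ** R) (column j U)))"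
  proof (rule sum_mono)
    fix j
    let ?q = "\<lambda>Z. qform (R ** Z ** R) (column j U)"
    have le: "?q Y \<le> (1 - t) *\<^sub>R ?q Y2 + t *\<^sub>R ?q Y1" using HY[of "R *v column j U"] by (simp add: qR)
    then have "f (?q Y) \<le> f ((1 - t) *\<^sub>R ?q Y2 + t *\<^sub>R ?q Y1)"
      using pos[OF Y(1), of j] by (intro mono_onD[OF f(1)]) auto
    also have "\<dots> \<le> (1 - t) * f (?q Y2) + t * f (?q Y1)"
      using t pos Y by (intro convex_onD[OF f(2)]) auto
    finally show "f (?q Y) \<le> t * f (?q Y1) + (1 - t) * f (?q Y2)" by simp
  qed
  also have "\<dots> \<le> t * rtrace (matfun f (R ** Y1 ** R)) + (1 - t) * rtrace (matfun f (R ** Y2 ** R))"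
    unfolding sum.distrib sum_distrib_left[symmetric]
    using t by (intro add_mono mult_left_mono pei Y) auto
  finally show ?thesis .
qed

text \<open>Exponents above 1 do not preserve the operator order in general, so the comparison is
  made between diagonal entries in the eigenbasis of \<open>G\<close>, followed by
  \<open>peierls\<close> for \<open>S\<close>.\<close>

lemma trace_powr_mono:
  assumes G: "psd G" and S: "psd S" and le: "\<And>x. qform G x \<le> qform S x" and s: "1 \<le> s"
  shows "rtrace (matfun (\<lambda>x. x powr s) G) \<le> rtrace (matfun (\<lambda>x. x powr s) S)"
proof -
  obtain W g where W: "unitary W" and Geq: "G = spec W (\<lambda>i. of_real (g i))" and g: "\<forall>i. 0 \<le> g i"
    by (rule psd_diagonalisation[OF G])
  obtain U d where U: "unitary U" and Seq: "S = spec U (\<lambda>i. of_real (d i))" and d: "\<forall>i. 0 \<le> d i"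
    by (rule psd_diagonalisation[OF S])
  have "g j \<le> qform S (column j W)" for j
    using le[of "column j W"] unfolding Geq by (simp add: qform_spec_column[OF W])
  then have "(\<Sum>j\<in>UNIV. g j powr s) \<le> (\<Sum>j\<in>UNIV. qform S (column j W) powr s)"
    using g s by (intro sum_mono powr_mono2) auto
  also have "\<dots> \<le> (\<Sum>i\<in>UNIV. d i powr s)"
    unfolding Seq using d by (intro peierls[OF U W powr_convex_nonneg[OF s]]) auto
  finally show ?thesis unfolding Geq Seq rtrace_matfun_spec[OF W] rtrace_matfun_spec[OF U] .
qed

section \<open>Concavity inequalities for strictly positive maps\<close>

lemma rdiag_adj: "cadj (rdiag d) = rdiag d"
  by (simp add: rdiag_eq_cdiag cadj_cdiag)

text \<open>Normalising \<open>\<Phi>\<close> by \<open>X A\<close> gives a unital map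
  \<open>\<Theta>\<close>. The inverse of \<open>X C\<close> is not given as a value of
  \<open>\<Phi>\<close>, but \<open>posmap_schwarz\<close> dominates the matrix in question by the
  matrix \<open>S C\<close> of the interpolation theorem.\<close>

lemma trace_power_concave_inv:
  fixes \<Phi> :: "complex^'n^'n \<Rightarrow> complex^'l^'l"
  assumes lin: "clinear_map \<Phi>" and sp: "strictly_positive \<Phi>"
    and A1: "posdef A1" and A2: "posdef A2" and t: "0 \<le> t" "t \<le> 1" and r: "0 < r" "r < 1"
    and A_def: "A = cscale (of_real t) A1 + cscale (of_real (1 - t)) A2"
    and X_def: "\<And>C. X C = \<Phi> (mpow C (- r))"
    and U: "unitary U" and d: "\<And>i. 0 \<le> d i"
    and V: "V = mpow (X A) (1/2) ** U ** rdiag (\<lambda>i. d i powr (1/2))"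
  shows "t * rtrace (matfun (\<lambda>x. x powr (1/r)) (cadj V ** matrix_inv (X A1) ** V))
       + (1 - t) * rtrace (matfun (\<lambda>x. x powr (1/r)) (cadj V ** matrix_inv (X A2) ** V)) \<le> (\<Sum>i\<in>UNIV. d i powr (1/r))"
proof -
  have pm: "posmap \<Phi>" using strictly_positive_posmap[OF lin sp] .
  have A: "posdef A" unfolding A_def by (rule posdef_convex_comb[OF A1 A2 t])
  have X: "posdef (X C)" if "posdef C" for C
    using sp posdef_mpow[OF that] by (simp add: X_def strictly_positive_def)
  let ?R = "mpow (X A) (1/2)" and ?R' = "mpow (X A) (- (1/2))" and ?E = "mpow A (- (r/2))"
  let ?D = "rdiag (\<lambda>i. d i powr (1/2))"
  have adj: "cadj ?R = ?R" "cadj ?R' = ?R'" "cadj ?E = ?E"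
    by (simp_all add: hermitian_mpow X A)
  have EE: "?E ** ?E = mpow A (- r)" by (simp add: mpow_add[OF A])
  have XR: "X A ** ?R' = ?R"
  proof -
    have "X A ** ?R' = mpow (X A) 1 ** ?R'" by (simp add: mpow_one X A)
    then show ?thesis by (simp add: mpow_add X A)
  qed
  have R'R: "?R' ** ?R = mat 1" using mpow_cancel(2)[OF X[OF A], of "1/2"] by simp
  \<comment> \<open>Unital, because \<open>\<Phi>\<close> sends \<open>?E ** ?E\<close> to
    \<open>X A\<close>, which the outer inverse roots and \<open>U\<close> reduce to the
    identity.\<close>
  define \<Theta> where "\<Theta> Y = cadj (?R' ** U) ** \<Phi> (?E ** Y ** cadj ?E) ** (?R' ** U)" for Y
  have \<Theta>: "posmap \<Theta>" unfolding \<Theta>_def[abs_def] by (rule posmap_congruence[OF pm])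
  have unital: "\<Theta> (mat 1) = mat 1"
  proof -
    have "\<Theta> (mat 1) = cadj U ** (?R' ** (X A ** ?R')) ** U"
      by (simp add: \<Theta>_def adj EE cadj_mult matrix_mul_assoc flip: X_def)
    then show ?thesis using U by (simp add: XR R'R)
  qed
  define S where "S C = ?D ** \<Theta> (?E ** mpow C r ** ?E) ** ?D" for C
  have comp: "rtrace (matfun (\<lambda>x. x powr (1/r)) (cadj V ** matrix_inv (X C) ** V)) \<le> rtrace (matfun (\<lambda>x. x powr (1/r)) (S C))"
    if C: "posdef C" for C
  proof (rule trace_powr_mono)
    show "psd (cadj V ** matrix_inv (X C) ** V)"
      by (intro psd_congruence posdef_imp_psd posdef_inv(3) X C)
    have "psd (?E ** mpow C r ** ?E)"
      using psd_congruence[OF posdef_imp_psd[OF posdef_mpow[OF C, of r]], of ?E] by (simp add: adj)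
    then have "psd (\<Theta> (?E ** mpow C r ** ?E))" using \<Theta> by (simp add: posmap_def)
    from psd_congruence[OF this, of ?D] show "psd (S C)" by (simp add: S_def rdiag_adj)
    show "1 \<le> 1/r" using r by simp
    fix x
    define y where "y = U *v (?D *v x)"
    have "qform (cadj V ** matrix_inv (X C) ** V) x = qform (matrix_inv (X C)) (?R *v y)"
      unfolding qform_congruence V y_def by (simp add: matrix_vector_mul_assoc matrix_mul_assoc)
    \<comment> \<open>Pulling out \<open>X A\<close> produces the left-hand side of
      \<open>posmap_schwarz\<close>, with \<open>A^(-r)\<close> as its \<open>E\<close> and
      \<open>C^(-r)\<close> as its \<open>C\<close>.\<close>
    also have "?R *v y = X A *v (?R' *v y)"
      by (simp add: matrix_vector_mul_assoc XR)
    also have "qform (matrix_inv (X C)) (X A *v (?R' *v y)) = qform (X A ** matrix_inv (X C) ** X A) (?R' *v y)"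
      using qform_congruence[of "X A" "matrix_inv (X C)" "?R' *v y"] posdef_hermitian[OF X[OF A]]
      by (simp add: hermitian_def)
    also have "\<dots> \<le> qform (\<Phi> (mpow A (- r) ** matrix_inv (mpow C (- r)) ** mpow A (- r))) (?R' *v y)"
      unfolding X_def
      by (rule posmap_schwarz[OF pm posdef_mpow[OF C] posdef_hermitian[OF posdef_mpow[OF A]]])
        (rule X[OF C, unfolded X_def])
    also have "mpow A (- r) ** matrix_inv (mpow C (- r)) ** mpow A (- r) = ?E ** (?E ** mpow C r ** ?E) ** cadj ?E"
      unfolding adj matrix_inv_mpow[OF C] EE[symmetric] by (simp add: matrix_mul_assoc)
    also have "qform (\<Phi> (?E ** (?E ** mpow C r ** ?E) ** cadj ?E)) (?R' *v y) = qform (S C) x"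
    proof -
      have "S C = cadj ?D ** \<Theta> (?E ** mpow C r ** ?E) ** ?D" by (simp add: S_def rdiag_adj)
      then show ?thesis
        by (simp only: \<Theta>_def qform_congruence y_def matrix_vector_mul_assoc[symmetric])
    qed
    finally show "qform (cadj V ** matrix_inv (X C) ** V) x \<le> qform (S C) x" .
  qed
  have "t * rtrace (matfun (\<lambda>x. x powr (1/r)) (S A1)) + (1 - t) * rtrace (matfun (\<lambda>x. x powr (1/r)) (S A2))
    \<le> (\<Sum>i\<in>UNIV. d i powr (1/r))"
    by (rule trace_power_interpolation[OF \<Theta> unital A1 A2 t d r A_def S_def])
  moreover have "t * rtrace (matfun (\<lambda>x. x powr (1/r)) (cadj V ** matrix_inv (X A1) ** V))
       + (1 - t) * rtrace (matfun (\<lambda>x. x powr (1/r)) (cadj V ** matrix_inv (X A2) ** V))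
     \<le> t * rtrace (matfun (\<lambda>x. x powr (1/r)) (S A1)) + (1 - t) * rtrace (matfun (\<lambda>x. x powr (1/r)) (S A2))"
    using t by (intro add_mono mult_left_mono comp A1 A2) auto
  ultimately show ?thesis by linarith
qed

text \<open>Here \<open>X C\<close> itself is a value of \<open>\<Phi>\<close>, so with
  \<open>A^(r/2)\<close> inside and the inverse root of \<open>X A\<close> outside the matrices
  coincide with those of \<open>trace_power_interpolation\<close>.\<close>

lemma trace_power_concave:
  fixes \<Phi> :: "complex^'n^'n \<Rightarrow> complex^'l^'l"
  assumes lin: "clinear_map \<Phi>" and sp: "strictly_positive \<Phi>"
    and A1: "posdef A1" and A2: "posdef A2" and t: "0 \<le> t" "t \<le> 1" and r: "0 < r" "r < 1"
    and A_def: "A = cscale (of_real t) A1 + cscale (of_real (1 - t)) A2"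
    and X_def: "\<And>C. X C = \<Phi> (mpow C r)"
    and U: "unitary U" and d: "\<And>i. 0 \<le> d i"
    and V: "V = mpow (X A) (- (1/2)) ** U ** rdiag (\<lambda>i. d i powr (1/2))"
  shows "t * rtrace (matfun (\<lambda>x. x powr (1/r)) (cadj V ** X A1 ** V))
       + (1 - t) * rtrace (matfun (\<lambda>x. x powr (1/r)) (cadj V ** X A2 ** V)) \<le> (\<Sum>i\<in>UNIV. d i powr (1/r))"
proof -
  have pm: "posmap \<Phi>" using strictly_positive_posmap[OF lin sp] .
  have A: "posdef A" unfolding A_def by (rule posdef_convex_comb[OF A1 A2 t])
  have X: "posdef (X A)"
    using sp posdef_mpow[OF A] by (simp add: X_def strictly_positive_def)
  let ?R = "mpow (X A) (- (1/2))" and ?E = "mpow A (r/2)" and ?E' = "mpow A (- (r/2))"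
  let ?D = "rdiag (\<lambda>i. d i powr (1/2))"
  have adj: "cadj ?R = ?R" "cadj ?E = ?E"
    by (simp_all add: hermitian_mpow X A)
  have EE: "?E ** ?E = mpow A r" by (simp add: mpow_add[OF A])
  have RXR: "?R ** (X A ** ?R) = mat 1"
  proof -
    have "?R ** (X A ** ?R) = ?R ** (mpow (X A) 1 ** ?R)" by (simp add: mpow_one X)
    then show ?thesis by (simp add: mpow_add X mpow_zero)
  qed
  define \<Theta> where "\<Theta> Y = cadj (?R ** U) ** \<Phi> (?E ** Y ** cadj ?E) ** (?R ** U)" for Y
  have \<Theta>: "posmap \<Theta>" unfolding \<Theta>_def[abs_def] by (rule posmap_congruence[OF pm])
  have unital: "\<Theta> (mat 1) = mat 1"
  proof -
    have "\<Theta> (mat 1) = cadj U ** (?R ** (X A ** ?R)) ** U"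
      by (simp add: \<Theta>_def adj EE cadj_mult matrix_mul_assoc flip: X_def)
    then show ?thesis using U by (simp add: RXR)
  qed
  have S: "cadj V ** X C ** V = ?D ** \<Theta> (?E' ** mpow C r ** ?E') ** ?D" for C
  proof -
    have "?E ** (?E' ** mpow C r ** ?E') ** ?E = (?E ** ?E') ** mpow C r ** (?E' ** ?E)"
      by (simp only: matrix_mul_assoc)
    then have "?E ** (?E' ** mpow C r ** ?E') ** ?E = mpow C r" by (simp add: mpow_cancel[OF A])
    then show ?thesis
      by (simp add: \<Theta>_def adj V X_def cadj_mult rdiag_adj matrix_mul_assoc)
  qed
  show ?thesis
    unfolding S by (rule trace_power_interpolation[OF \<Theta> unital A1 A2 t d r A_def refl])
qed


section \<open>Joint convexity of \<open>F1\<close> and \<open>F2\<close>\<close>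

lemma convex_on_powr_one:
  fixes f :: "real \<Rightarrow> real"
  assumes "convex_on {0<..} (\<lambda>x. f (x powr 1))"
  shows "convex_on {0<..} f"
proof (rule convex_onI)
  fix t x y :: real
  assume "0 < t" "t < 1" "x \<in> {0<..}" "y \<in> {0<..}"
  moreover from this have "0 < (1 - t) * x + t * y" by (simp add: add_pos_pos)
  ultimately show "f ((1 - t) *\<^sub>R x + t *\<^sub>R y) \<le> (1 - t) * f x + t * f y"
    using convex_onD[OF assms, of t x y] by simp
qed simp

lemma jointly_convex_F1:
  fixes \<Phi> :: "complex^'n^'n \<Rightarrow> complex^'l^'l" and \<Psi> :: "complex^'m^'m \<Rightarrow> complex^'l^'l"
  assumes \<Phi>: "clinear_map \<Phi>" "strictly_positive \<Phi>" and \<Psi>: "clinear_map \<Psi>" "strictly_positive \<Psi>"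
    and f: "mono_on {0<..} f" "convex_on {0<..} (\<lambda>x. f (x powr (1 + p)))" and p: "-1 < p" "p \<le> 0"
    and q: "q \<in> {-1..0} \<union> {1..2}"
  shows "jointly_convex (F1 f \<Phi> \<Psi> p q)"
  unfolding jointly_convex_def
proof (intro allI impI, elim conjE)
  fix A1 A2 :: "complex^'n^'n" and B1 B2 :: "complex^'m^'m" and t :: real
  assume A1: "posdef A1" and A2: "posdef A2" and B1: "posdef B1" and B2: "posdef B2"
    and t: "0 \<le> t" "t \<le> 1"
  define A where "A = cscale (of_real t) A1 + cscale (of_real (1 - t)) A2"
  define B where "B = cscale (of_real t) B1 + cscale (of_real (1 - t)) B2"
  have A: "posdef A" unfolding A_def by (rule posdef_convex_comb[OF A1 A2 t])
  have B: "posdef B" unfolding B_def by (rule posdef_convex_comb[OF B1 B2 t])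
  define X where "X C = \<Phi> (mpow C p)" for C
  define Y where "Y C = \<Psi> (mpow C q)" for C
  have X: "posdef (X C)" if "posdef C" for C
    using \<Phi>(2) posdef_mpow[OF that] by (simp add: X_def strictly_positive_def)
  have Y: "posdef (Y C)" if "posdef C" for C
    using \<Psi>(2) posdef_mpow[OF that] by (simp add: Y_def strictly_positive_def)
  have HY: "qform (Y B) x \<le> t * qform (Y B1) x + (1 - t) * qform (Y B2) x" for x
    unfolding Y_def by (rule posmap_mpow_convex[OF strictly_positive_posmap[OF \<Psi>] B1 B2 t q B_def])
  define R L where "R C = mpow (X C) (1/2)" and "L C = mpow (X C) (- (1/2))" for C
  have R: "posdef (R C)" "hermitian (R C)" "hermitian (L C)" "R C ** L C = mat 1" "L C ** L C = matrix_inv (X C)"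
    if "posdef C" for C
    unfolding R_def L_def using X[OF that]
    by (simp_all add: posdef_mpow posdef_hermitian mpow_cancel mpow_add mpow_zero matrix_inv_posdef)
  have "rtrace (matfun f (R A ** Y B ** R A))
      \<le> t * rtrace (matfun f (R A1 ** Y B1 ** R A1)) + (1 - t) * rtrace (matfun f (R A2 ** Y B2 ** R A2))"
  proof (cases "p = 0")
    case True
    have "R A1 = R A" "R A2 = R A"
      using A A1 A2 by (simp_all add: R_def X_def True mpow_zero)
    moreover have "convex_on {0<..} f"
      using f(2) by (simp add: True convex_on_powr_one)
    ultimately show ?thesis
      using trace_fun_convex_fixed[OF Y[OF B] Y[OF B1] Y[OF B2] t R(1)[OF A] HY f(1)] by simp
  next
    case False
    define r where "r = - p"
    have r: "0 < r" "r < 1" and p: "p = - r" using p False by (simp_all add: r_def)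
    have Xr: "X C = \<Phi> (mpow C (- r))" for C by (simp add: X_def p)
    show ?thesis
    proof (rule trace_fun_convex[OF Y[OF B] Y[OF B1] Y[OF B2] t R(1)[OF A] R(2)[OF A1] R(2)[OF A2]
          R(3)[OF A1] R(3)[OF A2] R(4)[OF A1] R(4)[OF A2] r HY _ f(1)])
      show "convex_on {0<..} (\<lambda>x. f (x powr (1 - r)))" using f(2) by (simp add: p)
      show "t * rtrace (matfun (\<lambda>x. x powr (1/r)) (cadj V ** (L A1 ** L A1) ** V))
         + (1 - t) * rtrace (matfun (\<lambda>x. x powr (1/r)) (cadj V ** (L A2 ** L A2) ** V)) \<le> (\<Sum>i\<in>UNIV. d i powr (1/r))"
        if "unitary U" "\<And>i. 0 \<le> d i" "V = R A ** U ** rdiag (\<lambda>i. d i powr (1/2))" for U d V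
        unfolding R(5)[OF A1] R(5)[OF A2]
        by (rule trace_power_concave_inv[OF \<Phi> A1 A2 t r A_def Xr that(1,2) that(3)[unfolded R_def]])
    qed
  qed
  then show "F1 f \<Phi> \<Psi> p q (cscale (of_real t) A1 + cscale (of_real (1 - t)) A2)
          (cscale (of_real t) B1 + cscale (of_real (1 - t)) B2)
        \<le> t * F1 f \<Phi> \<Psi> p q A1 B1 + (1 - t) * F1 f \<Phi> \<Psi> p q A2 B2"
    unfolding F1_def A_def[symmetric] B_def[symmetric] X_def[symmetric] Y_def[symmetric] R_def[symmetric] .
qed

text \<open>Inverting the product makes \<open>R\<close> the inverse root of \<open>X\<close>; its
  inverse \<open>L\<close> squares to a value of \<open>\<Phi>\<close>, so the bound is
  \<open>trace_power_concave\<close>. Convexity of the inverted values of \<open>\<Psi>\<close> is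
  the hypothesis \<open>inv_convex\<close>, which a general map and the identity fulfil on different
  ranges of \<open>q\<close>.\<close>

lemma jointly_convex_F2:
  fixes \<Phi> :: "complex^'n^'n \<Rightarrow> complex^'l^'l" and \<Psi> :: "complex^'m^'m \<Rightarrow> complex^'l^'l"
  assumes \<Phi>: "clinear_map \<Phi>" "strictly_positive \<Phi>" and \<Psi>: "strictly_positive \<Psi>"
    and f: "mono_on {0<..} f" "convex_on {0<..} (\<lambda>x. f (x powr (1 + p)))" and p: "-1 < p" "p \<le> 0"
    and inv_convex: "\<And>B1 B2 t x. posdef B1 \<Longrightarrow> posdef B2 \<Longrightarrow> 0 \<le> t \<Longrightarrow> t \<le> 1 \<Longrightarrow>
      qform (matrix_inv (\<Psi> (mpow (cscale (of_real t) B1 + cscale (of_real (1 - t)) B2) (- q)))) x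
      \<le> t * qform (matrix_inv (\<Psi> (mpow B1 (- q)))) x + (1 - t) * qform (matrix_inv (\<Psi> (mpow B2 (- q)))) x"
  shows "jointly_convex (F2 f \<Phi> \<Psi> p q)"
  unfolding jointly_convex_def
proof (intro allI impI, elim conjE)
  fix A1 A2 :: "complex^'n^'n" and B1 B2 :: "complex^'m^'m" and t :: real
  assume A1: "posdef A1" and A2: "posdef A2" and B1: "posdef B1" and B2: "posdef B2"
    and t: "0 \<le> t" "t \<le> 1"
  define A where "A = cscale (of_real t) A1 + cscale (of_real (1 - t)) A2"
  define B where "B = cscale (of_real t) B1 + cscale (of_real (1 - t)) B2"
  have A: "posdef A" unfolding A_def by (rule posdef_convex_comb[OF A1 A2 t])
  have B: "posdef B" unfolding B_def by (rule posdef_convex_comb[OF B1 B2 t])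
  define X where "X C = \<Phi> (mpow C (- p))" for C
  define Z where "Z C = \<Psi> (mpow C (- q))" for C
  have X: "posdef (X C)" if "posdef C" for C
    using \<Phi>(2) posdef_mpow[OF that] by (simp add: X_def strictly_positive_def)
  have Z: "posdef (Z C)" if "posdef C" for C
    using \<Psi> posdef_mpow[OF that] by (simp add: Z_def strictly_positive_def)
  note Y = posdef_inv(3)[OF Z]
  have HY: "qform (matrix_inv (Z B)) x \<le> t * qform (matrix_inv (Z B1)) x + (1 - t) * qform (matrix_inv (Z B2)) x" for x
    unfolding Z_def B_def by (rule inv_convex[OF B1 B2 t])
  define R L where "R C = mpow (X C) (- (1/2))" and "L C = mpow (X C) (1/2)" for C
  have R: "posdef (R C)" "hermitian (R C)" "hermitian (L C)" "R C ** L C = mat 1" "L C ** L C = X C"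
      "L C ** R C = mat 1"
    if "posdef C" for C
    unfolding R_def L_def using X[OF that] mpow_cancel[OF X[OF that], of "1/2"]
    by (simp_all add: posdef_mpow posdef_hermitian mpow_add mpow_one)
  have inv: "matrix_inv (L C ** Z D ** L C) = R C ** matrix_inv (Z D) ** R C" if "posdef C" "posdef D" for C D
  proof (rule matrix_inv_eqI)
    have "L C ** Z D ** L C ** (R C ** matrix_inv (Z D) ** R C)
        = L C ** Z D ** (L C ** R C) ** matrix_inv (Z D) ** R C" by (simp only: matrix_mul_assoc)
    also have "\<dots> = L C ** (Z D ** matrix_inv (Z D)) ** R C"
      by (simp add: R(6)[OF that(1)] matrix_mul_assoc)
    also have "\<dots> = mat 1" by (simp add: R(6)[OF that(1)] posdef_inv(1)[OF Z[OF that(2)]])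
    finally show "L C ** Z D ** L C ** (R C ** matrix_inv (Z D) ** R C) = mat 1" .
  qed
  have "rtrace (matfun f (R A ** matrix_inv (Z B) ** R A))
      \<le> t * rtrace (matfun f (R A1 ** matrix_inv (Z B1) ** R A1)) + (1 - t) * rtrace (matfun f (R A2 ** matrix_inv (Z B2) ** R A2))"
  proof (cases "p = 0")
    case True
    have "R A1 = R A" "R A2 = R A"
      using A A1 A2 by (simp_all add: R_def X_def True mpow_zero)
    moreover have "convex_on {0<..} f"
      using f(2) by (simp add: True convex_on_powr_one)
    ultimately show ?thesis
      using trace_fun_convex_fixed[OF Y[OF B] Y[OF B1] Y[OF B2] t R(1)[OF A] HY f(1)] by simp
  next
    case False
    define r where "r = - p"
    have r: "0 < r" "r < 1" and p: "p = - r" using p False by (simp_all add: r_def)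
    have Xr: "X C = \<Phi> (mpow C r)" for C by (simp add: X_def p)
    show ?thesis
    proof (rule trace_fun_convex[OF Y[OF B] Y[OF B1] Y[OF B2] t R(1)[OF A] R(2)[OF A1] R(2)[OF A2]
          R(3)[OF A1] R(3)[OF A2] R(4)[OF A1] R(4)[OF A2] r HY _ f(1)])
      show "convex_on {0<..} (\<lambda>x. f (x powr (1 - r)))" using f(2) by (simp add: p)
      show "t * rtrace (matfun (\<lambda>x. x powr (1/r)) (cadj V ** (L A1 ** L A1) ** V))
         + (1 - t) * rtrace (matfun (\<lambda>x. x powr (1/r)) (cadj V ** (L A2 ** L A2) ** V)) \<le> (\<Sum>i\<in>UNIV. d i powr (1/r))"
        if "unitary U" "\<And>i. 0 \<le> d i" "V = R A ** U ** rdiag (\<lambda>i. d i powr (1/2))" for U d V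
        unfolding R(5)[OF A1] R(5)[OF A2]
        by (rule trace_power_concave[OF \<Phi> A1 A2 t r A_def Xr that(1,2) that(3)[unfolded R_def]])
    qed
  qed
  then show "F2 f \<Phi> \<Psi> p q (cscale (of_real t) A1 + cscale (of_real (1 - t)) A2)
          (cscale (of_real t) B1 + cscale (of_real (1 - t)) B2)
        \<le> t * F2 f \<Phi> \<Psi> p q A1 B1 + (1 - t) * F2 f \<Phi> \<Psi> p q A2 B2"
    unfolding F2_def A_def[symmetric] B_def[symmetric] X_def[symmetric] Z_def[symmetric] L_def[symmetric]
      inv[OF A B] inv[OF A1 B1] inv[OF A2 B2] .
qed

theorem theorem5p3:
  fixes \<Phi> :: "complex^'n^'n \<Rightarrow> complex^'l^'l"
    and \<Psi> :: "complex^'m^'m \<Rightarrow> complex^'l^'l"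
    and f :: "real \<Rightarrow> real" and p :: real
  assumes "clinear_map \<Phi>" and "strictly_positive \<Phi>"
    and "clinear_map \<Psi>" and "strictly_positive \<Psi>"
    and "mono_on {0<..} f"
    and "-1 < p" and "p \<le> 0"
    and "convex_on {0<..} (\<lambda>x. f (x powr (1 + p)))"
  shows "(\<forall>q. (q \<in> {-1..0} \<union> {1..2}) \<and> (p, q) \<noteq> (0, 0) \<longrightarrow> jointly_convex (F1 f \<Phi> \<Psi> p q))
       \<and> (\<forall>q. q \<in> {-1..0} \<and> (p, q) \<noteq> (0, 0) \<longrightarrow> jointly_convex (F2 f \<Phi> \<Psi> p q))
       \<and> (\<forall>q. q \<in> {1..2} \<and> (p, q) \<noteq> (0, 0) \<longrightarrow>
             jointly_convex (F2 f \<Phi> (id :: complex^'l^'l \<Rightarrow> complex^'l^'l) p q))"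
proof (intro conjI allI impI)
  fix q :: real assume "(q \<in> {-1..0} \<union> {1..2}) \<and> (p, q) \<noteq> (0, 0)"
  then show "jointly_convex (F1 f \<Phi> \<Psi> p q)"
    using jointly_convex_F1[OF assms(1-5) assms(8,6,7)] by blast
next
  fix q :: real assume q: "q \<in> {-1..0} \<and> (p, q) \<noteq> (0, 0)"
  show "jointly_convex (F2 f \<Phi> \<Psi> p q)"
  proof (rule jointly_convex_F2[OF assms(1,2,4,5,8,6,7)])
    fix B1 B2 :: "complex^'m^'m" and t :: real and x
    assume B1: "posdef B1" and B2: "posdef B2" and t: "0 \<le> t" "t \<le> 1"
    define B where "B = cscale (of_real t) B1 + cscale (of_real (1 - t)) B2"
    have B: "posdef B" unfolding B_def by (rule posdef_convex_comb[OF B1 B2 t])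
    have Z: "posdef (\<Psi> (mpow C (- q)))" if "posdef C" for C
      using assms(4) posdef_mpow[OF that] by (simp add: strictly_positive_def)
    show "qform (matrix_inv (\<Psi> (mpow (cscale (of_real t) B1 + cscale (of_real (1 - t)) B2) (- q)))) x
      \<le> t * qform (matrix_inv (\<Psi> (mpow B1 (- q)))) x + (1 - t) * qform (matrix_inv (\<Psi> (mpow B2 (- q)))) x"
      unfolding B_def[symmetric]
      \<comment> \<open>Since \<open>-q\<close> lies in \<open>[0, 1]\<close>, the values of
        \<open>\<Psi>\<close> are concave in \<open>B\<close>, and inversion makes them
        convex.\<close>
      using q inv_jointly_convex[OF Z[OF B] Z[OF B1] Z[OF B2] t
        posmap_mpow_concave[OF strictly_positive_posmap[OF assms(3,4)] B1 B2 t _ _ B_def, of "- q"]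
        smult_convex_comb_same[symmetric]] by simp
  qed
next
  fix q :: real assume q: "q \<in> {1..2} \<and> (p, q) \<noteq> (0, 0)"
  show "jointly_convex (F2 f \<Phi> (id :: complex^'l^'l \<Rightarrow> complex^'l^'l) p q)"
  proof (rule jointly_convex_F2[OF assms(1,2) _ assms(5,8,6,7)])
    fix B1 B2 :: "complex^'l^'l" and t :: real and x
    assume B1: "posdef B1" and B2: "posdef B2" and t: "0 \<le> t" "t \<le> 1"
    define B where "B = cscale (of_real t) B1 + cscale (of_real (1 - t)) B2"
    have B: "posdef B" unfolding B_def by (rule posdef_convex_comb[OF B1 B2 t])
    \<comment> \<open>For the identity map the inverted value is the power \<open>q\<close> itself,
      which is operator convex on \<open>[1, 2]\<close>.\<close>
    have inv: "matrix_inv (id (mpow C (- q))) = mpow C q" if "posdef C" for C :: "complex^'l^'l"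
      using matrix_inv_mpow[OF that, of "- q"] by simp
    show "qform (matrix_inv (id (mpow (cscale (of_real t) B1 + cscale (of_real (1 - t)) B2) (- q)))) x
      \<le> t * qform (matrix_inv (id (mpow B1 (- q)))) x + (1 - t) * qform (matrix_inv (id (mpow B2 (- q)))) x"
      unfolding B_def[symmetric] inv[OF B] inv[OF B1] inv[OF B2]
      using q by (intro mpow_convex_12[OF B1 B2 t _ _ B_def]) auto
  qed (simp add: strictly_positive_def)
qed

end
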